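(* Let $\tau$ be a monomial order on $S=K[x_1,\dots,x_n]$ (in the sense of the context). If $reg(gin_\tau(I))=reg(I)$ for all homogeneous ideals $I\subset S$, then $\tau=\mathrm{rlex}$.
   Context: $K$ is an algebraically closed field of characteristic $0$ and $S=K[x_1,\dots,x_n]$ is the standard graded polynomial ring; $S_1$ is its space of linear forms. A monomial order $\tau$ means a total order $>_\tau$ on the monomials of $S$ with $x_1>_\tau x_2>_\tau\dots>_\tau x_n$ that is graded ($\deg f>\deg g$ implies $f>_\tau g$ for monomials $f,g$) and multiplicative ($f>_\tau g$ implies $fh>_\tau gh$ for monomials $f,g,h$). $\mathrm{rlex}$ denotes the graded reverse lexicographic order: monomials of larger degree are larger, and for distinct monomials $x_1^{a_1}\cdots x_n^{a_n}$ and $x_1^{b_1}\cdots x_n^{b_n}$ of the same degree, the first is larger if and only if $a_K<b_K$, where $K$ here is the largest index $i$ with $a_i\neq b_i$. For a nonzero $f\in S$, $in_\tau(f)$ is its $\tau$-largest monomial, and for an ideal $I$, $in_\tau(I)$ is the monomial ideal generated by all $in_\tau(f)$, $0\neq f\in I$. A matrix $g\in GL(S_1)$ acts on $S$ by the induced linear change of coordinates. By a theorem of Galligo, for a given ideal $I$ and monomial order $\tau$ there is a nonempty Zariski open subset $U\subset GL(S_1)$ such that $in_\tau(g(I))$ is the same ideal for all $g\in U$; this ideal is the generic initial ideal, denoted $gin_\tau(I)$. For a homogeneous ideal $I$ with minimal graded free resolution $0\to\bigoplus_j S(-a_{lj})\to\cdots\to\bigoplus_j S(-a_{1j})\to\bigoplus_j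 S(-a_{0j})\to I\to 0$, the regularity $reg(I)$ is the least $d$ such that $a_{ij}\le d+i$ for all $i,j$. *)

theory Defs
  imports
    "HOL-Library.Poly_Mapping"
    "HOL-Computational_Algebra.Polynomial"
    "HOL-Analysis.Cartesian_Space"
    "Jordan_Normal_Form.Matrix_Kernel"
begin

hide_type (open) Finite_Cartesian_Product.vec

text \<open>
  The variables of the polynomial ring are indexed by a finite linearly ordered type \<open>'n\<close>:
  if \<open>i\<^sub>1 < \<dots> < i\<^sub>n\<close> are the elements of \<open>'n\<close>, then \<open>i\<^sub>k\<close> is the index of \<open>x\<^sub>k\<close>.
  Monomials are written additively, by their exponents.
\<close>

type_synonym 'n monom = "'n \<Rightarrow>\<^sub>0 nat"
type_synonym ('n, 'k) mpoly = "'n monom \<Rightarrow>\<^sub>0 'k"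

definition mdeg :: "'n::finite monom \<Rightarrow> nat" where
  "mdeg m = (\<Sum>i\<in>UNIV. Poly_Mapping.lookup m i)"

definition var_monom :: "'n \<Rightarrow> 'n monom" where
  "var_monom i = Poly_Mapping.single i 1"

definition Const :: "'k::zero \<Rightarrow> ('n, 'k) mpoly" where
  "Const c = Poly_Mapping.single 0 c"

definition Var :: "'n \<Rightarrow> ('n, 'k::comm_ring_1) mpoly" where
  "Var i = Poly_Mapping.single (var_monom i) 1"

text \<open>The image of \<open>p\<close> under the map given by \<open>c\<close> on coefficients and \<open>s\<close> on variables.\<close>

definition mpoly_subst ::
  "('k::zero \<Rightarrow> 'b::comm_ring_1) \<Rightarrow> ('n \<Rightarrow> 'b) \<Rightarrow> ('n, 'k) mpoly \<Rightarrow> 'b" where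
  "mpoly_subst c s p =
     (\<Sum>m\<in>Poly_Mapping.keys p.
        c (Poly_Mapping.lookup p m) * (\<Prod>i\<in>Poly_Mapping.keys m. s i ^ Poly_Mapping.lookup m i))"


subsection \<open>Monomial orders\<close>

text \<open>Orders are given by their strict relation: \<open>gt a b\<close> means that \<open>a\<close> is larger than \<open>b\<close>.\<close>

definition monomial_order :: "('n::{finite, linorder} monom \<Rightarrow> 'n monom \<Rightarrow> bool) \<Rightarrow> bool" where
  "monomial_order gt \<longleftrightarrow>
     (\<forall>a. \<not> gt a a) \<and>
     (\<forall>a b c. gt a b \<longrightarrow> gt b c \<longrightarrow> gt a c) \<and>
     (\<forall>a b. a \<noteq> b \<longrightarrow> gt a b \<or> gt b a) \<and>
     (\<forall>i j. i < j \<longrightarrow> gt (var_monom i) (var_monom j)) \<and>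
     (\<forall>a b. mdeg a > mdeg b \<longrightarrow> gt a b) \<and>
     (\<forall>a b c. gt a b \<longrightarrow> gt (a + c) (b + c))"

definition rlex :: "'n::{finite, linorder} monom \<Rightarrow> 'n monom \<Rightarrow> bool" where
  "rlex a b \<longleftrightarrow>
     mdeg a > mdeg b \<or>
     (mdeg a = mdeg b \<and> a \<noteq> b \<and>
      (let i = Max {i. Poly_Mapping.lookup a i \<noteq> Poly_Mapping.lookup b i}
       in Poly_Mapping.lookup a i < Poly_Mapping.lookup b i))"


subsection \<open>Ideals and initial ideals\<close>

text \<open>Ideals are the submodules of the ring regarded as a module over itself.\<close>

abbreviation ideal_gen :: "'a::comm_ring_1 set \<Rightarrow> 'a set" where
  "ideal_gen \<equiv> Modules.module.span (*)"

definition homogeneous :: "nat \<Rightarrow> ('n::finite, 'k::zero) mpoly \<Rightarrow> bool" where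
  "homogeneous d f \<longleftrightarrow> (\<forall>m\<in>Poly_Mapping.keys f. mdeg m = d)"

definition homogeneous_ideal :: "('n::finite, 'k::comm_ring_1) mpoly set \<Rightarrow> bool" where
  "homogeneous_ideal I \<longleftrightarrow> (\<exists>B. (\<forall>f\<in>B. \<exists>d. homogeneous d f) \<and> I = ideal_gen B)"

definition init_monom ::
  "('n monom \<Rightarrow> 'n monom \<Rightarrow> bool) \<Rightarrow> ('n, 'k::zero) mpoly \<Rightarrow> 'n monom" where
  "init_monom gt f = 
     (THE m. m \<in> Poly_Mapping.keys f \<and> (\<forall>m'\<in>Poly_Mapping.keys f. m' \<noteq> m \<longrightarrow> gt m m'))"

definition init_ideal ::
  "('n monom \<Rightarrow> 'n monom \<Rightarrow> bool) \<Rightarrow> ('n, 'k::comm_ring_1) mpoly set \<Rightarrow> ('n, 'k) mpoly set" where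
  "init_ideal gt I = ideal_gen {Poly_Mapping.single (init_monom gt f) 1 | f. f \<in> I \<and> f \<noteq> 0}"


subsection \<open>Generic initial ideals\<close>

text \<open>The action of a matrix \<open>g\<close> sends \<open>x\<^sub>j\<close> to the linear form given by the \<open>j\<close>-th column of \<open>g\<close>.\<close>

definition gl_act :: "'k::comm_ring_1^'n^'n \<Rightarrow> ('n::finite, 'k) mpoly \<Rightarrow> ('n, 'k) mpoly" where
  "gl_act g = mpoly_subst Const (\<lambda>j. \<Sum>i\<in>UNIV. Const (vec_nth (vec_nth g i) j) * Var i)"

text \<open>
  The topology on the general linear group is induced from the Zariski topology of the affine
  space of all matrices, whose coordinate ring has one variable for each entry.
\<close>

definition zariski_open_GL :: "('k::comm_ring_1^'n^'n) set \<Rightarrow> bool" where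
  "zariski_open_GL U \<longleftrightarrow>
     (\<exists>P :: ('n \<times> 'n, 'k) mpoly set.
        U = {g. invertible g \<and>
                (\<exists>p\<in>P. mpoly_subst (\<lambda>c. c) (\<lambda>(i, j). vec_nth (vec_nth g i) j) p \<noteq> 0)})"

text \<open>
  The description is unique because any two nonempty open subsets of the general linear group
  over an infinite field meet; existence is Galligo's theorem.
\<close>

definition gin ::
  "('n::{finite, linorder} monom \<Rightarrow> 'n monom \<Rightarrow> bool) \<Rightarrow>
   ('n, 'k::comm_ring_1) mpoly set \<Rightarrow> ('n, 'k) mpoly set" where
  "gin gt I = (THE J. \<exists>U. zariski_open_GL U \<and> U \<noteq> {} \<and>
                         (\<forall>g\<in>U. init_ideal gt (gl_act g ` I) = J))"


subsection \<open>Minimal graded free resolutions and regularity\<close>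

text \<open>
  A resolution of \<open>I\<close> consists of the free modules \<open>F\<^sub>i = \<Oplus>\<^sub>j S(-a i ! j)\<close>, the augmentation
  \<open>F\<^sub>0 \<rightarrow> I\<close> given by a vector \<open>f\<close> of generators, and the maps \<open>F\<^sub>i\<^sub>+\<^sub>1 \<rightarrow> F\<^sub>i\<close> given by the
  matrices \<open>D i\<close>. It is minimal if no map has an entry with a nonzero constant term, that is,
  if the image of each \<open>F\<^sub>i\<^sub>+\<^sub>1\<close> lies in the irrelevant maximal ideal times \<open>F\<^sub>i\<close>.
\<close>

definition minimal_graded_free_resolution ::
  "('n::finite, 'k::comm_ring_1) mpoly set \<Rightarrow> (nat \<Rightarrow> nat list) \<Rightarrow>
   ('n, 'k) mpoly vec \<Rightarrow> (nat \<Rightarrow> ('n, 'k) mpoly mat) \<Rightarrow> bool" where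
  "minimal_graded_free_resolution I a f D \<longleftrightarrow>
     (\<exists>l. \<forall>i>l. a i = []) \<and>
     f \<in> carrier_vec (length (a 0)) \<and>
     (\<forall>i. D i \<in> carrier_mat (length (a i)) (length (a (Suc i)))) \<and>
     \<comment> \<open>the maps are homogeneous of degree zero\<close>
     (\<forall>j < length (a 0). homogeneous (a 0 ! j) (vec_index f j)) \<and>
     (\<forall>i. \<forall>j < length (a i). \<forall>k < length (a (Suc i)).
        \<forall>m\<in>Poly_Mapping.keys (D i $$ (j, k)). a i ! j + mdeg m = a (Suc i) ! k) \<and>
     \<comment> \<open>exactness\<close>
     I = {scalar_prod f v | v. v \<in> carrier_vec (length (a 0))} \<and>
     {v \<in> carrier_vec (length (a 0)). scalar_prod f v = 0} =
       (\<lambda>v. D 0 *\<^sub>v v) ` carrier_vec (length (a 1)) \<and>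
     (\<forall>i. mat_kernel (D i) = (\<lambda>v. D (Suc i) *\<^sub>v v) ` carrier_vec (length (a (i + 2)))) \<and>
     \<comment> \<open>minimality\<close>
     (\<forall>i. \<forall>j < length (a i). \<forall>k < length (a (Suc i)).
        Poly_Mapping.lookup (D i $$ (j, k)) 0 = 0)"

text \<open>
  The shifts do not depend on the choice of the minimal resolution. The shifts of a nonzero ideal
  are nonnegative, and so is its regularity; the regularity of the zero ideal is \<open>0\<close>.
\<close>

definition reg :: "('n::finite, 'k::comm_ring_1) mpoly set \<Rightarrow> nat" where
  "reg I = (LEAST d. \<exists>a f D. minimal_graded_free_resolution I a f D \<and>
                            (\<forall>i. \<forall>j < length (a i). a i ! j \<le> d + i))"

end

theory Submission
  imports Defs "HOL-Analysis.Determinants"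
begin

text \<open>
  If \<open>\<tau>\<close> is not the reverse lexicographic order, cancelling common factors in two monomials that are
  compared differently yields variables \<open>x\<^sub>k > x\<^sub>z\<close>, adjacent in the order of the variables, and
  a degree \<open>d\<close> with \<open>x\<^sub>1\<^sup>d\<^sup>-\<^sup>1 x\<^sub>z >\<^sub>\<tau> x\<^sub>k\<^sup>d\<close>. Let \<open>I\<close> be generated by \<open>x\<^sub>k\<^sup>d - x\<^sub>k\<^sup>d\<^sup>-\<^sup>1 x\<^sub>z\<close> and all other
  monomials of degree \<open>d\<close> in \<open>x\<^sub>1, \<dots>, x\<^sub>k\<close>. The remaining variables form a regular sequence modulo \<open>I\<close>,
  and modulo these variables \<open>I\<close> becomes \<open>(x\<^sub>1, \<dots>, x\<^sub>k)\<^sup>d\<close>, so \<open>reg I \<le> d\<close>.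

  After a general change of coordinates, an element of \<open>I\<close> of degree \<open>d\<close> whose only term in
  \<open>x\<^sub>1, \<dots>, x\<^sub>k\<close> is \<open>x\<^sub>k\<^sup>d\<close> also has a term \<open>x\<^sub>1\<^sup>d\<^sup>-\<^sup>1 x\<^sub>z\<close>. So \<open>x\<^sub>k\<^sup>d\<close> does not lie in \<open>gin I\<close>, while a product
  of \<open>d + 1\<close> linear forms gives \<open>x\<^sub>k\<^sup>d\<^sup>+\<^sup>1 \<in> gin I\<close>. So \<open>gin I\<close> has a minimal generator of degree
  greater than \<open>d\<close>, and its regularity exceeds \<open>d\<close>.

  The results on resolutions rest on one observation: if a complex of free modules has no homology in
  the relevant degrees, then reducing it modulo one more variable creates homology only one step
  higher and one degree higher. Modulo all variables a minimal complex has zero differentials, so its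
  homology counts generators. This gives both Hilbert's syzygy theorem and the bound for \<open>reg I\<close>.
\<close>

section \<open>Polynomials and linear changes of coordinates\<close>

text \<open>Both invariants must be shown to exist before they can be compared: \<open>gin\<close>
  is a definite description, so Galligo's theorem is proved, and \<open>reg\<close> is a least
  number over actual minimal resolutions, so finite resolutions are constructed. Only
  \<open>reg I \<le> d\<close> and \<open>reg (gin I) > d\<close> are derived; neither regularity is
  computed. The binomial factors as \<open>x_k^(d-1) (x_k - x_z)\<close>. The coordinate change
  \<open>x_k -> x_k + x_u\<close> alone already produces the term \<open>x_u^(d-1) x_z\<close> that
  outranks \<open>x_k^d\<close>. For \<open>rlex\<close> this cannot happen: a monomial containing
  \<open>x_z\<close> is smaller than every monomial of the same degree in earlier variables. The
  factor \<open>x_k - x_z\<close> is the reason why \<open>x_k^(d+1)\<close> reappears one degree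
  later. Genericity always means that a polynomial in the entries of \<open>g\<close> does not
  vanish. So, apart from Galligo's theorem, each generic claim is verified at one convenient matrix,
  this change or the identity, and finitely many such polynomials are multiplied. Here the field has
  to be infinite.\<close>

abbreviation "lookup \<equiv> Poly_Mapping.lookup"
abbreviation "keys \<equiv> Poly_Mapping.keys"
abbreviation "single \<equiv> Poly_Mapping.single"

interpretation ideal: Modules.module "(*) :: 'a::comm_ring_1 \<Rightarrow> 'a \<Rightarrow> 'a"
  by unfold_locales (auto simp: algebra_simps)

text \<open>As a simp rule, this would move brackets to the left, against \<open>mult.assoc\<close>.\<close>

declare ideal.scale_scale [simp del]

section \<open>Degrees of monomials and coefficients of products\<close>

lemma mdeg_0 [simp]: "mdeg 0 = 0"
  by (simp add: mdeg_def)

lemma mdeg_add [simp]: "mdeg (a + b) = mdeg a + mdeg b"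
  by (simp add: mdeg_def lookup_add sum.distrib)

lemma mdeg_single [simp]: "mdeg (single i c) = c"
  by (simp add: mdeg_def lookup_single when_def)

lemma mdeg_var_monom [simp]: "mdeg (var_monom i) = 1"
  by (simp add: var_monom_def)

lemma lookup_le_mdeg: "lookup m i \<le> mdeg m"
  unfolding mdeg_def by (rule member_le_sum) auto

lemma mdeg_eq_0_iff [simp]: "mdeg m = 0 \<longleftrightarrow> m = 0"
  by (metis le_zero_eq lookup_le_mdeg lookup_zero mdeg_0 poly_mapping_eqI)

lemma mdeg_pos_iff [simp]: "0 < mdeg m \<longleftrightarrow> m \<noteq> 0"
  using mdeg_eq_0_iff[of m] by linarith

lemma finite_monoms_mdeg_le: "finite {m :: 'n::finite monom. mdeg m \<le> d}"
proof -
  have "lookup ` {m :: 'n monom. mdeg m \<le> d} \<subseteq> (UNIV \<rightarrow>\<^sub>E {..d})"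
    by (auto simp: PiE_iff intro: order_trans[OF lookup_le_mdeg])
  then have "finite (lookup ` {m :: 'n monom. mdeg m \<le> d})"
    by (rule finite_subset) (auto intro: finite_PiE)
  then show ?thesis
    by (rule finite_imageD) (auto intro!: inj_onI poly_mapping_eqI)
qed

lemma finite_monoms_mdeg: "finite {m :: 'n::finite monom. mdeg m = d}"
  by (rule finite_subset[OF _ finite_monoms_mdeg_le[of d]]) auto

lemma monom_diff_add: "(\<And>i. lookup b i \<le> lookup a i) \<Longrightarrow> b + (a - b) = (a :: 'n monom)"
  by (rule poly_mapping_eqI) (simp add: lookup_add lookup_minus)

lemma finite_monom_divisors: "finite {l :: 'n::finite monom. \<exists>k. m = l + k}"
  by (rule finite_subset[OF _ finite_monoms_mdeg_le[of "mdeg m"]]) auto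

lemma poly_mapping_sum_monomials:
  assumes "finite K" "keys p \<subseteq> K"
  shows "p = (\<Sum>m\<in>K. single m (lookup p m))"
proof (rule poly_mapping_eqI)
  fix k
  have "lookup (\<Sum>m\<in>K. single m (lookup p m)) k = (\<Sum>m\<in>K. (lookup p m when m = k))"
    by (simp add: lookup_sum lookup_single)
  also have "\<dots> = (\<Sum>m\<in>K. (lookup p k when m = k))"
    by (intro sum.cong) (auto simp: when_def)
  also have "\<dots> = lookup p k"
    using assms by (cases "k \<in> K") (auto simp: when_def in_keys_iff)
  finally show "lookup p k = lookup (\<Sum>m\<in>K. single m (lookup p m)) k" ..
qed

lemma lookup_single_mult_add:
  "lookup (single m c * f) (m + k) = c * lookup (f :: ('n, 'k::comm_ring_1) mpoly) k"
proof -
  have "f = (\<Sum>l\<in>insert k (keys f). single l (lookup f l))"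
    by (rule poly_mapping_sum_monomials) auto
  then have "single m c * f = single m c * (\<Sum>l\<in>insert k (keys f). single l (lookup f l))"
    by simp
  also have "\<dots> = (\<Sum>l\<in>insert k (keys f). single (m + l) (c * lookup f l))"
    by (simp only: sum_distrib_left mult_single)
  finally have "lookup (single m c * f) (m + k) =
      (\<Sum>l\<in>insert k (keys f). (c * lookup f l when m + l = m + k))"
    by (simp add: lookup_sum lookup_single)
  also have "\<dots> = (\<Sum>l\<in>insert k (keys f). (c * lookup f k when l = k))"
    by (intro sum.cong) (auto simp: when_def)
  finally show ?thesis by (simp add: when_def)
qed

lemma lookup_single_mult_not:
  assumes "\<nexists>k. l = m + k"
  shows "lookup (single m c * (f :: ('n, 'k::comm_ring_1) mpoly)) l = 0"
proof (rule ccontr)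
  assume "lookup (single m c * f) l \<noteq> 0"
  then have "l \<in> keys (single m c * f)" by (simp add: in_keys_iff)
  then show False using keys_mult[of "single m c" f] assms
    by (auto split: if_splits)
qed

lemma lookup_mult_sum:
  fixes f g :: "('n, 'k::comm_ring_1) mpoly"
  assumes "finite K" "keys f \<subseteq> K"
  shows "lookup (f * g) m = (\<Sum>l\<in>K. lookup f l * lookup (single l 1 * g) m)"
proof -
  have *: "single l c * g = single 0 c * (single l 1 * g)" for l c
    by (simp add: mult_single flip: mult.assoc)
  have "f * g = (\<Sum>l\<in>K. single l (lookup f l) * g)"
    by (subst poly_mapping_sum_monomials[OF assms]) (simp add: sum_distrib_right)
  also have "\<dots> = (\<Sum>l\<in>K. single 0 (lookup f l) * (single l 1 * g))"
    by (intro sum.cong refl *)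
  moreover have "lookup (single 0 c * h) m = c * lookup h m" for c and h :: "('n, 'k) mpoly"
    using lookup_single_mult_add[of 0 c h m] by simp
  ultimately show ?thesis
    by (simp only: lookup_sum)
qed

text \<open>The index set depends on \<open>m\<close> alone and not on the supports of the factors.
  So a coefficient of a product is a fixed polynomial expression in the coefficients of the factors,
  as \<open>polyfun_gl_act\<close> requires.\<close>

lemma lookup_mult_divisors:
  "lookup (f * g) m = (\<Sum>l | \<exists>k. m = l + k. lookup f l * lookup g (m - l))"
  for f g :: "('n::finite, 'k::comm_ring_1) mpoly"
proof -
  let ?D = "{l. \<exists>k. m = l + k}"
  have "lookup (f * g) m = (\<Sum>l\<in>keys f \<union> ?D. lookup f l * lookup (single l 1 * g) m)"
    by (rule lookup_mult_sum) (auto simp: finite_monom_divisors)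
  also have "\<dots> = (\<Sum>l\<in>?D. lookup f l * lookup (single l 1 * g) m)"
  proof (rule sum.mono_neutral_right)
    show "\<forall>l\<in>keys f \<union> ?D - ?D. lookup f l * lookup (single l 1 * g) m = 0"
    proof
      fix l assume "l \<in> keys f \<union> ?D - ?D"
      then have "\<nexists>k. m = l + k" by blast
      then have "lookup (single l 1 * g) m = 0" by (rule lookup_single_mult_not)
      then show "lookup f l * lookup (single l 1 * g) m = 0" by simp
    qed
  qed (auto simp: finite_monom_divisors)
  also have "\<dots> = (\<Sum>l\<in>?D. lookup f l * lookup g (m - l))"
    by (rule sum.cong) (auto simp: lookup_single_mult_add)
  finally show ?thesis .
qed

lemma lookup_Const_mult [simp]:
  "lookup (Const c * f) m = c * lookup (f :: ('n, 'k::comm_ring_1) mpoly) m"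
  unfolding Const_def using lookup_single_mult_add[of 0 c f m] by simp

lemma Const_0 [simp]: "Const 0 = 0" by (simp add: Const_def)
lemma Const_1 [simp]: "Const 1 = (1 :: ('n, 'k::comm_ring_1) mpoly)" by (simp add: Const_def)
lemma Const_add: "Const (a + b) = Const a + (Const b :: ('n, 'k::comm_ring_1) mpoly)"
  by (simp add: Const_def single_add)
lemma Const_mult: "Const (a * b) = Const a * (Const b :: ('n, 'k::comm_ring_1) mpoly)"
  by (simp add: Const_def mult_single)
lemma Const_uminus: "Const (- a) = - (Const a :: ('n, 'k::comm_ring_1) mpoly)"
  by (simp add: Const_def single_uminus)
lemma Const_sum: "Const (sum f A) = (\<Sum>x\<in>A. Const (f x) :: ('n, 'k::comm_ring_1) mpoly)"
  by (induction A rule: infinite_finite_induct) (auto simp: Const_add)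
lemma lookup_Const: "lookup (Const c) m = (if m = 0 then c else 0)"
  by (auto simp: Const_def lookup_single when_def)

lemma Const_mult_single: "Const c * single m d = single m (c * d :: 'k::comm_ring_1)"
  by (simp add: Const_def mult_single)

text \<open>One operator covers homogeneous components, components of vectors with shifts
  (\<open>hvec\<close>), and the separation of terms in
  \<open>var_ideal_insert_split\<close>.\<close>

definition restrict_keys :: "('n monom \<Rightarrow> bool) \<Rightarrow> ('n, 'k::zero) mpoly \<Rightarrow> ('n, 'k) mpoly" where
  "restrict_keys P f = Poly_Mapping.mapp (\<lambda>m c. if P m then c else 0) f"

lemma lookup_restrict_keys [simp]: "lookup (restrict_keys P f) m = (if P m then lookup f m else 0)"
  by (auto simp: restrict_keys_def lookup_mapp when_def in_keys_iff)

lemma keys_restrict_keys [simp]: "keys (restrict_keys P f) = {m \<in> keys f. P m}"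
  by (auto simp: in_keys_iff split: if_splits)

section \<open>Homogeneous components\<close>

abbreviation hcomp :: "nat \<Rightarrow> ('n::finite, 'k::zero) mpoly \<Rightarrow> ('n, 'k) mpoly" where
  "hcomp d \<equiv> restrict_keys (\<lambda>m. mdeg m = d)"

lemma restrict_keys_0 [simp]: "restrict_keys P 0 = 0"
  by (rule poly_mapping_eqI) simp

lemma restrict_keys_add: "restrict_keys P (f + g) = restrict_keys P f + restrict_keys P g"
  for f g :: "('n, 'k::comm_ring_1) mpoly"
  by (rule poly_mapping_eqI) (simp add: lookup_add)

lemma restrict_keys_diff: "restrict_keys P (f - g) = restrict_keys P f - restrict_keys P g"
  for f g :: "('n, 'k::comm_ring_1) mpoly"
  by (rule poly_mapping_eqI) (simp add: lookup_minus)

lemma restrict_keys_sum: "restrict_keys P (sum f A) = (\<Sum>x\<in>A. restrict_keys P (f x))"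
  for f :: "'a \<Rightarrow> ('n, 'k::comm_ring_1) mpoly"
  by (rule poly_mapping_eqI) (simp add: lookup_sum)

lemma homogeneous_hcomp [simp]: "homogeneous d (hcomp d f)"
  by (simp add: homogeneous_def)

lemma hcomp_homogeneous: "homogeneous e f \<Longrightarrow> hcomp d f = (if d = e then f else 0)"
  by (intro poly_mapping_eqI) (auto simp: homogeneous_def in_keys_iff)

lemma homogeneous_0 [simp]: "homogeneous d 0"
  by (simp add: homogeneous_def)

lemma homogeneous_single: "mdeg m = d \<Longrightarrow> homogeneous d (single m c)"
  by (simp add: homogeneous_def)

lemma homogeneous_add: "homogeneous d f \<Longrightarrow> homogeneous d g \<Longrightarrow> homogeneous d (f + g)"
  for f g :: "('n::finite, 'k::comm_ring_1) mpoly"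
  using keys_add[of f g] by (auto simp: homogeneous_def)

lemma homogeneous_uminus: "homogeneous d f \<Longrightarrow> homogeneous d (- f)"
  for f g :: "('n::finite, 'k::comm_ring_1) mpoly"
  by (auto simp: homogeneous_def in_keys_iff)

lemma homogeneous_diff: "homogeneous d f \<Longrightarrow> homogeneous d g \<Longrightarrow> homogeneous d (f - g)"
  for f g :: "('n::finite, 'k::comm_ring_1) mpoly"
  using homogeneous_add[of d f "-g"] homogeneous_uminus[of d g] by simp

lemma homogeneous_sum: "(\<And>x. x \<in> A \<Longrightarrow> homogeneous d (f x)) \<Longrightarrow> homogeneous d (sum f A)"
  for f :: "'a \<Rightarrow> ('n::finite, 'k::comm_ring_1) mpoly"
  by (induction A rule: infinite_finite_induct) (auto intro: homogeneous_add)

lemma homogeneous_mult: "homogeneous d f \<Longrightarrow> homogeneous e g \<Longrightarrow> homogeneous (d + e) (f * g)"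
  for f g :: "('n::finite, 'k::comm_ring_1) mpoly"
  using keys_mult[of f g] by (fastforce simp: homogeneous_def)

lemma homogeneous_1 [simp]: "homogeneous 0 1"
  by (simp add: homogeneous_def)

lemma homogeneous_power: "homogeneous d f \<Longrightarrow> homogeneous (n * d) (f ^ n)"
  for f g :: "('n::finite, 'k::comm_ring_1) mpoly"
  by (induction n) (auto intro: homogeneous_mult)

lemma homogeneous_Var: "homogeneous 1 (Var i)"
  unfolding Var_def by (rule homogeneous_single) simp

lemma homogeneous_Const: "homogeneous 0 (Const c)"
  unfolding Const_def by (rule homogeneous_single) simp

lemma homogeneous_Const_mult: "homogeneous d f \<Longrightarrow> homogeneous d (Const c * f)"
  for f :: "('n::finite, 'k::comm_ring_1) mpoly"
  using homogeneous_mult[OF homogeneous_Const] by fastforce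

lemma sum_hcomp:
  fixes f :: "('n::finite, 'k::comm_ring_1) mpoly"
  assumes "\<And>m. m \<in> keys f \<Longrightarrow> mdeg m < D"
  shows "f = (\<Sum>d<D. hcomp d f)"
proof (rule poly_mapping_eqI)
  fix m
  have "lookup (\<Sum>d<D. hcomp d f) m = (\<Sum>d<D. if mdeg m = d then lookup f m else 0)"
    by (simp add: lookup_sum)
  also have "\<dots> = lookup f m" using assms[of m] by (auto simp: in_keys_iff)
  finally show "lookup f m = lookup (\<Sum>d<D. hcomp d f) m" ..
qed

lemma ex_mdeg_bound: "\<exists>D. \<forall>m\<in>keys f. mdeg m < D"
  using finite_nat_set_iff_bounded[of "mdeg ` keys f"] by auto

lemma hcomp_mult_homogeneous:
  fixes f g :: "('n::finite, 'k::comm_ring_1) mpoly"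
  assumes "homogeneous e g"
  shows "hcomp d (f * g) = (if e \<le> d then hcomp (d - e) f * g else 0)"
proof -
  obtain D where D: "\<And>m. m \<in> keys f \<Longrightarrow> mdeg m < D" using ex_mdeg_bound by blast
  \<comment> \<open>The bound is raised above \<open>d\<close> so that the index
    \<open>d - e\<close> lies in the range of summation even if \<open>f\<close> has no terms of
    that degree.\<close>
  define D' where "D' = max D (Suc d)"
  have f: "f = (\<Sum>i<D'. hcomp i f)"
    by (rule sum_hcomp) (use D in \<open>auto simp: D'_def less_max_iff_disj\<close>)
  have "hcomp d (f * g) = (\<Sum>i<D'. hcomp d (hcomp i f * g))"
    by (subst f) (simp add: sum_distrib_right restrict_keys_sum)
  also have "\<dots> = (\<Sum>i<D'. if d = i + e then hcomp i f * g else 0)"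
    by (intro sum.cong refl hcomp_homogeneous homogeneous_mult) (use assms in auto)
  also have "\<dots> = (if e \<le> d then hcomp (d - e) f * g else 0)"
  proof (cases "e \<le> d")
    case True
    then have "(\<Sum>i<D'. if d = i + e then hcomp i f * g else 0) =
      (\<Sum>i<D'. if i = d - e then hcomp (d - e) f * g else 0)"
      by (intro sum.cong) auto
    then show ?thesis using True by (auto simp: D'_def)
  next
    case False
    then show ?thesis by (auto intro!: sum.neutral)
  qed
  finally show ?thesis .
qed

lemma homogeneous_lookup_0: "homogeneous d f \<Longrightarrow> mdeg m \<noteq> d \<Longrightarrow> lookup f m = 0"
  by (auto simp: homogeneous_def in_keys_iff)

section \<open>Substitution homomorphisms\<close>

definition monom_subst :: "('n \<Rightarrow> 'b::comm_ring_1) \<Rightarrow> 'n::finite monom \<Rightarrow> 'b" where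
  "monom_subst s m = (\<Prod>i\<in>UNIV. s i ^ lookup m i)"

lemma monom_subst_keys: "monom_subst s m = (\<Prod>i\<in>keys m. s i ^ lookup m i)"
  unfolding monom_subst_def by (rule prod.mono_neutral_right) (auto simp: in_keys_iff)

lemma monom_subst_0 [simp]: "monom_subst s 0 = 1"
  by (simp add: monom_subst_def)

lemma monom_subst_add: "monom_subst s (a + b) = monom_subst s a * monom_subst s b"
  by (simp add: monom_subst_def lookup_add power_add prod.distrib)

lemma monom_subst_var [simp]: "monom_subst s (single i n) = s i ^ n"
proof -
  have "monom_subst s (single i n) = (\<Prod>j\<in>UNIV. if j = i then s i ^ n else 1)"
    unfolding monom_subst_def by (intro prod.cong) (auto simp: lookup_single when_def)
  then show ?thesis by simp
qed

text \<open>There are two instances: \<open>Const\<close> for linear changes of coordinates, and the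
  identity for evaluating a coordinate polynomial at the entries of a matrix.\<close>

locale coeff_hom =
  fixes c :: "'k::comm_ring_1 \<Rightarrow> 'b::comm_ring_1"
  assumes c_0: "c 0 = 0" and c_1: "c 1 = 1"
    and c_add: "c (x + y) = c x + c y" and c_mult: "c (x * y) = c x * c y"
begin

lemma subst_superset:
  fixes s :: "'n::finite \<Rightarrow> 'b"
  assumes "finite K" "keys p \<subseteq> K"
  shows "mpoly_subst c s p = (\<Sum>m\<in>K. c (lookup p m) * monom_subst s m)"
  unfolding mpoly_subst_def monom_subst_keys[symmetric]
  by (rule sum.mono_neutral_left) (use assms in \<open>auto simp: in_keys_iff c_0\<close>)

lemma subst_0 [simp]: "mpoly_subst c s 0 = 0"
  by (simp add: mpoly_subst_def)

lemma subst_add: "mpoly_subst c s (p + q) = mpoly_subst c s p + mpoly_subst c s q"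
  for s :: "'n::finite \<Rightarrow> 'b"
proof -
  let ?K = "keys p \<union> keys q"
  have *: "finite ?K" "keys p \<subseteq> ?K" "keys q \<subseteq> ?K" "keys (p + q) \<subseteq> ?K"
    using keys_add[of p q] by auto
  show ?thesis
    using * by (simp add: subst_superset[of ?K] lookup_add c_add distrib_right sum.distrib)
qed

lemma subst_single [simp]: "mpoly_subst c s (single m a) = c a * monom_subst s m"
  for s :: "'n::finite \<Rightarrow> 'b"
  using subst_superset[of "{m}" "single m a" s] by (simp add: c_0)

lemma subst_Const: "mpoly_subst c s (Const a) = c a"
  for s :: "'n::finite \<Rightarrow> 'b"
  unfolding Const_def by simp

lemma subst_Var: "mpoly_subst c s (Var i) = s i"
  for s :: "'n::finite \<Rightarrow> 'b"
  unfolding Var_def var_monom_def by (simp add: c_1)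

lemma subst_sum: "mpoly_subst c s (sum f A) = (\<Sum>x\<in>A. mpoly_subst c s (f x))"
  for s :: "'n::finite \<Rightarrow> 'b"
  by (induction A rule: infinite_finite_induct) (auto simp: subst_add)

lemma subst_mult: "mpoly_subst c s (p * q) = mpoly_subst c s p * mpoly_subst c s q"
  for s :: "'n::finite \<Rightarrow> 'b"
proof -
  have p: "p = (\<Sum>m\<in>keys p. single m (lookup p m))" for p :: "('n, 'k) mpoly"
    by (rule poly_mapping_sum_monomials) auto
  have "mpoly_subst c s (p * q) =
      (\<Sum>m\<in>keys p. \<Sum>l\<in>keys q. mpoly_subst c s (single m (lookup p m) * single l (lookup q l)))"
    by (subst p[of p], subst p[of q]) (simp add: sum_product subst_sum)
  also have "\<dots> = (\<Sum>m\<in>keys p. \<Sum>l\<in>keys q.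
      mpoly_subst c s (single m (lookup p m)) * mpoly_subst c s (single l (lookup q l)))"
    by (intro sum.cong refl) (simp add: mult_single c_mult monom_subst_add)
  also have "\<dots> = (\<Sum>m\<in>keys p. mpoly_subst c s (single m (lookup p m))) *
      (\<Sum>l\<in>keys q. mpoly_subst c s (single l (lookup q l)))"
    by (simp add: sum_product)
  also have "\<dots> = mpoly_subst c s p * mpoly_subst c s q"
    by (simp only: subst_sum[symmetric] p[symmetric])
  finally show ?thesis .
qed

end

lemma Var_power: "Var i ^ n = single (single i n) (1 :: 'k::comm_ring_1)"
  by (induction n) (simp_all add: Var_def var_monom_def mult_single flip: single_add)

lemma single_eq_Vars:
  "single m c = Const c * (\<Prod>i\<in>UNIV. Var i ^ lookup m i)"
  for m :: "'n::finite monom" and c :: "'k::comm_ring_1"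
proof -
  have "(\<Prod>i\<in>A. Var i ^ lookup m i) = single (\<Sum>i\<in>A. single i (lookup m i)) (1 :: 'k)"
    if "finite A" for A
    using that by induction (auto simp: Var_power mult_single)
  moreover have "(\<Sum>i\<in>UNIV. single i (lookup m i)) = m"
    by (rule poly_mapping_sum_monomials[symmetric]) auto
  ultimately show ?thesis by (simp add: Const_mult_single)
qed

lemma mpoly_induct [case_names Const Var add mult]:
  fixes p :: "('n::finite, 'k::comm_ring_1) mpoly"
  assumes C: "\<And>c. P (Const c)" and V: "\<And>i. P (Var i)"
    and A: "\<And>p q. P p \<Longrightarrow> P q \<Longrightarrow> P (p + q)" and M: "\<And>p q. P p \<Longrightarrow> P q \<Longrightarrow> P (p * q)"
  shows "P p"
proof -
  have one: "P 1" using C[of 1] by simp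
  have pow: "P p \<Longrightarrow> P (p ^ n)" for p n by (induction n) (auto intro: one M)
  have "P (\<Prod>i\<in>A. Var i ^ f i)" for A and f :: "'n \<Rightarrow> nat"
    by (induction A rule: infinite_finite_induct) (auto intro: one M pow V)
  then have s: "P (single m c)" for m c
    unfolding single_eq_Vars by (intro M C)
  have "P (\<Sum>m\<in>A. single m (f m))" for A f
    by (induction A rule: infinite_finite_induct) (use C[of 0] in \<open>auto intro: A s\<close>)
  then show ?thesis by (subst poly_mapping_sum_monomials[of "keys p"]) auto
qed

interpretation Const: coeff_hom "Const :: 'k::comm_ring_1 \<Rightarrow> ('n, 'k) mpoly"
  by unfold_locales (auto simp: Const_add Const_mult)

section \<open>The action of linear changes of coordinates\<close>

lemma gl_act_0 [simp]: "gl_act g 0 = 0"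
  by (simp add: gl_act_def)

lemma gl_act_add: "gl_act g (p + q) = gl_act g p + gl_act g q"
  by (simp add: gl_act_def Const.subst_add)

lemma gl_act_mult: "gl_act g (p * q) = gl_act g p * gl_act g q"
  by (simp add: gl_act_def Const.subst_mult)

lemma gl_act_sum: "gl_act g (sum f A) = (\<Sum>x\<in>A. gl_act g (f x))"
  by (simp add: gl_act_def Const.subst_sum)

lemma gl_act_Const [simp]: "gl_act g (Const c) = Const c"
  unfolding gl_act_def by (rule Const.subst_Const)

lemma gl_act_1 [simp]: "gl_act g 1 = 1"
  using gl_act_Const[of g 1] by simp

lemma gl_act_power: "gl_act g (p ^ n) = gl_act g p ^ n"
  by (induction n) (auto simp: gl_act_mult)

lemma gl_act_Var: "gl_act g (Var j) = (\<Sum>i\<in>UNIV. Const (vec_nth (vec_nth g i) j) * Var i)"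
  unfolding gl_act_def by (rule Const.subst_Var)

lemma gl_act_uminus: "gl_act g (- p) = - gl_act g p"
  using gl_act_add[of g p "- p"] by (simp add: minus_unique)

lemma gl_act_diff: "gl_act g (p - q) = gl_act g p - gl_act g q"
  using gl_act_add[of g p "- q"] by (simp add: gl_act_uminus)

lemma gl_act_comp: "gl_act g (gl_act h p) = gl_act (g ** h) p"
proof (induction p rule: mpoly_induct)
  case (Var j)
  have "gl_act g (gl_act h (Var j)) =
      (\<Sum>l\<in>UNIV. \<Sum>i\<in>UNIV. Const (vec_nth (vec_nth h i) j) * (Const (vec_nth (vec_nth g l) i) * Var l))"
    by (simp add: gl_act_Var gl_act_sum gl_act_mult sum_distrib_left) (rule sum.swap)
  also have "\<dots> = (\<Sum>l\<in>UNIV. Const (vec_nth (vec_nth (g ** h) l) j) * Var l)"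
  proof (rule sum.cong[OF refl])
    fix l
    have "vec_nth (vec_nth (g ** h) l) j =
        (\<Sum>i\<in>UNIV. vec_nth (vec_nth h i) j * vec_nth (vec_nth g l) i)"
      unfolding matrix_matrix_mult_def by (simp add: mult.commute)
    then show "(\<Sum>i\<in>UNIV. Const (vec_nth (vec_nth h i) j) * (Const (vec_nth (vec_nth g l) i) * Var l)) =
        Const (vec_nth (vec_nth (g ** h) l) j) * Var l"
      by (simp only: Const_sum Const_mult sum_distrib_right mult.assoc)
  qed
  finally show ?case by (simp only: gl_act_Var)
qed (auto simp: gl_act_add gl_act_mult)

lemma gl_act_one:
  fixes p :: "('n::finite, 'k::comm_ring_1) mpoly"
  shows "gl_act (Finite_Cartesian_Product.mat 1) p = p"
proof (induction p rule: mpoly_induct)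
  case (Var j)
  have "gl_act (Finite_Cartesian_Product.mat 1) (Var j) = (\<Sum>i\<in>UNIV. if i = j then Var i else 0 :: ('n, 'k::comm_ring_1) mpoly)"
    unfolding gl_act_Var by (intro sum.cong) (auto simp: Finite_Cartesian_Product.mat_def)
  then show ?case by simp
qed (auto simp: gl_act_add gl_act_mult)

lemma gl_act_inverse:
  assumes "invertible g"
  obtains h where "\<And>p. gl_act h (gl_act g p) = p" "\<And>p. gl_act g (gl_act h p) = p"
proof -
  from assms obtain h where "g ** h = Finite_Cartesian_Product.mat 1" "h ** g = Finite_Cartesian_Product.mat 1" by (auto simp: invertible_def)
  then show ?thesis by (intro that[of h]) (auto simp: gl_act_comp gl_act_one)
qed

lemma gl_act_eq_0_iff: "invertible g \<Longrightarrow> gl_act g p = 0 \<longleftrightarrow> p = 0"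
  using gl_act_inverse[of g] by (metis gl_act_0)

lemma homogeneous_gl_act:
  assumes "homogeneous d p"
  shows "homogeneous d (gl_act g p)"
proof -
  have ms: "homogeneous (mdeg m) (gl_act g (single m c))" for m c
  proof -
    have *: "homogeneous (\<Sum>i\<in>A. lookup m i) (\<Prod>i\<in>A. gl_act g (Var i) ^ lookup m i)" for A
    proof (induction A rule: infinite_finite_induct)
      case (insert x F)
      have "homogeneous 1 (gl_act g (Var x))"
        unfolding gl_act_Var by (intro homogeneous_sum homogeneous_Const_mult homogeneous_Var)
      then have "homogeneous (lookup m x) (gl_act g (Var x) ^ lookup m x)"
        using homogeneous_power[of 1 "gl_act g (Var x)" "lookup m x"] by simp
      then show ?case using insert by (auto intro: homogeneous_mult)
    qed auto
    have "gl_act g (single m c) = Const c * (\<Prod>i\<in>UNIV. gl_act g (Var i) ^ lookup m i)"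
      unfolding gl_act_Var by (simp add: gl_act_def monom_subst_def)
    then show ?thesis using *[of UNIV] by (simp add: mdeg_def homogeneous_Const_mult)
  qed
  have "gl_act g p = (\<Sum>m\<in>keys p. gl_act g (single m (lookup p m)))"
    by (subst poly_mapping_sum_monomials[of "keys p" p]) (auto simp: gl_act_sum)
  also have "homogeneous d \<dots>"
    using assms ms by (intro homogeneous_sum) (auto simp: homogeneous_def[of _ p])
  finally show ?thesis .
qed

lemma hcomp_gl_act: "hcomp d (gl_act g p) = gl_act g (hcomp d p)"
proof -
  obtain D where D: "\<And>m. m \<in> keys p \<Longrightarrow> mdeg m < D" using ex_mdeg_bound by blast
  define D' where "D' = max D (Suc d)"
  have f: "p = (\<Sum>i<D'. hcomp i p)"
    by (rule sum_hcomp) (use D in \<open>auto simp: D'_def less_max_iff_disj\<close>)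
  have "hcomp d (gl_act g p) = (\<Sum>i<D'. hcomp d (gl_act g (hcomp i p)))"
    by (subst f) (simp add: gl_act_sum restrict_keys_sum)
  also have "\<dots> = (\<Sum>i<D'. if d = i then gl_act g (hcomp i p) else 0)"
    by (intro sum.cong refl hcomp_homogeneous homogeneous_gl_act) auto
  also have "\<dots> = gl_act g (hcomp d p)" by (auto simp: D'_def)
  finally show ?thesis .
qed

section \<open>Polynomial functions on matrices and generic leading terms\<close>

text \<open>Closure rules make polynomiality of determinants, coefficients and elimination steps a
  matter of introduction rules. \<open>polyfun_mpoly_subst\<close> and
  \<open>polyfun_ex_mpoly\<close> translate to and from coordinate polynomials.\<close>

inductive polyfun :: "('k::comm_ring_1^'n^'n \<Rightarrow> 'k) \<Rightarrow> bool" where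
  const: "polyfun (\<lambda>g. c)"
| entry: "polyfun (\<lambda>g. vec_nth (vec_nth g i) j)"
| add: "polyfun p \<Longrightarrow> polyfun q \<Longrightarrow> polyfun (\<lambda>g. p g + q g)"
| mult: "polyfun p \<Longrightarrow> polyfun q \<Longrightarrow> polyfun (\<lambda>g. p g * q g)"

lemma polyfun_uminus: "polyfun p \<Longrightarrow> polyfun (\<lambda>g. - p g)"
  using polyfun.mult[OF polyfun.const[of "-1"]] by fastforce

lemma polyfun_diff: "polyfun p \<Longrightarrow> polyfun q \<Longrightarrow> polyfun (\<lambda>g. p g - q g)"
  using polyfun.add[of p "\<lambda>g. - q g"] by (simp add: polyfun_uminus)

lemma polyfun_sum: "(\<And>x. x \<in> A \<Longrightarrow> polyfun (p x)) \<Longrightarrow> polyfun (\<lambda>g. \<Sum>x\<in>A. p x g)"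
  by (induction A rule: infinite_finite_induct) (auto intro: polyfun.intros)

lemma polyfun_prod: "(\<And>x. x \<in> A \<Longrightarrow> polyfun (p x)) \<Longrightarrow> polyfun (\<lambda>g. \<Prod>x\<in>A. p x g)"
  by (induction A rule: infinite_finite_induct) (auto intro: polyfun.intros)

lemma polyfun_det: "polyfun (Determinants.det :: 'k::comm_ring_1^'n^'n \<Rightarrow> 'k)"
  unfolding Determinants.det_def[abs_def]
  by (intro polyfun_sum polyfun.mult polyfun_prod polyfun.const polyfun.entry)

interpretation id_hom: coeff_hom "\<lambda>c :: 'k::comm_ring_1. c"
  by unfold_locales auto

lemma polyfun_mpoly_subst:
  "polyfun (\<lambda>g. mpoly_subst (\<lambda>c. c) (\<lambda>(i, j). vec_nth (vec_nth g i) j) p)"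
proof (induction p rule: mpoly_induct)
  case (Var x)
  show ?case unfolding id_hom.subst_Var by (cases x) (simp add: polyfun.entry)
qed (auto simp only: id_hom.subst_Const id_hom.subst_add id_hom.subst_mult intro: polyfun.intros)

lemma polyfun_ex_mpoly:
  assumes "polyfun q"
  shows "\<exists>p. \<forall>g. mpoly_subst (\<lambda>c. c) (\<lambda>(i, j). vec_nth (vec_nth g i) j) p = q g"
  using assms
proof induction
  case (const c)
  show ?case by (rule exI[of _ "Const c"]) (simp add: id_hom.subst_Const)
next
  case (entry i j)
  show ?case by (rule exI[of _ "Var (i, j)"]) (simp add: id_hom.subst_Var)
next
  case (add p q)
  then show ?case by (metis id_hom.subst_add)
next
  case (mult p q)
  then show ?case by (metis id_hom.subst_mult)
qed

lemma zariski_open_GL_basic: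
  assumes "polyfun q"
  shows "zariski_open_GL {g. invertible g \<and> q g \<noteq> 0}"
proof -
  obtain p where "\<And>g. mpoly_subst (\<lambda>c. c) (\<lambda>(i, j). vec_nth (vec_nth g i) j) p = q g"
    using polyfun_ex_mpoly[OF assms] by blast
  then show ?thesis unfolding zariski_open_GL_def by (intro exI[of _ "{p}"]) simp
qed

lemma zariski_open_GL_contains_basic:
  assumes "zariski_open_GL U" "h \<in> U"
  obtains q where "polyfun q" "q h \<noteq> 0" "{g. invertible g \<and> q g \<noteq> 0} \<subseteq> U"
proof -
  from assms obtain P where U: "U = {g. invertible g \<and>
      (\<exists>p\<in>P. mpoly_subst (\<lambda>c. c) (\<lambda>(i, j). vec_nth (vec_nth g i) j) p \<noteq> 0)}"
    unfolding zariski_open_GL_def by blast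
  with assms(2) obtain p where "p \<in> P"
    "mpoly_subst (\<lambda>c. c) (\<lambda>(i, j). vec_nth (vec_nth h i) j) p \<noteq> 0" by blast
  with U show ?thesis
    by (intro that[of "\<lambda>g. mpoly_subst (\<lambda>c. c) (\<lambda>(i, j). vec_nth (vec_nth g i) j) p"]
        polyfun_mpoly_subst) auto
qed

text \<open>The matrix at which \<open>q\<close> is nonzero may be singular;
  \<open>generic_invertible\<close> multiplies by the determinant to find an invertible one.\<close>

definition generic :: "('k::comm_ring_1^'n^'n \<Rightarrow> 'k) \<Rightarrow> bool" where
  "generic q \<longleftrightarrow> polyfun q \<and> (\<exists>g. q g \<noteq> 0)"

lemma polyfun_on_line:
  assumes "polyfun q"
  shows "\<exists>P. \<forall>t. poly P t = q (\<chi> i j. vec_nth (vec_nth a i) j + t * vec_nth (vec_nth b i) j)"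
  using assms
proof induction
  case (const c)
  show ?case by (rule exI[of _ "[:c:]"]) simp
next
  case (entry i j)
  show ?case
    by (rule exI[of _ "[:vec_nth (vec_nth a i) j, vec_nth (vec_nth b i) j:]"]) simp
next
  case (add p q)
  then show ?case by (metis poly_add)
next
  case (mult p q)
  then show ?case by (metis poly_mult)
qed

text \<open>Two polynomial functions are compared on the line through points where they do not vanish.\<close>

lemma generic_mult:
  fixes p q :: "'k::{idom, ring_char_0}^'n^'n \<Rightarrow> 'k"
  assumes "generic p" "generic q"
  shows "generic (\<lambda>g. p g * q g)"
proof -
  from assms obtain g0 g1 where g: "p g0 \<noteq> 0" "q g1 \<noteq> 0" and pq: "polyfun p" "polyfun q"
    by (auto simp: generic_def)
  define b where "b = (\<chi> i j. vec_nth (vec_nth g1 i) j - vec_nth (vec_nth g0 i) j)"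
  let ?l = "\<lambda>t. (\<chi> i j. vec_nth (vec_nth g0 i) j + t * vec_nth (vec_nth b i) j)"
  obtain P Q where P: "\<And>t. poly P t = p (?l t)" and Q: "\<And>t. poly Q t = q (?l t)"
    using pq[THEN polyfun_on_line] by metis
  have "?l 0 = g0" "?l 1 = g1" by (simp_all add: b_def Finite_Cartesian_Product.vec_eq_iff)
  then have "P \<noteq> 0" "Q \<noteq> 0" using P[of 0] Q[of 1] g by auto
  then have "finite {t. poly (P * Q) t = 0}" by (intro poly_roots_finite) simp
  then obtain t where "poly (P * Q) t \<noteq> 0"
    using infinite_UNIV_char_0[where 'a = 'k] by (metis (mono_tags, lifting) Collect_cong UNIV_I Collect_mem_eq mem_Collect_eq top_set_def)
  then have "p (?l t) * q (?l t) \<noteq> 0" using P Q by simp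
  then show ?thesis using pq unfolding generic_def by (blast intro: polyfun.mult)
qed

lemma generic_1: "generic (\<lambda>g. 1)"
  by (auto simp: generic_def intro: polyfun.const)

lemma generic_prod:
  fixes q :: "'a \<Rightarrow> 'k::{idom, ring_char_0}^'n^'n \<Rightarrow> 'k"
  assumes "\<And>x. x \<in> A \<Longrightarrow> generic (q x)"
  shows "generic (\<lambda>g. \<Prod>x\<in>A. q x g)"
  using assms by (induction A rule: infinite_finite_induct) (auto intro: generic_1 generic_mult)

lemma generic_invertible:
  fixes q :: "'k::field_char_0^'n^'n \<Rightarrow> 'k"
  assumes "generic q"
  obtains g where "invertible g" "q g \<noteq> 0"
proof -
  have "generic (Determinants.det :: 'k^'n^'n \<Rightarrow> 'k)"
    unfolding generic_def by (auto simp: polyfun_det intro!: exI[of _ "Finite_Cartesian_Product.mat 1"])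
  from generic_mult[OF this assms] obtain g :: "'k^'n^'n" where "Determinants.det g \<noteq> 0" "q g \<noteq> 0"
    by (auto simp: generic_def)
  then show ?thesis using that by (simp add: invertible_det_nz)
qed

section \<open>Gaussian elimination with entries that depend on a matrix\<close>

definition indep :: "'j set \<Rightarrow> 'm set \<Rightarrow> ('j \<Rightarrow> 'm \<Rightarrow> 'k::field) \<Rightarrow> bool" where
  "indep J T v \<longleftrightarrow> (\<forall>c. (\<forall>m\<in>T. (\<Sum>j\<in>J. c j * v j m) = 0) \<longrightarrow> (\<forall>j\<in>J. c j = 0))"

text \<open>These are the pivot columns of the matrix with rows \<open>v j\<close>, its columns
  ordered by \<open>gt\<close>. They are defined by the row space and not by a particular echelon
  form.\<close>

definition leads :: "('m \<Rightarrow> 'm \<Rightarrow> bool) \<Rightarrow> 'j set \<Rightarrow> 'm set \<Rightarrow> ('j \<Rightarrow> 'm \<Rightarrow> 'k::field) \<Rightarrow> 'm set" where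
  "leads gt J T v = {m\<in>T. \<exists>c. (\<Sum>j\<in>J. c j * v j m) \<noteq> 0 \<and>
     (\<forall>m'\<in>T. gt m' m \<longrightarrow> (\<Sum>j\<in>J. c j * v j m') = 0)}"

lemma leadsI:
  assumes "m \<in> T" "(\<Sum>j\<in>J. c j * v j m) \<noteq> 0"
    "\<And>m'. m' \<in> T \<Longrightarrow> gt m' m \<Longrightarrow> (\<Sum>j\<in>J. c j * v j m') = 0"
  shows "m \<in> leads gt J T v"
  unfolding leads_def using assms by blast

text \<open>The row is multiplied by the pivot instead of divided by it, so entries that are
  polynomial functions of \<open>g\<close> remain polynomial.\<close>

definition eliminate :: "'j \<Rightarrow> 'm \<Rightarrow> ('j \<Rightarrow> 'm \<Rightarrow> 'k::field) \<Rightarrow> 'j \<Rightarrow> 'm \<Rightarrow> 'k" where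
  "eliminate i x v j m = v i x * v j m - v j x * v i m"

lemma sum_eliminate:
  "(\<Sum>j\<in>J. c j * eliminate i x v j m) =
    v i x * (\<Sum>j\<in>J. c j * v j m) - (\<Sum>j\<in>J. c j * v j x) * v i m"
  by (simp add: eliminate_def sum_distrib_left sum_distrib_right sum_subtractf[symmetric] algebra_simps)

lemma indepD: "indep J T v \<Longrightarrow> (\<And>m. m \<in> T \<Longrightarrow> (\<Sum>j\<in>J. c j * v j m) = 0) \<Longrightarrow> j \<in> J \<Longrightarrow> c j = 0"
  unfolding indep_def by blast

lemma indep_eliminate:
  assumes J: "finite J" "i \<notin> J" and x: "v i x \<noteq> 0" and ind: "indep (insert i J) T v"
  shows "indep J T (eliminate i x v)"
  unfolding indep_def
proof (intro allI impI ballI)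
  fix c j assume c: "\<forall>m\<in>T. (\<Sum>j\<in>J. c j * eliminate i x v j m) = 0" and j: "j \<in> J"
  \<comment> \<open>A relation between eliminated rows, expanded into a relation between the
    original ones; row \<open>i\<close> receives whatever the eliminations subtracted.\<close>
  let ?d = "\<lambda>j. if j = i then - (\<Sum>j\<in>J. c j * v j x) else v i x * c j"
  have *: "(\<Sum>j\<in>J. ?d j * v j m) = v i x * (\<Sum>j\<in>J. c j * v j m)" for m
    unfolding sum_distrib_left using J by (intro sum.cong) auto
  have "(\<Sum>j\<in>insert i J. ?d j * v j m) = 0" if "m \<in> T" for m
    using c[rule_format, OF that] J by (simp only: sum_eliminate sum.insert * if_True simp_thms) simp
  from indepD[OF ind this, of j] j J x show "c j = 0" by (auto split: if_splits)
qed

text \<open>A relation between all rows, read in column \<open>x\<close>, determines the coefficient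
  of row \<open>i\<close> from the others. So it is a relation between the eliminated rows.\<close>

lemma indep_if_eliminate:
  assumes J: "finite J" "i \<notin> J" and x: "x \<in> T" "v i x \<noteq> 0" and ind: "indep J T (eliminate i x v)"
  shows "indep (insert i J) T v"
  unfolding indep_def
proof (intro allI impI)
  fix c assume c: "\<forall>m\<in>T. (\<Sum>j\<in>insert i J. c j * v j m) = 0"
  have s: "(\<Sum>j\<in>J. c j * v j m) = - (c i * v i m)" if "m \<in> T" for m
    using c[rule_format, OF that] J by (simp add: add_eq_0_iff)
  have "(\<Sum>j\<in>J. c j * eliminate i x v j m) = 0" if "m \<in> T" for m
    by (simp only: sum_eliminate s[OF that] s[OF x(1)]) simp
  then have *: "\<forall>j\<in>J. c j = 0" using indepD[OF ind] by blast
  then have "(\<Sum>j\<in>J. c j * v j x) = 0" by simp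
  then have "c i = 0" using s[OF x(1)] x by simp
  with * show "\<forall>j\<in>insert i J. c j = 0" by simp
qed

lemma indep_ex_nonzero:
  assumes "indep (insert i J) T v" "finite J" "i \<notin> J"
  shows "\<exists>x\<in>T. v i x \<noteq> 0"
proof (rule ccontr)
  assume z: "\<not> ?thesis"
  have "(\<Sum>j\<in>insert i J. (if j = i then 1 else 0) * v j m) = 0" if "m \<in> T" for m
    using z that assms(2,3) by (auto intro!: sum.neutral)
  from indepD[OF assms(1) this, of i] show False by simp
qed

lemma polyfun_eliminate:
  assumes "\<And>j m. j \<in> insert i J \<Longrightarrow> m \<in> T \<Longrightarrow> polyfun (\<lambda>g. w g j m)" "j \<in> J" "m \<in> T" "x \<in> T"
  shows "polyfun (\<lambda>g. eliminate i x (w g) j m)"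
  unfolding eliminate_def using assms by (intro polyfun_diff polyfun.mult) auto

text \<open>The polynomial is the product of the pivots of an elimination that succeeds at
  \<open>g0\<close>; wherever it does not vanish, the same elimination succeeds.\<close>

lemma indep_open:
  fixes w :: "'k::field^'n^'n \<Rightarrow> 'j \<Rightarrow> 'm \<Rightarrow> 'k"
  assumes "finite J" "\<And>j m. j \<in> J \<Longrightarrow> m \<in> T \<Longrightarrow> polyfun (\<lambda>g. w g j m)" "indep J T (w g0)"
  shows "\<exists>q. polyfun q \<and> q g0 \<noteq> 0 \<and> (\<forall>g. q g \<noteq> 0 \<longrightarrow> indep J T (w g))"
  using assms
proof (induction J arbitrary: w rule: finite_induct)
  case empty
  show ?case by (rule exI[of _ "\<lambda>g. 1"]) (simp add: polyfun.const indep_def)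
next
  case (insert i J)
  obtain x where x: "x \<in> T" "w g0 i x \<noteq> 0"
    using indep_ex_nonzero[OF insert.prems(2)] insert.hyps by auto
  have "\<exists>q. polyfun q \<and> q g0 \<noteq> 0 \<and> (\<forall>g. q g \<noteq> 0 \<longrightarrow> indep J T (eliminate i x (w g)))"
    using insert.prems x insert.hyps
    by (intro insert.IH indep_eliminate polyfun_eliminate[where J = J and T = T]) auto
  then obtain q where q: "polyfun q" "q g0 \<noteq> 0" "\<And>g. q g \<noteq> 0 \<Longrightarrow> indep J T (eliminate i x (w g))"
    by blast
  have "polyfun (\<lambda>g. q g * w g i x)" using q insert.prems x by (intro polyfun.mult) auto
  moreover have "indep (insert i J) T (w g)" if "q g * w g i x \<noteq> 0" for g
    using that q(3) x insert.hyps by (intro indep_if_eliminate[of J i x T]) auto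
  ultimately show ?case using q(2) x by (intro exI[of _ "\<lambda>g. q g * w g i x"]) auto
qed

text \<open>Kept apart from monomial orders since it is also instantiated with the order
  \<open>pot\<close> on the terms of a free module.\<close>

locale strict_total =
  fixes gt :: "'m \<Rightarrow> 'm \<Rightarrow> bool"
  assumes irrefl: "\<not> gt a a" and trans: "gt a b \<Longrightarrow> gt b c \<Longrightarrow> gt a c"
    and total: "a \<noteq> b \<Longrightarrow> gt a b \<or> gt b a"
begin

lemma asym: "gt a b \<Longrightarrow> \<not> gt b a"
  using irrefl trans by blast

lemma ex_greatest:
  assumes "finite A" "A \<noteq> {}"
  shows "\<exists>m\<in>A. \<forall>m'\<in>A. m' \<noteq> m \<longrightarrow> gt m m'"
  using assms
proof (induction rule: finite_ne_induct)
  case (insert x F)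
  then obtain m where m: "m \<in> F" "\<forall>m'\<in>F. m' \<noteq> m \<longrightarrow> gt m m'" by blast
  show ?case using total[of x m] m insert.hyps trans by (cases "gt x m") (auto, metis)
qed auto

text \<open>No row is nonzero in a column above \<open>x\<close>. So a nonzero combination either
  leads in \<open>x\<close> or vanishes there, and in the second case its multiple by the pivot is a
  combination of the eliminated rows.\<close>

lemma leads_eliminate:
  assumes J: "finite J" "i \<notin> J" and x: "x \<in> T" "v i x \<noteq> 0"
    and top: "\<And>j m. j \<in> insert i J \<Longrightarrow> m \<in> T \<Longrightarrow> gt m x \<Longrightarrow> v j m = 0"
  shows "leads gt (insert i J) T v = insert x (leads gt J T (eliminate i x v))"
    and "x \<notin> leads gt J T (eliminate i x v)"
proof -
  let ?v = "eliminate i x v"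
  have vx: "(\<Sum>j\<in>J. c j * ?v j x) = 0" for c
    unfolding sum_eliminate by simp
  have topv: "?v j m = 0" if "j \<in> J" "m \<in> T" "gt m x" for j m
    using top[of _ m] that by (simp add: eliminate_def)
  show "x \<notin> leads gt J T ?v" unfolding leads_def using vx by auto
  show "leads gt (insert i J) T v = insert x (leads gt J T ?v)"
  proof (intro equalityI subsetI)
    fix m assume "m \<in> leads gt (insert i J) T v"
    then obtain c where m: "m \<in> T" and c: "(\<Sum>j\<in>insert i J. c j * v j m) \<noteq> 0"
      "\<And>m'. m' \<in> T \<Longrightarrow> gt m' m \<Longrightarrow> (\<Sum>j\<in>insert i J. c j * v j m') = 0"
      unfolding leads_def by blast
    show "m \<in> insert x (leads gt J T ?v)"
    proof (cases "m = x")
      case False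
      have "\<not> gt m x"
      proof
        assume "gt m x"
        then have "(\<Sum>j\<in>insert i J. c j * v j m) = 0" using top m by (intro sum.neutral) simp
        with c(1) show False by blast
      qed
      with False have xm: "gt x m" using total by blast
      have "(\<Sum>j\<in>insert i J. c j * v j x) = 0" using c(2)[OF x(1) xm] .
      then have s: "(\<Sum>j\<in>J. c j * v j x) = - (c i * v i x)" using J by (simp add: add_eq_0_iff)
      have E: "(\<Sum>j\<in>J. c j * ?v j m') = v i x * (\<Sum>j\<in>insert i J. c j * v j m')" for m'
        unfolding sum_eliminate s using J by (simp add: algebra_simps)
      have "m \<in> leads gt J T ?v"
      proof (rule leadsI[where c = c, OF m])
        show "(\<Sum>j\<in>J. c j * ?v j m) \<noteq> 0" unfolding E using c(1) x(2) by simp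
        show "(\<Sum>j\<in>J. c j * ?v j m') = 0" if "m' \<in> T" "gt m' m" for m'
          unfolding E c(2)[OF that] by simp
      qed
      then show ?thesis by blast
    qed simp
  next
    fix m assume "m \<in> insert x (leads gt J T ?v)"
    then consider "m = x" | "m \<in> leads gt J T ?v" by blast
    then show "m \<in> leads gt (insert i J) T v"
    proof cases
      case 1
      let ?c = "\<lambda>j. if j = i then 1 else 0"
      have "(\<Sum>j\<in>J. ?c j * v j m') = 0" for m' using J by (intro sum.neutral) auto
      then have "(\<Sum>j\<in>insert i J. ?c j * v j m') = v i m'" for m' using J by simp
      then show ?thesis unfolding 1 using x top by (intro leadsI[where c = ?c]) simp_all
    next
      case 2
      then obtain c where m: "m \<in> T" and c: "(\<Sum>j\<in>J. c j * ?v j m) \<noteq> 0"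
        "\<And>m'. m' \<in> T \<Longrightarrow> gt m' m \<Longrightarrow> (\<Sum>j\<in>J. c j * ?v j m') = 0"
        unfolding leads_def by blast
      let ?d = "\<lambda>j. if j = i then - (\<Sum>j\<in>J. c j * v j x) else v i x * c j"
      have *: "(\<Sum>j\<in>J. ?d j * v j m) = v i x * (\<Sum>j\<in>J. c j * v j m)" for m
        unfolding sum_distrib_left using J by (intro sum.cong) auto
      have "(\<Sum>j\<in>insert i J. ?d j * v j m') = (\<Sum>j\<in>J. c j * ?v j m')" for m'
        using J by (simp only: sum_eliminate sum.insert * if_True simp_thms) simp
      then show ?thesis using c by (intro leadsI[where c = ?d, OF m]) simp_all
    qed
  qed
qed

text \<open>This is elimination over the polynomial functions, without division. The product of the
  pivots is \<open>q\<close>; where it does not vanish, the pivot columns do not depend on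
  \<open>g\<close>.\<close>

lemma generic_leads:
  fixes w :: "'k::field_char_0^'n^'n \<Rightarrow> 'j \<Rightarrow> 'm \<Rightarrow> 'k"
  assumes "finite J" "finite T" "\<And>j m. j \<in> J \<Longrightarrow> m \<in> T \<Longrightarrow> polyfun (\<lambda>g. w g j m)" "indep J T (w g0)"
  shows "\<exists>M q. M \<subseteq> T \<and> card M = card J \<and> generic q \<and> (\<forall>g. q g \<noteq> 0 \<longrightarrow> leads gt J T (w g) = M)"
  using assms
proof (induction "card J" arbitrary: J w g0)
  case 0
  then show ?case
    by (intro exI[of _ "{}"] exI[of _ "\<lambda>g. 1"]) (auto simp: generic_1 leads_def)
next
  case (Suc n)
  \<comment> \<open>A column counts as soon as it is nonzero for some \<open>g\<close>, so all
    columns above the largest one in this set vanish identically.\<close>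
  let ?X = "{m \<in> T. \<exists>j\<in>J. \<exists>g. w g j m \<noteq> 0}"
  have "?X \<noteq> {}"
  proof -
    obtain i where i: "i \<in> J" using Suc.hyps(2) by fastforce
    then have "J = insert i (J - {i})" by blast
    then show ?thesis using indep_ex_nonzero[of i "J - {i}" T "w g0"] Suc.prems i by fastforce
  qed
  then obtain x where x: "x \<in> ?X" "\<forall>m\<in>?X. m \<noteq> x \<longrightarrow> gt x m"
    using ex_greatest[of ?X] Suc.prems by auto
  then obtain i g1 where i: "i \<in> J" "w g1 i x \<noteq> 0" and xT: "x \<in> T" by blast
  define J' where "J' = J - {i}"
  have J: "J = insert i J'" "finite J'" "i \<notin> J'" using i Suc.prems by (auto simp: J'_def)
  have top: "w g j m = 0" if "j \<in> J" "m \<in> T" "gt m x" for g j m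
  proof (rule ccontr)
    assume "w g j m \<noteq> 0"
    then have "m \<in> ?X" using that by blast
    moreover have "m \<noteq> x" using that(3) irrefl by blast
    ultimately have "gt x m" using x(2) by blast
    then show False using that(3) asym by blast
  qed
  have "\<exists>q. polyfun q \<and> q g0 \<noteq> 0 \<and> (\<forall>g. q g \<noteq> 0 \<longrightarrow> indep J T (w g))"
    using Suc.prems by (intro indep_open) auto
  then obtain qi where qi: "polyfun qi" "qi g0 \<noteq> 0" "\<And>g. qi g \<noteq> 0 \<Longrightarrow> indep J T (w g)"
    by blast
  have gx: "generic (\<lambda>g. w g i x)" using Suc.prems(3) i xT by (auto simp: generic_def)
  \<comment> \<open>The pivot may vanish at \<open>g0\<close>, so the induction continues at a
    matrix \<open>g2\<close> where the rows are independent and the pivot is nonzero.\<close>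
  have "generic (\<lambda>g. qi g * w g i x)" using qi gx by (intro generic_mult) (auto simp: generic_def)
  then obtain g2 where g2: "indep J T (w g2)" "w g2 i x \<noteq> 0"
    using qi(3) by (auto simp: generic_def)
  have "\<exists>M q. M \<subseteq> T \<and> card M = card J' \<and> generic q \<and>
      (\<forall>g. q g \<noteq> 0 \<longrightarrow> leads gt J' T (eliminate i x (w g)) = M)"
  proof (rule Suc.hyps(1))
    show "n = card J'" using Suc.hyps(2) J by simp
    show "polyfun (\<lambda>g. eliminate i x (w g) j m)" if "j \<in> J'" "m \<in> T" for j m
      using Suc.prems(3) J that xT by (intro polyfun_eliminate[where J = J' and T = T]) auto
    show "indep J' T (eliminate i x (w g2))"
      using g2 J by (intro indep_eliminate) auto
  qed (use Suc.prems J in auto)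
  then obtain M q where M: "M \<subseteq> T" "card M = card J'" "generic q"
    "\<And>g. q g \<noteq> 0 \<Longrightarrow> leads gt J' T (eliminate i x (w g)) = M" by blast
  have gen: "generic (\<lambda>g. q g * w g i x)" using M gx by (intro generic_mult) auto
  have L: "leads gt J T (w g) = insert x M" "x \<notin> M" if "q g * w g i x \<noteq> 0" for g
  proof -
    from that have ne: "q g \<noteq> 0" "w g i x \<noteq> 0" by auto
    have "\<And>j m. j \<in> insert i J' \<Longrightarrow> m \<in> T \<Longrightarrow> gt m x \<Longrightarrow> w g j m = 0"
      using top J(1) by blast
    note l = leads_eliminate[where v = "w g", OF J(2,3) xT ne(2) this]
    show "leads gt J T (w g) = insert x M" "x \<notin> M"
      using l M(4)[OF ne(1)] J(1) by simp_all
  qed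
  obtain g3 where "q g3 * w g3 i x \<noteq> 0" using gen by (auto simp: generic_def)
  then have "x \<notin> M" using L(2) by blast
  moreover have "finite M" using M(1) Suc.prems(2) finite_subset by blast
  ultimately have "card (insert x M) = card J" using M(2) J by simp
  then show ?case using L(1) gen M(1) xT by (intro exI[of _ "insert x M"] exI conjI) auto
qed

lemma card_leads:
  fixes v :: "'j \<Rightarrow> 'm \<Rightarrow> 'k::field_char_0"
  assumes "finite J" "finite T" "indep J T v"
  shows "card (leads gt J T v) = card J"
proof -
  \<comment> \<open>A constant family reduces the claim to the generic one; the matrices that index
    it can be 1 by 1.\<close>
  obtain M q where "card M = card J" "generic q"
    "\<And>g :: 'k^unit^unit. q g \<noteq> 0 \<Longrightarrow> leads gt J T v = M"
    using generic_leads[of J T "\<lambda>g :: 'k^unit^unit. v"] assms polyfun.const by blast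
  then show ?thesis by (auto simp: generic_def)
qed

end

section \<open>Generic initial ideals\<close>

lemma incseq_subseq_nat:
  fixes s :: "nat \<Rightarrow> nat"
  shows "\<exists>r. strict_mono r \<and> incseq (\<lambda>n. s (r n))"
proof -
  obtain r where r: "strict_mono r" "monoseq (\<lambda>n. s (r n))" using seq_monosub by blast
  show ?thesis
  proof (cases "incseq (\<lambda>n. s (r n))")
    case False
    then have dec: "decseq (\<lambda>n. s (r n))" using r(2) by (simp add: monoseq_iff)
    obtain N where N: "\<And>n. s (r N) \<le> s (r n)"
      using ex_has_least_nat[of "\<lambda>_. True" _ "\<lambda>n. s (r n)"] by blast
    then have "s (r (N + n)) = s (r N)" for n
      using decseqD[OF dec, of N "N + n"] by (simp add: order_antisym)
    then have "incseq (\<lambda>n. s ((\<lambda>n. r (N + n)) n))" by (simp add: incseq_def)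
    moreover have "strict_mono (\<lambda>n. r (N + n))" using r(1) by (simp add: strict_mono_def)
    ultimately show ?thesis by blast
  qed (use r in blast)
qed

text \<open>Thinning out once for each variable makes every exponent weakly increasing along one
  common subsequence.\<close>

lemma dickson_seq:
  fixes f :: "nat \<Rightarrow> 'n::finite monom"
  shows "\<exists>i j. i < j \<and> (\<exists>k. f j = f i + k)"
proof -
  have "\<exists>r. strict_mono r \<and> (\<forall>x\<in>A. incseq (\<lambda>n. lookup (f (r n)) x))" if "finite A" for A
    using that
  proof induction
    case empty
    then show ?case by (auto intro: exI[of _ id] simp: strict_mono_def)
  next
    case (insert x A)
    then obtain r where r: "strict_mono r" "\<forall>x\<in>A. incseq (\<lambda>n. lookup (f (r n)) x)" by blast
    obtain r' where r': "strict_mono r'" "incseq (\<lambda>n. lookup (f (r (r' n))) x)"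
      using incseq_subseq_nat[of "\<lambda>n. lookup (f (r n)) x"] by blast
    have "incseq (\<lambda>n. lookup (f (r (r' n))) y)" if "y \<in> insert x A" for y
      using that r' r(2) strict_mono_mono[OF r'(1)] by (auto simp: incseq_def mono_def)
    moreover have "strict_mono (\<lambda>n. r (r' n))" using r(1) r'(1) by (simp add: strict_mono_def)
    ultimately show ?case by blast
  qed
  from this[of UNIV] obtain r where r: "strict_mono r" "\<And>x. incseq (\<lambda>n. lookup (f (r n)) x)" by auto
  have "f (r 1) = f (r 0) + (f (r 1) - f (r 0))"
    by (rule monom_diff_add[symmetric]) (use r(2) in \<open>auto simp: incseq_def\<close>)
  moreover have "r 0 < r 1" using r(1) by (simp add: strict_mono_def)
  ultimately show ?thesis by blast
qed

text \<open>\<open>B\<close> consists of the elements of \<open>L\<close> that are minimal under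
  divisibility. If it were infinite, \<open>dickson_seq\<close> would find two distinct ones, one
  dividing the other.\<close>

lemma dickson:
  fixes L :: "'n::finite monom set"
  obtains B where "finite B" "B \<subseteq> L" "\<And>m. m \<in> L \<Longrightarrow> \<exists>b\<in>B. \<exists>k. m = b + k"
proof
  let ?B = "{m \<in> L. \<forall>b\<in>L. \<forall>k. m = b + k \<longrightarrow> b = m}"
  show "finite ?B"
  proof (rule ccontr)
    assume "infinite ?B"
    then obtain f :: "nat \<Rightarrow> 'n monom" where f: "inj f" "range f \<subseteq> ?B"
      using infinite_countable_subset by blast
    obtain i j k where "i < j" "f j = f i + k" using dickson_seq by blast
    moreover from this f(2) have "f i = f j" by blast
    ultimately show False using f(1) by (auto dest: injD)
  qed
  show "\<exists>b\<in>?B. \<exists>k. m = b + k" if "m \<in> L" for m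
    using that
  proof (induction "mdeg m" arbitrary: m rule: less_induct)
    case less
    show ?case
    proof (cases "m \<in> ?B")
      case True
      then show ?thesis by (intro bexI[of _ m] exI[of _ 0]) auto
    next
      case False
      with less.prems obtain b k where b: "b \<in> L" "m = b + k" "b \<noteq> m" by blast
      then have "mdeg b < mdeg m" by auto
      from less.hyps[OF this b(1)] obtain b' k' where b': "b' \<in> ?B" "b = b' + k'" by blast
      then have "m = b' + (k' + k)" using b(2) by (simp add: add.assoc)
      with b'(1) show ?thesis by blast
    qed
  qed
qed auto

section \<open>Graded ideals under linear changes of coordinates\<close>

lemma polyfun_gl_act: "polyfun (\<lambda>g. lookup (gl_act g f) m)"
  for f :: "('n::finite, 'k::comm_ring_1) mpoly"
proof (induction f arbitrary: m rule: mpoly_induct)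
  case (Var j)
  have "lookup (gl_act g (Var j)) m = (\<Sum>i\<in>UNIV. vec_nth (vec_nth g i) j * lookup (Var i :: ('n, 'k) mpoly) m)"
    for g by (simp add: gl_act_Var lookup_sum)
  then show ?case by (auto intro!: polyfun_sum polyfun.mult polyfun.entry polyfun.const)
next
  case (mult p q)
  then show ?case by (auto simp: gl_act_mult lookup_mult_divisors intro!: polyfun_sum polyfun.mult)
qed (auto simp: lookup_Const gl_act_add lookup_add intro: polyfun.intros)

text \<open>This form of homogeneity refers to no generators. It passes to images under
  \<open>gl_act g\<close> and gives access to single degrees.\<close>

definition graded_ideal :: "('n::finite, 'k::comm_ring_1) mpoly set \<Rightarrow> bool" where
  "graded_ideal I \<longleftrightarrow> ideal.subspace I \<and> (\<forall>f\<in>I. \<forall>d. hcomp d f \<in> I)"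

lemma homogeneous_ideal_graded:
  assumes "homogeneous_ideal I"
  shows "graded_ideal I"
proof -
  from assms obtain B where B: "\<forall>f\<in>B. \<exists>d. homogeneous d f" and I: "I = ideal_gen B"
    by (auto simp: homogeneous_ideal_def)
  have sub: "ideal.subspace I" using I by simp
  have "hcomp d f \<in> ideal_gen B" if "f \<in> ideal_gen B" for f d
    using that
  proof (induction rule: ideal.span_induct_alt)
    case base
    show ?case by (simp add: ideal.span_zero)
  next
    case (step c x y)
    from B step(1) obtain e where "homogeneous e x" by blast
    then have "hcomp d (c * x) \<in> ideal_gen B"
      using step(1) by (auto simp: hcomp_mult_homogeneous intro: ideal.span_zero ideal.span_scale ideal.span_base)
    then show ?case using step by (simp add: restrict_keys_add ideal.span_add)
  qed
  with sub I show ?thesis by (auto simp: graded_ideal_def)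
qed

lemma graded_ideal_gl_act:
  assumes I: "graded_ideal I" and g: "invertible g"
  shows "graded_ideal (gl_act g ` I)"
proof -
  obtain h where h: "\<And>p. gl_act h (gl_act g p) = p" "\<And>p. gl_act g (gl_act h p) = p"
    using gl_act_inverse[OF g] by blast
  have sub: "ideal.subspace I" using I by (simp add: graded_ideal_def)
  have "ideal.subspace (gl_act g ` I)"
  proof (rule ideal.subspaceI)
    show "0 \<in> gl_act g ` I" using ideal.subspace_0[OF sub] gl_act_0 by force
    show "x + y \<in> gl_act g ` I" if "x \<in> gl_act g ` I" "y \<in> gl_act g ` I" for x y
      using that ideal.subspace_add[OF sub] by (auto simp flip: gl_act_add)
    show "c * x \<in> gl_act g ` I" if "x \<in> gl_act g ` I" for c x
    proof -
      from that obtain y where y: "y \<in> I" "x = gl_act g y" by blast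
      then have "c * x = gl_act g (gl_act h c * y)" by (simp add: gl_act_mult h)
      then show ?thesis using ideal.subspace_scale[OF sub y(1)] by blast
    qed
  qed
  then show ?thesis using I by (auto simp: graded_ideal_def hcomp_gl_act)
qed

lemma invertible_mat_1: "invertible (Finite_Cartesian_Product.mat 1 :: 'k::field^'n^'n)"
  by (simp add: invertible_det_nz)

section \<open>Initial monomials\<close>

locale mono_order =
  fixes \<tau> :: "'n::{finite, linorder} monom \<Rightarrow> 'n monom \<Rightarrow> bool"
  assumes mo: "monomial_order \<tau>"
begin

sublocale strict_total \<tau>
  using mo unfolding monomial_order_def by unfold_locales blast+

lemma add_mono: "\<tau> a b \<Longrightarrow> \<tau> (a + c) (b + c)"
  and mdeg_gt: "mdeg a > mdeg b \<Longrightarrow> \<tau> a b"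
  and var_gt: "i < j \<Longrightarrow> \<tau> (var_monom i) (var_monom j)"
  using mo unfolding monomial_order_def by blast+

lemma add_cancel: "\<tau> (a + c) (b + c) \<longleftrightarrow> \<tau> a b"
  using add_mono total asym irrefl by metis

lemma add_mono2: "\<tau> a b \<or> a = b \<Longrightarrow> \<tau> c d \<or> c = d \<Longrightarrow> \<tau> (a + c) (b + d) \<or> a = b \<and> c = d"
  using add_mono[of a b c] add_mono[of c d b] trans[of "a + c" "b + c" "b + d"]
  by (auto simp: add.commute)

lemma init_monom_eqI:
  assumes "m \<in> keys f" "\<And>m'. m' \<in> keys f \<Longrightarrow> m' \<noteq> m \<Longrightarrow> \<tau> m m'"
  shows "init_monom \<tau> f = m"
  unfolding init_monom_def
proof (rule the_equality)
  show "m \<in> keys f \<and> (\<forall>m'\<in>keys f. m' \<noteq> m \<longrightarrow> \<tau> m m')" using assms by blast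
  show "m' = m" if "m' \<in> keys f \<and> (\<forall>m''\<in>keys f. m'' \<noteq> m' \<longrightarrow> \<tau> m' m'')" for m'
    using that assms(1) assms(2)[of m'] asym[of m m'] by (cases "m' = m") auto
qed

lemma init_monom:
  assumes "f \<noteq> 0"
  shows "init_monom \<tau> f \<in> keys f"
    and "m' \<in> keys f \<Longrightarrow> m' \<noteq> init_monom \<tau> f \<Longrightarrow> \<tau> (init_monom \<tau> f) m'"
proof -
  obtain m where m: "m \<in> keys f" "\<forall>m'\<in>keys f. m' \<noteq> m \<longrightarrow> \<tau> m m'"
    using ex_greatest[of "keys f"] assms by (auto simp: keys_eq_empty[symmetric] simp del: keys_eq_empty)
  then have "init_monom \<tau> f = m" by (intro init_monom_eqI) auto
  with m show "init_monom \<tau> f \<in> keys f"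
    "m' \<in> keys f \<Longrightarrow> m' \<noteq> init_monom \<tau> f \<Longrightarrow> \<tau> (init_monom \<tau> f) m'" by auto
qed

text \<open>Only the pair of leading terms contributes to the largest exponent of the product, and
  the product of their coefficients is nonzero in a field.\<close>

lemma init_monom_mult:
  fixes f g :: "('n, 'k::field) mpoly"
  assumes "f \<noteq> 0" "g \<noteq> 0"
  shows "f * g \<noteq> 0" and "init_monom \<tau> (f * g) = init_monom \<tau> f + init_monom \<tau> g"
proof -
  let ?a = "init_monom \<tau> f" and ?b = "init_monom \<tau> g"
  have "lookup f l * lookup g (?a + ?b - l) = 0" if l: "\<exists>k. ?a + ?b = l + k" "l \<noteq> ?a" for l
  proof (rule ccontr)
    assume "lookup f l * lookup g (?a + ?b - l) \<noteq> 0"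
    moreover obtain k where k: "?a + ?b = l + k" using l by blast
    ultimately have "l \<in> keys f" "k \<in> keys g" by (auto simp: in_keys_iff)
    then have "\<tau> ?a l" "\<tau> ?b k \<or> ?b = k"
      using init_monom(2)[OF assms(1), of l] init_monom(2)[OF assms(2), of k] l(2) by auto
    then have "\<tau> (?a + ?b) (l + k)" using add_mono2[of ?a l ?b k] l(2) by auto
    then show False using k irrefl by simp
  qed
  then have "lookup (f * g) (?a + ?b) =
      (\<Sum>l | \<exists>k. ?a + ?b = l + k. if l = ?a then lookup f ?a * lookup g ?b else 0)"
    unfolding lookup_mult_divisors by (intro sum.cong) auto
  also have "\<dots> = lookup f ?a * lookup g ?b"
    using finite_monom_divisors[of "?a + ?b"] by auto
  also have "\<dots> \<noteq> 0" using init_monom(1) assms by (auto simp: in_keys_iff)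
  finally have k: "?a + ?b \<in> keys (f * g)" by (simp add: in_keys_iff)
  then show "f * g \<noteq> 0" by auto
  have "\<tau> (?a + ?b) m" if "m \<in> keys (f * g)" "m \<noteq> ?a + ?b" for m
  proof -
    from that keys_mult[of f g] obtain l k where "m = l + k" "l \<in> keys f" "k \<in> keys g" by auto
    moreover from this have "\<tau> ?a l \<or> ?a = l" "\<tau> ?b k \<or> ?b = k"
      using init_monom(2)[OF assms(1), of l] init_monom(2)[OF assms(2), of k] by auto
    ultimately show ?thesis using add_mono2[of ?a l ?b k] that(2) by auto
  qed
  with k show "init_monom \<tau> (f * g) = ?a + ?b" by (rule init_monom_eqI)
qed

lemma init_monom_single [simp]: "c \<noteq> 0 \<Longrightarrow> init_monom \<tau> (single m c) = m"
  by (rule init_monom_eqI) auto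

lemma single_mult_init_monom:
  fixes f :: "('n, 'k::field) mpoly"
  assumes "f \<noteq> 0"
  shows "single m 1 * f \<noteq> 0" and "init_monom \<tau> (single m 1 * f) = m + init_monom \<tau> f"
proof -
  have "single m (1 :: 'k) \<noteq> 0" by (metis lookup_single_eq lookup_zero zero_neq_one)
  with assms show "single m 1 * f \<noteq> 0" "init_monom \<tau> (single m 1 * f) = m + init_monom \<tau> f"
    using init_monom_mult[of "single m 1" f] by auto
qed

lemma init_monom_hcomp:
  fixes f :: "('n, 'k::field) mpoly"
  assumes "f \<noteq> 0"
  shows "hcomp (mdeg (init_monom \<tau> f)) f \<noteq> 0"
    and "init_monom \<tau> (hcomp (mdeg (init_monom \<tau> f)) f) = init_monom \<tau> f"
proof -
  have k: "init_monom \<tau> f \<in> keys (hcomp (mdeg (init_monom \<tau> f)) f)" using init_monom(1)[OF assms] by simp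
  then show "hcomp (mdeg (init_monom \<tau> f)) f \<noteq> 0" by (metis empty_iff keys_zero)
  show "init_monom \<tau> (hcomp (mdeg (init_monom \<tau> f)) f) = init_monom \<tau> f"
    using init_monom(2)[OF assms] by (intro init_monom_eqI[OF k]) auto
qed

definition inits :: "('n, 'k::field) mpoly set \<Rightarrow> 'n monom set" where
  "inits I = {init_monom \<tau> f | f. f \<in> I \<and> f \<noteq> 0}"

definition inits_deg :: "nat \<Rightarrow> ('n, 'k::field) mpoly set \<Rightarrow> 'n monom set" where
  "inits_deg d I = {init_monom \<tau> f | f. f \<in> I \<and> f \<noteq> 0 \<and> homogeneous d f}"

lemma init_ideal_eq: "init_ideal \<tau> I = ideal_gen ((\<lambda>m. single m 1) ` inits I)"
  unfolding init_ideal_def inits_def by (rule arg_cong[where f = ideal_gen]) auto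

lemma mdeg_inits_deg: "m \<in> inits_deg d I \<Longrightarrow> mdeg m = d"
  unfolding inits_deg_def using init_monom(1) by (auto simp: homogeneous_def)

text \<open>The component in the degree of the leading term has the same leading term. So initial
  monomials can be determined degree by degree, by finite-dimensional linear algebra.\<close>

lemma inits_eq_inits_deg:
  assumes "graded_ideal I"
  shows "m \<in> inits I \<longleftrightarrow> m \<in> inits_deg (mdeg m) I"
proof
  assume "m \<in> inits I"
  then obtain f where "f \<in> I" "f \<noteq> 0" "m = init_monom \<tau> f" by (auto simp: inits_def)
  then have "hcomp (mdeg m) f \<in> I" "hcomp (mdeg m) f \<noteq> 0" "m = init_monom \<tau> (hcomp (mdeg m) f)"
    using assms init_monom_hcomp[of f] by (auto simp: graded_ideal_def)
  then show "m \<in> inits_deg (mdeg m) I" unfolding inits_deg_def by (blast intro: homogeneous_hcomp)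
qed (auto simp: inits_deg_def inits_def)

lemma inits_add:
  assumes "graded_ideal I" "m \<in> inits I"
  shows "k + m \<in> inits I"
proof -
  from assms(2) obtain f where "f \<in> I" "f \<noteq> 0" "m = init_monom \<tau> f" by (auto simp: inits_def)
  moreover from this have "single k 1 * f \<in> I"
    using assms(1) ideal.subspace_scale by (auto simp: graded_ideal_def)
  ultimately show ?thesis unfolding inits_def
    using single_mult_init_monom[of f k] by (auto intro!: exI[of _ "single k 1 * f"])
qed

text \<open>By \<open>card_leads\<close>, an independent set has at most as many elements as there
  are monomials of degree \<open>d\<close>. So an independent set of greatest size exists, and it
  spans.\<close>

lemma homogeneous_basis:
  fixes I :: "('n, 'k::field_char_0) mpoly set"
  assumes "graded_ideal I"
  obtains J where "finite J" "J \<subseteq> {f\<in>I. homogeneous d f}" "indep J {m. mdeg m = d} lookup"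
    "\<And>f. f \<in> I \<Longrightarrow> homogeneous d f \<Longrightarrow> \<exists>c. f = (\<Sum>b\<in>J. Const (c b) * b)"
proof -
  let ?T = "{m :: 'n monom. mdeg m = d}" and ?V = "{f\<in>I. homogeneous d f}"
  let ?P = "\<lambda>J. finite J \<and> J \<subseteq> ?V \<and> indep J ?T lookup"
  have "card J \<le> card ?T" if "?P J" for J
  proof -
    have "card J = card (leads \<tau> J ?T lookup)"
      using that by (intro card_leads[symmetric]) (auto simp: finite_monoms_mdeg)
    also have "\<dots> \<le> card ?T" by (rule card_mono) (auto simp: finite_monoms_mdeg leads_def)
    finally show ?thesis .
  qed
  then have "\<forall>J. ?P J \<longrightarrow> card J < Suc (card ?T)" by (simp add: less_Suc_eq_le)
  moreover have "?P {}" by (simp add: indep_def)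
  ultimately obtain J where J: "?P J" "\<And>J'. ?P J' \<Longrightarrow> card J' \<le> card J"
    using ex_has_greatest_nat[of ?P "{}" card "Suc (card ?T)"] by blast
  have "\<exists>c. f = (\<Sum>b\<in>J. Const (c b) * b)" if f: "f \<in> I" "homogeneous d f" for f
  proof (cases "f \<in> J")
    case True
    have "f = (\<Sum>b\<in>J. if b = f then f else 0)" using True J(1) by simp
    also have "\<dots> = (\<Sum>b\<in>J. Const (if b = f then 1 else 0) * b)" by (intro sum.cong) auto
    finally show ?thesis by (rule exI[of _ "\<lambda>b. if b = f then 1 else 0"])
  next
    case False
    have "\<not> ?P (insert f J)"
    proof
      assume "?P (insert f J)"
      from J(2)[OF this] J(1) False show False by simp
    qed
    then have "\<not> indep (insert f J) ?T lookup" using J(1) f by blast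
    then obtain c where c: "\<And>m. m \<in> ?T \<Longrightarrow> (\<Sum>b\<in>insert f J. c b * lookup b m) = 0"
      "\<not> (\<forall>b\<in>insert f J. c b = 0)" unfolding indep_def by blast
    have s: "c f * lookup f m + (\<Sum>b\<in>J. c b * lookup b m) = 0" if "m \<in> ?T" for m
      using c(1)[OF that] J(1) False by simp
    have "c f \<noteq> 0"
    proof
      assume "c f = 0"
      then have "(\<Sum>b\<in>J. c b * lookup b m) = 0" if "m \<in> ?T" for m using s[OF that] by simp
      then have "\<forall>b\<in>J. c b = 0" using indepD[of J ?T lookup c] J(1) by blast
      with \<open>c f = 0\<close> c(2) show False by simp
    qed
    have "f = (\<Sum>b\<in>J. Const (- c b / c f) * b)"
    proof (rule poly_mapping_eqI)
      fix m
      show "lookup f m = lookup (\<Sum>b\<in>J. Const (- c b / c f) * b) m"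
      proof (cases "mdeg m = d")
        case True
        then have "c f * lookup f m = - (\<Sum>b\<in>J. c b * lookup b m)" using s by (simp add: eq_neg_iff_add_eq_0)
        also have "\<dots> = c f * lookup (\<Sum>b\<in>J. Const (- c b / c f) * b) m"
          using \<open>c f \<noteq> 0\<close> by (simp add: lookup_sum sum_distrib_left sum_negf)
        finally show ?thesis using \<open>c f \<noteq> 0\<close> by simp
      next
        case False
        then have "lookup b m = 0" if "b \<in> insert f J" for b
          using that f J(1) homogeneous_lookup_0[of d b m] by auto
        then show ?thesis by (simp add: lookup_sum)
      qed
    qed
    then show ?thesis by (rule exI[of _ "\<lambda>b. - c b / c f"])
  qed
  with J(1) show ?thesis using that by blast
qed

section \<open>Galligo's theorem\<close>

lemma indep_gl_act:
  fixes J :: "('n, 'k::field_char_0) mpoly set"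
  assumes "J \<subseteq> {f. homogeneous d f}" "indep J {m. mdeg m = d} lookup" "invertible g"
  shows "indep J {m. mdeg m = d} (\<lambda>b. lookup (gl_act g b))"
  unfolding indep_def
proof (intro allI impI)
  fix c assume c: "\<forall>m\<in>{m. mdeg m = d}. (\<Sum>b\<in>J. c b * lookup (gl_act g b) m) = 0"
  have "(\<Sum>b\<in>J. c b * lookup (gl_act g b) m) = 0" for m
  proof (cases "mdeg m = d")
    case False
    then have "lookup (gl_act g b) m = 0" if "b \<in> J" for b
      using that assms(1) homogeneous_gl_act homogeneous_lookup_0 by blast
    then show ?thesis by simp
  qed (use c in simp)
  then have "gl_act g (\<Sum>b\<in>J. Const (c b) * b) = 0"
    by (intro poly_mapping_eqI) (simp add: gl_act_sum gl_act_mult lookup_sum)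
  then have 0: "(\<Sum>b\<in>J. Const (c b) * b) = 0" using gl_act_eq_0_iff[OF assms(3)] by blast
  have "(\<Sum>b\<in>J. c b * lookup b m) = 0" for m
    using arg_cong[OF 0, of "\<lambda>p. lookup p m"] by (simp add: lookup_sum)
  then show "\<forall>b\<in>J. c b = 0" using indepD[OF assms(2)] by blast
qed

text \<open>The bridge to elimination: rows are the transformed basis elements, columns the
  monomials of degree \<open>d\<close>, and by \<open>polyfun_gl_act\<close> the entries are
  polynomial in \<open>g\<close>.\<close>

lemma inits_deg_eq_leads:
  fixes I :: "('n, 'k::field_char_0) mpoly set"
  assumes I: "graded_ideal I" and g: "invertible g" and J: "J \<subseteq> {f\<in>I. homogeneous d f}"
    and span: "\<And>f. f \<in> I \<Longrightarrow> homogeneous d f \<Longrightarrow> \<exists>c. f = (\<Sum>b\<in>J. Const (c b) * b)"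
  shows "inits_deg d (gl_act g ` I) = leads \<tau> J {m. mdeg m = d} (\<lambda>b. lookup (gl_act g b))"
proof -
  have sub: "ideal.subspace I" using I by (simp add: graded_ideal_def)
  have lk: "(\<Sum>b\<in>J. c b * lookup (gl_act g b) m) = lookup (gl_act g (\<Sum>b\<in>J. Const (c b) * b)) m" for c m
    by (simp add: gl_act_sum gl_act_mult lookup_sum)
  show ?thesis
  proof (intro equalityI subsetI)
    fix m assume "m \<in> inits_deg d (gl_act g ` I)"
    then obtain f where f: "f \<in> I" "gl_act g f \<noteq> 0" "homogeneous d (gl_act g f)" "m = init_monom \<tau> (gl_act g f)"
      by (auto simp: inits_deg_def)
    have "gl_act g f = gl_act g (hcomp d f)"
      using f(3) by (simp add: hcomp_homogeneous flip: hcomp_gl_act)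
    moreover have "hcomp d f \<in> I" using I f(1) by (auto simp: graded_ideal_def)
    ultimately obtain c where c: "gl_act g f = gl_act g (\<Sum>b\<in>J. Const (c b) * b)"
      using span[of "hcomp d f"] by auto
    have "m \<in> keys (gl_act g f)" "mdeg m = d"
      using init_monom(1)[OF f(2)] f(3,4) by (auto simp: homogeneous_def)
    moreover have "lookup (gl_act g f) m' = 0" if "\<tau> m' m" for m'
      using init_monom(2)[OF f(2)] f(4) that asym irrefl by (metis in_keys_iff)
    ultimately show "m \<in> leads \<tau> J {m. mdeg m = d} (\<lambda>b. lookup (gl_act g b))"
      unfolding leads_def lk c by (auto simp: in_keys_iff)
  next
    fix m assume "m \<in> leads \<tau> J {m. mdeg m = d} (\<lambda>b. lookup (gl_act g b))"
    then obtain c where c: "mdeg m = d" "lookup (gl_act g (\<Sum>b\<in>J. Const (c b) * b)) m \<noteq> 0"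
      "\<And>m'. mdeg m' = d \<Longrightarrow> \<tau> m' m \<Longrightarrow> lookup (gl_act g (\<Sum>b\<in>J. Const (c b) * b)) m' = 0"
      unfolding leads_def lk by blast
    define f where "f = (\<Sum>b\<in>J. Const (c b) * b)"
    have fI: "f \<in> I" unfolding f_def using J
      by (intro ideal.subspace_sum[OF sub] ideal.subspace_scale[OF sub]) auto
    have fh: "homogeneous d (gl_act g f)" unfolding f_def using J
      by (intro homogeneous_gl_act homogeneous_sum homogeneous_Const_mult) auto
    have "init_monom \<tau> (gl_act g f) = m"
    proof (rule init_monom_eqI)
      show "m \<in> keys (gl_act g f)" using c(2) by (simp add: in_keys_iff f_def)
      show "\<tau> m m'" if "m' \<in> keys (gl_act g f)" "m' \<noteq> m" for m'
        using c(3)[of m'] that fh total[of m m'] by (auto simp: in_keys_iff homogeneous_def f_def)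
    qed
    moreover have "gl_act g f \<noteq> 0" using c(2) by (auto simp: f_def)
    ultimately show "m \<in> inits_deg d (gl_act g ` I)"
      unfolding inits_deg_def using fI fh by blast
  qed
qed

text \<open>The cardinality is controlled for every invertible \<open>g\<close>, also where
  \<open>q\<close> vanishes. This lets \<open>galligo\<close> turn an inclusion into an equality in
  degrees whose polynomial is not under control.\<close>

lemma galligo_deg:
  fixes I :: "('n, 'k::field_char_0) mpoly set"
  assumes I: "graded_ideal I"
  shows "\<exists>M q. generic q \<and> finite M \<and>
    (\<forall>g. invertible g \<longrightarrow> card (inits_deg d (gl_act g ` I)) = card M \<and>
      finite (inits_deg d (gl_act g ` I)) \<and> (q g \<noteq> 0 \<longrightarrow> inits_deg d (gl_act g ` I) = M))"
proof -
  let ?T = "{m :: 'n monom. mdeg m = d}"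
  obtain J where J: "finite J" "J \<subseteq> {f\<in>I. homogeneous d f}" "indep J ?T lookup"
    "\<And>f. f \<in> I \<Longrightarrow> homogeneous d f \<Longrightarrow> \<exists>c. f = (\<Sum>b\<in>J. Const (c b) * b)"
    using homogeneous_basis[OF I] by blast
  have ind: "indep J ?T (\<lambda>b. lookup (gl_act g b))" if "invertible g" for g
    using J that by (intro indep_gl_act) auto
  obtain M q where M: "M \<subseteq> ?T" "card M = card J" "generic q"
    "\<And>g. q g \<noteq> 0 \<Longrightarrow> leads \<tau> J ?T (\<lambda>b. lookup (gl_act g b)) = M"
    using generic_leads[OF J(1) finite_monoms_mdeg polyfun_gl_act ind[OF invertible_mat_1]] by blast
  have "finite M" using M(1) finite_monoms_mdeg finite_subset by blast
  moreover have "card (inits_deg d (gl_act g ` I)) = card M" "finite (inits_deg d (gl_act g ` I))"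
    "q g \<noteq> 0 \<Longrightarrow> inits_deg d (gl_act g ` I) = M" if g: "invertible g" for g
  proof -
    have eq: "inits_deg d (gl_act g ` I) = leads \<tau> J ?T (\<lambda>b. lookup (gl_act g b))"
      using g J(2,4) by (intro inits_deg_eq_leads[OF I]) auto
    show "card (inits_deg d (gl_act g ` I)) = card M"
      unfolding eq M(2) by (rule card_leads[OF J(1) finite_monoms_mdeg ind[OF g]])
    show "finite (inits_deg d (gl_act g ` I))"
      unfolding eq by (rule finite_subset[OF _ finite_monoms_mdeg[of d]]) (auto simp: leads_def)
    show "q g \<noteq> 0 \<Longrightarrow> inits_deg d (gl_act g ` I) = M" unfolding eq by (rule M(4))
  qed
  ultimately show ?thesis using M(3) by blast
qed

text \<open>All degrees together would impose infinitely many open conditions. By Dickson's lemma,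
  finitely many monomials divide all generic initial monomials. Conditions in their degrees alone
  give inclusions in every degree, and equal cardinalities make these equalities.\<close>

lemma galligo:
  fixes I :: "('n, 'k::field_char_0) mpoly set"
  assumes I: "graded_ideal I"
  shows "\<exists>M q. generic q \<and> (\<forall>g. invertible g \<longrightarrow> q g \<noteq> 0 \<longrightarrow> inits (gl_act g ` I) = M)"
proof -
  obtain M q where q: "\<And>d. generic (q d)" "\<And>d. finite (M d)"
    and card: "\<And>d g. invertible g \<Longrightarrow> card (inits_deg d (gl_act g ` I)) = card (M d)"
    and fin: "\<And>d g. invertible g \<Longrightarrow> finite (inits_deg d (gl_act g ` I))"
    and M: "\<And>d g. invertible g \<Longrightarrow> q d g \<noteq> 0 \<Longrightarrow> inits_deg d (gl_act g ` I) = M d"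
    using galligo_deg[OF I] by metis
  have M_mdeg: "mdeg m = d" if "m \<in> M d" for m d
    using that M mdeg_inits_deg generic_invertible[OF q(1)[of d]] by metis
  define L where "L = (\<Union>d. M d)"
  obtain B where B: "finite B" "B \<subseteq> L" "\<And>m. m \<in> L \<Longrightarrow> \<exists>b\<in>B. \<exists>k. m = b + k"
    using dickson[of L] by blast
  define Q where "Q = (\<lambda>g. \<Prod>b\<in>B. q (mdeg b) g)"
  have gQ: "generic Q" unfolding Q_def by (intro generic_prod q)
  have "inits (gl_act g ` I) = L" if g: "invertible g" "Q g \<noteq> 0" for g
  proof -
    have gr: "graded_ideal (gl_act g ` I)" using graded_ideal_gl_act[OF I g(1)] .
    have "M d \<subseteq> inits_deg d (gl_act g ` I)" for d
    proof
      fix m assume m: "m \<in> M d"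
      then obtain b k where b: "b \<in> B" "m = b + k" using B(3) L_def by blast
      then have "q (mdeg b) g \<noteq> 0" using g(2) B(1) by (auto simp: Q_def)
      moreover have "b \<in> M (mdeg b)" using b(1) B(2) M_mdeg by (auto simp: L_def)
      ultimately have "b \<in> inits_deg (mdeg b) (gl_act g ` I)" using M[OF g(1)] by blast
      then have "m \<in> inits (gl_act g ` I)"
        using inits_eq_inits_deg[OF gr] inits_add[OF gr] b(2) by (metis add.commute)
      then show "m \<in> inits_deg d (gl_act g ` I)"
        using inits_eq_inits_deg[OF gr] M_mdeg[OF m] by blast
    qed
    then have "inits_deg d (gl_act g ` I) = M d" for d
      using card_subset_eq[OF fin[OF g(1)]] card[OF g(1)] by metis
    then show ?thesis
      using inits_eq_inits_deg[OF gr] mdeg_inits_deg unfolding L_def by blast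
  qed
  with gQ show ?thesis by blast
qed

text \<open>For uniqueness, any competing open set contains a basic one. The product of both
  polynomials is generic, so some invertible matrix lies in both sets.\<close>

lemma init_ideal_gin:
  fixes I :: "('n, 'k::field_char_0) mpoly set"
  assumes I: "graded_ideal I"
  shows "\<exists>q. generic q \<and> (\<forall>g. invertible g \<longrightarrow> q g \<noteq> 0 \<longrightarrow> init_ideal \<tau> (gl_act g ` I) = gin \<tau> I)"
proof -
  obtain M q where q: "generic q" and M: "\<And>g. invertible g \<Longrightarrow> q g \<noteq> 0 \<Longrightarrow> inits (gl_act g ` I) = M"
    using galligo[OF I] by blast
  define J :: "('n, 'k) mpoly set" where "J = ideal_gen ((\<lambda>m. single m 1) ` M)"
  let ?U = "{g. invertible g \<and> q g \<noteq> 0}"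
  have J: "init_ideal \<tau> (gl_act g ` I) = J" if "invertible g" "q g \<noteq> 0" for g
    using M[OF that] by (simp add: init_ideal_eq J_def)
  have "gin \<tau> I = J"
    unfolding gin_def
  proof (rule the_equality)
    have "?U \<noteq> {}" using generic_invertible[OF q] by blast
    then show "\<exists>U. zariski_open_GL U \<and> U \<noteq> {} \<and> (\<forall>g\<in>U. init_ideal \<tau> (gl_act g ` I) = J)"
      using J q zariski_open_GL_basic[of q] by (intro exI[of _ ?U]) (auto simp: generic_def)
    fix J' assume "\<exists>U. zariski_open_GL U \<and> U \<noteq> {} \<and> (\<forall>g\<in>U. init_ideal \<tau> (gl_act g ` I) = J')"
    then obtain U h where U: "zariski_open_GL U" "h \<in> U" "\<And>g. g \<in> U \<Longrightarrow> init_ideal \<tau> (gl_act g ` I) = J'"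
      by blast
    obtain q' where q': "polyfun q'" "q' h \<noteq> 0" "{g. invertible g \<and> q' g \<noteq> 0} \<subseteq> U"
      using zariski_open_GL_contains_basic[OF U(1,2)] by blast
    have "generic (\<lambda>g. q g * q' g)" using q q' by (intro generic_mult) (auto simp: generic_def)
    then obtain g where "invertible g" "q g * q' g \<noteq> 0" by (rule generic_invertible)
    then show "J' = J" using J[of g] U(3)[of g] q'(3) by auto
  qed
  with J q show ?thesis by blast
qed

end

section \<open>Graded submodules of free modules\<close>

type_synonym ('n, 'k) pvec = "nat \<Rightarrow> ('n, 'k) mpoly"

text \<open>A matrix with \<open>t\<close> columns is given by a function on \<open>{..<t}\<close> whose values are its columns.\<close>

definition carr :: "nat \<Rightarrow> ('n, 'k::comm_ring_1) pvec set" where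
  "carr r = {v. \<forall>j\<ge>r. v j = 0}"

definition lin :: "(nat \<Rightarrow> ('n, 'k::comm_ring_1) pvec) \<Rightarrow> nat \<Rightarrow> ('n, 'k) pvec \<Rightarrow> ('n, 'k) pvec" where
  "lin E t v = (\<lambda>j. \<Sum>k<t. E k j * v k)"

text \<open>Homogeneity of degree \<open>N\<close> in the free module whose \<open>j\<close>-th
  generator has degree \<open>a j\<close>; the zero vector has every degree.\<close>

definition hom_vec :: "(nat \<Rightarrow> nat) \<Rightarrow> nat \<Rightarrow> ('n::finite, 'k::comm_ring_1) pvec \<Rightarrow> bool" where
  "hom_vec a N v \<longleftrightarrow> (\<forall>j. \<forall>m\<in>keys (v j). a j + mdeg m = N)"

definition hvec :: "(nat \<Rightarrow> nat) \<Rightarrow> nat \<Rightarrow> ('n::finite, 'k::comm_ring_1) pvec \<Rightarrow> ('n, 'k) pvec" where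
  "hvec a N v = (\<lambda>j. restrict_keys (\<lambda>m. a j + mdeg m = N) (v j))"

definition graded_submodule ::
  "nat \<Rightarrow> (nat \<Rightarrow> nat) \<Rightarrow> ('n::finite, 'k::comm_ring_1) pvec set \<Rightarrow> bool" where
  "graded_submodule r a M \<longleftrightarrow> M \<subseteq> carr r \<and> (\<lambda>_. 0) \<in> M \<and>
     (\<forall>u\<in>M. \<forall>v\<in>M. (\<lambda>j. u j + v j) \<in> M) \<and> (\<forall>p. \<forall>v\<in>M. (\<lambda>j. p * v j) \<in> M) \<and>
     (\<forall>v\<in>M. \<forall>N. hvec a N v \<in> M)"

lemma carrD: "v \<in> carr r \<Longrightarrow> lookup (v j) m \<noteq> 0 \<Longrightarrow> j < r"
  by (rule ccontr) (simp add: carr_def)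

lemma lin_add: "lin E t (\<lambda>k. u k + v k) = (\<lambda>j. lin E t u j + lin E t v j)"
  by (simp add: lin_def distrib_left sum.distrib)

lemma lin_diff: "lin E t (\<lambda>k. u k - v k) = (\<lambda>j. lin E t u j - lin E t v j)"
  by (simp add: lin_def right_diff_distrib sum_subtractf)

lemma lin_scale: "lin E t (\<lambda>k. p * v k) = (\<lambda>j. p * lin E t v j)"
  by (simp add: lin_def sum_distrib_left mult_ac)

lemma lin_0 [simp]: "lin E t (\<lambda>k. 0) = (\<lambda>j. 0)"
  by (simp add: lin_def)

lemma lin_cong: "(\<And>k. k < t \<Longrightarrow> u k = v k) \<Longrightarrow> lin E t u = lin E t v"
  by (simp add: lin_def)

lemma lin_carr: "(\<And>k. k < t \<Longrightarrow> E k \<in> carr r) \<Longrightarrow> lin E t v \<in> carr r"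
  by (simp add: lin_def carr_def)

lemma lin_unit: "k < t \<Longrightarrow> lin E t (\<lambda>l. if l = k then p else 0) = (\<lambda>j. p * E k j)"
proof (rule ext)
  fix j assume "k < t"
  have "lin E t (\<lambda>l. if l = k then p else 0) j = (\<Sum>l<t. if l = k then p * E k j else 0)"
    unfolding lin_def by (intro sum.cong) auto
  then show "lin E t (\<lambda>l. if l = k then p else 0) j = p * E k j" using \<open>k < t\<close> by simp
qed

lemma lin_image_carr: "lin E t v \<in> lin E t ` carr t"
proof -
  have "lin E t v = lin E t (\<lambda>k. if k < t then v k else 0)" by (rule lin_cong) simp
  then show ?thesis by (auto simp: carr_def)
qed

lemma hom_vec_hvec [simp]: "hom_vec a N (hvec a N v)"
  by (simp add: hom_vec_def hvec_def)

lemma hom_vecD: "hom_vec a N v \<Longrightarrow> lookup (v j) m \<noteq> 0 \<Longrightarrow> a j + mdeg m = N"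
  by (simp add: hom_vec_def in_keys_iff)

lemma hom_vecI: "(\<And>j m. lookup (v j) m \<noteq> 0 \<Longrightarrow> a j + mdeg m = N) \<Longrightarrow> hom_vec a N v"
  by (simp add: hom_vec_def in_keys_iff)

lemma hvec_hom_vec: "hom_vec a N v \<Longrightarrow> hvec a N v = v"
  by (intro ext poly_mapping_eqI) (auto simp: hvec_def dest: hom_vecD)

lemma hvec_carr: "v \<in> carr r \<Longrightarrow> hvec a N v \<in> carr r"
  by (simp add: carr_def hvec_def)

lemma hom_vec_add: "hom_vec a N u \<Longrightarrow> hom_vec a N v \<Longrightarrow> hom_vec a N (\<lambda>j. u j + v j)"
proof (rule hom_vecI)
  fix j m assume *: "hom_vec a N u" "hom_vec a N v" "lookup (u j + v j) m \<noteq> 0"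
  then have "lookup (u j) m \<noteq> 0 \<or> lookup (v j) m \<noteq> 0" by (auto simp: lookup_add)
  with * show "a j + mdeg m = N" using hom_vecD[of a N u j m] hom_vecD[of a N v j m] by auto
qed

lemma hom_vec_diff: "hom_vec a N u \<Longrightarrow> hom_vec a N v \<Longrightarrow> hom_vec a N (\<lambda>j. u j - v j)"
proof (rule hom_vecI)
  fix j m assume *: "hom_vec a N u" "hom_vec a N v" "lookup (u j - v j) m \<noteq> 0"
  then have "lookup (u j) m \<noteq> 0 \<or> lookup (v j) m \<noteq> 0" by (auto simp: lookup_minus)
  with * show "a j + mdeg m = N" using hom_vecD[of a N u j m] hom_vecD[of a N v j m] by auto
qed

lemma hom_vec_mult:
  assumes "homogeneous d p" "hom_vec a N v"
  shows "hom_vec a (N + d) (\<lambda>j. p * v j)"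
  unfolding hom_vec_def
proof (intro allI ballI)
  fix j m assume "m \<in> keys (p * v j)"
  then obtain l k where "m = l + k" "l \<in> keys p" "k \<in> keys (v j)" using keys_mult[of p "v j"] by auto
  then show "a j + mdeg m = N + d" using assms by (auto simp: hom_vec_def homogeneous_def)
qed

lemma hvec_lin:
  assumes "\<And>k. k < t \<Longrightarrow> hom_vec a (b k) (E k)"
  shows "hvec a N (lin E t v) = lin E t (hvec b N v)"
proof (rule ext)
  fix j
  have "restrict_keys (\<lambda>m. a j + mdeg m = N) (E k j * v k) =
      E k j * restrict_keys (\<lambda>m. b k + mdeg m = N) (v k)" (is "?L = ?R") if k: "k < t" for k
  \<comment> \<open>Only a nonzero entry guarantees \<open>a j \<le> b k\<close>, without which the
    truncated difference \<open>b k - a j\<close> would not be the degree of the entry.\<close>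
  proof (cases "E k j = 0")
    case False
    then obtain m where "lookup (E k j) m \<noteq> 0"
      by (metis lookup_zero poly_mapping_eqI)
    then have "a j + mdeg m = b k" by (rule hom_vecD[OF assms[OF k]])
    then have ab: "a j \<le> b k" by simp
    have h: "homogeneous (b k - a j) (E k j)"
      unfolding homogeneous_def
    proof
      fix l assume "l \<in> keys (E k j)"
      then have "a j + mdeg l = b k" by (intro hom_vecD[OF assms[OF k]]) (simp add: in_keys_iff)
      then show "mdeg l = b k - a j" by simp
    qed
    have z: "restrict_keys (\<lambda>m. c + mdeg m = N) p = (if c \<le> N then hcomp (N - c) p else 0)"
      for c and p :: "('a, 'b) mpoly"
      by (intro poly_mapping_eqI) auto
    have "?L = (if a j \<le> N then hcomp (N - a j) (v k * E k j) else 0)" by (simp add: z mult.commute)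
    also have "\<dots> = ?R"
      unfolding z hcomp_mult_homogeneous[OF h] using ab by (auto simp: mult.commute)
    finally show ?thesis .
  qed simp
  then show "hvec a N (lin E t v) j = lin E t (hvec b N v) j"
    by (simp add: hvec_def lin_def restrict_keys_sum)
qed

lemma hvec_diff: "hvec a N (\<lambda>j. u j - v j) = (\<lambda>j. hvec a N u j - hvec a N v j)"
  by (simp add: hvec_def restrict_keys_diff)

lemma graded_submodule_ker:
  assumes "\<And>k. k < t \<Longrightarrow> hom_vec a (b k) (E k)"
  shows "graded_submodule t b {v \<in> carr t. lin E t v = (\<lambda>_. 0)}"
proof -
  have "lin E t (hvec b N v) = (\<lambda>_. 0)" if "lin E t v = (\<lambda>_. 0)" for v N
    using hvec_lin[where a = a and b = b and E = E and t = t and N = N and v = v, OF assms] that by (simp add: hvec_def)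
  then show ?thesis
    unfolding graded_submodule_def by (auto simp: hvec_carr lin_add lin_scale) (auto simp: carr_def)
qed

lemma ex_sum_hvec:
  assumes "v \<in> carr r"
  shows "\<exists>D. v = (\<lambda>j. \<Sum>N<D. hvec a N v j)"
proof -
  have "finite (\<Union>j<r. (\<lambda>m. a j + mdeg m) ` keys (v j))" by auto
  then obtain D where D: "\<forall>N\<in>(\<Union>j<r. (\<lambda>m. a j + mdeg m) ` keys (v j)). N < D"
    using finite_nat_set_iff_bounded by blast
  have "v j = (\<Sum>N<D. hvec a N v j)" for j
  proof (rule poly_mapping_eqI)
    fix m
    have "lookup (\<Sum>N<D. hvec a N v j) m = (\<Sum>N<D. if a j + mdeg m = N then lookup (v j) m else 0)"
      by (simp add: lookup_sum hvec_def)
    also have "\<dots> = lookup (v j) m"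
    proof (cases "lookup (v j) m = 0")
      case False
      then have "j < r" using carrD[OF assms] by blast
      then have "a j + mdeg m < D" using D False by (auto simp: in_keys_iff)
      then show ?thesis by simp
    qed simp
    finally show "lookup (v j) m = lookup (\<Sum>N<D. hvec a N v j) m" ..
  qed
  then show ?thesis by blast
qed

lemma graded_submodule_eqI:
  assumes M: "graded_submodule r a M" and E: "\<And>k. k < t \<Longrightarrow> E k \<in> M"
    and hom: "\<And>v N. v \<in> M \<Longrightarrow> hom_vec a N v \<Longrightarrow> v \<in> lin E t ` carr t"
  shows "M = lin E t ` carr t"
proof (intro equalityI subsetI)
  let ?R = "lin E t ` carr t"
  have add: "(\<lambda>j. u j + v j) \<in> ?R" if uv: "u \<in> ?R" "v \<in> ?R" for u v
  proof -
    obtain u' v' where "u = lin E t u'" "v = lin E t v'" using uv by blast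
    then show ?thesis using lin_image_carr[of E t "\<lambda>k. u' k + v' k"] by (simp add: lin_add)
  qed
  fix v assume v: "v \<in> M"
  then obtain D where D: "v = (\<lambda>j. \<Sum>N<D. hvec a N v j)"
    using ex_sum_hvec[of v r a] M by (auto simp: graded_submodule_def)
  have h: "hvec a N v \<in> ?R" for N
    using M v by (intro hom[of _ N]) (auto simp: graded_submodule_def)
  have "(\<lambda>j. \<Sum>N<n. hvec a N v j) \<in> ?R" for n
  proof (induction n)
    case 0
    show ?case using lin_image_carr[of E t "\<lambda>_. 0"] by simp
  qed (use add h in auto)
  then show "v \<in> ?R" using D by metis
next
  fix v assume "v \<in> lin E t ` carr t"
  then obtain u where u: "v = lin E t u" by blast
  have "n \<le> t \<Longrightarrow> (\<lambda>j. \<Sum>k<n. E k j * u k) \<in> M" for n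
  proof (induction n)
    case (Suc n)
    then have "(\<lambda>j. u n * E n j) \<in> M" using E[of n] M by (auto simp: graded_submodule_def)
    then show ?case using Suc M by (simp add: graded_submodule_def mult.commute)
  qed (use M in \<open>simp add: graded_submodule_def\<close>)
  then show "v \<in> M" by (simp add: u lin_def)
qed

section \<open>Groebner bases of submodules for the position-over-term order\<close>

context mono_order begin

definition pot :: "nat \<times> 'n monom \<Rightarrow> nat \<times> 'n monom \<Rightarrow> bool" where
  "pot x y \<longleftrightarrow> fst x > fst y \<or> fst x = fst y \<and> \<tau> (snd x) (snd y)"

sublocale pot: strict_total pot
  by unfold_locales (auto simp: pot_def irrefl intro: trans dest: total)

definition is_lead :: "('n, 'k::comm_ring_1) pvec \<Rightarrow> nat \<times> 'n monom \<Rightarrow> bool" where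
  "is_lead v x \<longleftrightarrow> lookup (v (fst x)) (snd x) \<noteq> 0 \<and>
     (\<forall>y. lookup (v (fst y)) (snd y) \<noteq> 0 \<longrightarrow> y \<noteq> x \<longrightarrow> pot x y)"

lemma is_leadD: "is_lead v x \<Longrightarrow> lookup (v (fst y)) (snd y) \<noteq> 0 \<Longrightarrow> y \<noteq> x \<Longrightarrow> pot x y"
  unfolding is_lead_def by blast

lemma ex_is_lead:
  assumes "v \<in> carr r" "v \<noteq> (\<lambda>_. 0)"
  shows "\<exists>x. is_lead v x"
proof -
  let ?S = "{x. lookup (v (fst x)) (snd x) \<noteq> 0}"
  have "?S \<subseteq> (SIGMA j:{..<r}. keys (v j))"
  proof
    fix x assume x: "x \<in> ?S"
    then have "fst x < r" using carrD[OF assms(1)] by blast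
    then show "x \<in> (SIGMA j:{..<r}. keys (v j))" using x by (cases x) (auto simp: in_keys_iff)
  qed
  then have "finite ?S" by (rule finite_subset) auto
  moreover have "?S \<noteq> {}"
  proof
    assume e: "?S = {}"
    have "lookup (v j) m = 0" for j m
    proof -
      have "(j, m) \<notin> ?S" using e by blast
      then show ?thesis by simp
    qed
    then show False using assms(2) by (auto intro!: ext poly_mapping_eqI)
  qed
  ultimately show ?thesis using pot.ex_greatest[of ?S] unfolding is_lead_def by auto
qed

text \<open>Dickson's lemma, applied in each position, yields finitely many homogeneous elements
  whose leads divide the leads of all homogeneous elements. Division by them reduces every
  homogeneous element to zero.\<close>

lemma graded_submodule_fin_gen:
  fixes M :: "('n, 'k::field) pvec set"
  assumes M: "graded_submodule r a M"
  shows "\<exists>t b E. (\<forall>k<t. E k \<in> M \<and> hom_vec a (b k) (E k)) \<and> M = lin E t ` carr t"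
proof -
  define H where "H = {v\<in>M. \<exists>N. hom_vec a N v}"
  define L where "L j = {m. \<exists>v\<in>H. is_lead v (j, m)}" for j
  have "\<exists>B. finite B \<and> B \<subseteq> L j \<and> (\<forall>m\<in>L j. \<exists>b\<in>B. \<exists>k. m = b + k)" for j
    using dickson[of "L j"] by metis
  then obtain B where B: "\<And>j. finite (B j)" "\<And>j. B j \<subseteq> L j"
    "\<And>j m. m \<in> L j \<Longrightarrow> \<exists>b\<in>B j. \<exists>k. m = b + k" by metis
  have "\<forall>j. \<forall>m\<in>B j. \<exists>v\<in>H. is_lead v (j, m)" using B(2) by (auto simp: L_def)
  then obtain w where w: "\<And>j m. m \<in> B j \<Longrightarrow> w j m \<in> H \<and> is_lead (w j m) (j, m)" by metis
  define G where "G = (\<Union>j<r. w j ` B j)"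
  have "finite G" using B(1) by (simp add: G_def)
  then obtain t E where "G = E ` {i::nat. i < t}"
    using finite_imp_nat_seg_image_inj_on by metis
  then have E: "G = E ` {..<t}" by (simp add: lessThan_def)
  have EH: "E k \<in> H" if "k < t" for k
  proof -
    have "E k \<in> G" using E that by blast
    then show ?thesis using w by (auto simp: G_def)
  qed
  then have "\<forall>k. k < t \<longrightarrow> (\<exists>N. hom_vec a N (E k))" by (auto simp: H_def)
  then obtain b where b: "\<And>k. k < t \<Longrightarrow> hom_vec a (b k) (E k)" by metis
  let ?R = "lin E t ` carr t"
  have Mc: "M \<subseteq> carr r" using M by (simp add: graded_submodule_def)
  have "v \<in> ?R" if vM: "v \<in> M" "hom_vec a N v" for v N
  proof (cases "v = (\<lambda>_. 0)")
    case True
    then show ?thesis using lin_image_carr[of E t "\<lambda>_. 0"] by simp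
  next
    case False
    \<comment> \<open>A vector of degree \<open>N\<close> involves only these finitely many terms.
      Division terminates because the number of them below the lead decreases.\<close>
    let ?X = "{x. fst x < r \<and> a (fst x) + mdeg (snd x) = N}"
    have finX: "finite ?X"
    proof (rule finite_subset)
      show "?X \<subseteq> {..<r} \<times> {m. mdeg m \<le> N}" by auto
    qed (simp add: finite_monoms_mdeg_le)
    obtain x where "is_lead v x" using ex_is_lead[of v r] Mc vM(1) False by blast
    with vM show ?thesis
    proof (induction "card {y\<in>?X. pot x y}" arbitrary: v x rule: less_induct)
      case less
      obtain j m where x: "x = (j, m)" by (cases x)
      have lv: "lookup (v j) m \<noteq> 0" using less.prems(3) by (simp add: is_lead_def x)
      have jr: "j < r" using carrD[of v r j m] lv less.prems(1) Mc by blast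
      have aN: "a j + mdeg m = N" using hom_vecD[OF less.prems(2) lv] .
      have "m \<in> L j" using less.prems x by (auto simp: L_def H_def)
      then obtain c k where c: "c \<in> B j" and "m = c + k" using B(3) by blast
      then have mk: "m = k + c" by (simp add: add.commute)
      define u where "u = w j c"
      have u: "u \<in> M" "is_lead u (j, c)" using w[OF c] by (auto simp: H_def u_def)
      obtain N' where N': "hom_vec a N' u" using w[OF c] by (auto simp: H_def u_def)
      have lu: "lookup (u j) c \<noteq> 0" using u(2) by (simp add: is_lead_def)
      have "N' = a j + mdeg c" using hom_vecD[OF N' lu] by simp
      then have NN: "N = N' + mdeg k" using aN mk by simp
      define \<alpha> where "\<alpha> = lookup (v j) m / lookup (u j) c"
      define v' where "v' = (\<lambda>i. v i + single k (- \<alpha>) * u i)"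
      have lku: "lookup (single k (- \<alpha>) * u i) (k + m') = - \<alpha> * lookup (u i) m'" for i m'
        by (rule lookup_single_mult_add)
      have v'M: "v' \<in> M" using M u(1) less.prems(1) by (auto simp: graded_submodule_def v'_def)
      have v'h: "hom_vec a N v'" unfolding v'_def NN
        using less.prems(2) NN by (intro hom_vec_add hom_vec_mult[OF _ N'] homogeneous_single) auto
      have "u \<in> G" using c jr by (auto simp: G_def u_def)
      then obtain l where l: "l < t" "u = E l" using E by auto
      have vv': "v = (\<lambda>i. v' i + single k \<alpha> * u i)"
        by (rule ext) (simp add: v'_def single_uminus)
      have sub: "pot x y" if y: "lookup (v' (fst y)) (snd y) \<noteq> 0" for y
      proof (rule ccontr)
        assume np: "\<not> pot x y"
        have vy: "lookup (v (fst y)) (snd y) = 0" if "y \<noteq> x"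
          using is_leadD[OF less.prems(3), of y] np that by blast
        show False
        proof (cases "y = x")
          case True
          then have "lookup (v' (fst y)) (snd y) = lookup (v j) m - \<alpha> * lookup (u j) c"
            using lku[of j c] by (simp add: x v'_def lookup_add mk)
          then show False using y lu by (simp add: \<alpha>_def)
        next
          case False
          then have "lookup (single k (- \<alpha>) * u (fst y)) (snd y) \<noteq> 0"
            using y vy by (simp add: v'_def lookup_add)
          moreover from this obtain m' where m': "snd y = k + m'"
            using lookup_single_mult_not[of "snd y" k] by blast
          ultimately have "lookup (u (fst y)) m' \<noteq> 0" using lku[of "fst y" m'] by auto
          then have "(fst y, m') = (j, c) \<or> pot (j, c) (fst y, m')"
            using is_leadD[OF u(2), of "(fst y, m')"] by auto
          then have "y = x \<or> pot x y"
            using m' add_mono[of c m' k] by (auto simp: pot_def x mk prod_eq_iff add.commute)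
          then show False using np False by blast
        qed
      qed
      have "v' \<in> ?R"
      proof (cases "v' = (\<lambda>_. 0)")
        case True
        then show ?thesis using lin_image_carr[of E t "\<lambda>_. 0"] by simp
      next
        case False
        then obtain x' where x': "is_lead v' x'" using ex_is_lead[of v' r] Mc v'M by blast
        have l': "lookup (v' (fst x')) (snd x') \<noteq> 0" using x' by (simp add: is_lead_def)
        have xx': "pot x x'" using sub l' .
        have "x' \<in> ?X"
        proof -
          have "fst x' < r" using carrD[of v' r "fst x'" "snd x'"] l' v'M Mc by blast
          then show ?thesis using hom_vecD[OF v'h l'] by simp
        qed
        then have "{y\<in>?X. pot x' y} \<subset> {y\<in>?X. pot x y}"
          using xx' pot.trans pot.irrefl by blast
        then have "card {y\<in>?X. pot x' y} < card {y\<in>?X. pot x y}"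
          by (rule psubset_card_mono[rotated]) (rule finite_subset[OF _ finX], blast)
        from less.hyps[OF this v'M v'h x'] show ?thesis .
      qed
      then obtain p where p: "v' = lin E t p" by blast
      have v: "v = lin E t (\<lambda>i. p i + (if i = l then single k \<alpha> else 0))"
        unfolding lin_add lin_unit[OF l(1)] using vv' p l(2) by simp
      show ?case unfolding v by (rule lin_image_carr)
    qed
  qed
  then have "M = ?R"
    using EH by (intro graded_submodule_eqI[OF M]) (auto simp: H_def)
  then show ?thesis using EH b by (intro exI[of _ t] exI[of _ b] exI[of _ E]) (auto simp: H_def)
qed

text \<open>The number of generators is taken as small as possible. A syzygy with a nonzero constant
  term in coordinate \<open>k\<close> would express the \<open>k\<close>-th generator by the
  others.\<close>

lemma graded_submodule_min_gen:
  fixes M :: "('n, 'k::field) pvec set"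
  assumes M: "graded_submodule r a M"
  shows "\<exists>t b E. (\<forall>k<t. E k \<in> M \<and> hom_vec a (b k) (E k)) \<and> M = lin E t ` carr t \<and>
    (\<forall>v. lin E t v = (\<lambda>_. 0) \<longrightarrow> (\<forall>k<t. lookup (v k) 0 = 0))"
proof -
  let ?P = "\<lambda>t. \<exists>b E. (\<forall>k<t. E k \<in> M \<and> hom_vec a (b k) (E k)) \<and> M = lin E t ` carr t"
  define t where "t = (LEAST t. ?P t)"
  have "?P t" unfolding t_def using graded_submodule_fin_gen[OF M] by (rule LeastI_ex)
  then obtain b E where E: "\<And>k. k < t \<Longrightarrow> E k \<in> M" "\<And>k. k < t \<Longrightarrow> hom_vec a (b k) (E k)"
    "M = lin E t ` carr t" by blast
  have "lookup (v k) 0 = 0" if v: "lin E t v = (\<lambda>_. 0)" and k: "k < t" for v k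
  proof (rule ccontr)
    assume c: "lookup (v k) 0 \<noteq> 0"
    \<comment> \<open>In degree \<open>b k\<close> the \<open>k\<close>-th coordinate of the syzygy
      has degree zero, so it reduces to its constant term, a unit.\<close>
    define u where "u = hvec b (b k) v"
    have u: "lin E t u = (\<lambda>_. 0)"
      using hvec_lin[where a = a and b = b and E = E and t = t and N = "b k" and v = v, OF E(2)] v by (simp add: u_def hvec_def)
    have uk: "u k = Const (lookup (v k) 0)"
      by (rule poly_mapping_eqI) (auto simp: u_def hvec_def lookup_Const)
    define skip where "skip i = (if i < k then i else Suc i)" for i
    have bij: "bij_betw skip {..<t - 1} ({..<t} - {k})"
    proof (rule bij_betw_imageI)
      show "inj_on skip {..<t - 1}" by (auto simp: inj_on_def skip_def split: if_splits)
      have "l \<in> skip ` {..<t - 1}" if "l < t" "l \<noteq> k" for l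
        using that k by (intro image_eqI[of _ _ "if l < k then l else l - 1"]) (auto simp: skip_def)
      then show "skip ` {..<t - 1} = {..<t} - {k}" using k by (auto simp: skip_def)
    qed
    have split: "(\<Sum>l<t. f l) = f k + (\<Sum>i<t - 1. f (skip i))" for f :: "nat \<Rightarrow> ('n, 'k) mpoly"
      using sum.reindex_bij_betw[OF bij, of f] k by (subst sum.remove[of _ k]) auto
    let ?E = "\<lambda>i. E (skip i)"
    have sk: "skip i < t" if "i < t - 1" for i using bij that by (auto simp: bij_betw_def)
    have "?P (t - 1)"
    proof (intro exI conjI allI impI)
      show "?E i \<in> M" "hom_vec a (b (skip i)) (?E i)" if "i < t - 1" for i
        using sk[OF that] E by auto
      show "M = lin ?E (t - 1) ` carr (t - 1)"
      proof (rule graded_submodule_eqI[OF M])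
        show "?E i \<in> M" if "i < t - 1" for i using sk[OF that] E by auto
        fix w N assume "w \<in> M"
        then obtain p where p: "w = lin E t p" using E(3) by blast
        let ?c = "Const (1 / lookup (v k) 0) :: ('n, 'k) mpoly"
        have one: "?c * u k = 1" using c by (simp add: uk flip: Const_mult)
        \<comment> \<open>This multiple of the syzygy is chosen to cancel the coefficient of the
          \<open>k\<close>-th generator.\<close>
        have "w = lin E t (\<lambda>l. p l - ?c * p k * u l)"
          unfolding lin_diff lin_scale u p by simp
        also have "\<dots> = lin ?E (t - 1) (\<lambda>i. p (skip i) - ?c * p k * u (skip i))"
        proof -
          have z: "p k - ?c * p k * u k = 0" using one by (metis diff_self mult.assoc mult.commute mult_1)
          show ?thesis unfolding lin_def split z by simp
        qed
        finally have w: "w = lin ?E (t - 1) (\<lambda>i. p (skip i) - ?c * p k * u (skip i))" .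
        show "w \<in> lin ?E (t - 1) ` carr (t - 1)" unfolding w by (rule lin_image_carr)
      qed
    qed
    then have "t \<le> t - 1" unfolding t_def by (rule Least_le)
    then show False using k by simp
  qed
  with E show ?thesis by blast
qed

end

section \<open>Minimal complexes modulo variables\<close>

definition var_ideal :: "'n set \<Rightarrow> ('n::finite, 'k::comm_ring_1) mpoly set" where
  "var_ideal A = {p. \<forall>m. lookup p m \<noteq> 0 \<longrightarrow> (\<exists>x\<in>A. lookup m x \<noteq> 0)}"

lemma var_idealD: "p \<in> var_ideal A \<Longrightarrow> lookup p m \<noteq> 0 \<Longrightarrow> \<exists>x\<in>A. lookup m x \<noteq> 0"
  by (simp add: var_ideal_def)

lemma var_idealI: "(\<And>m. lookup p m \<noteq> 0 \<Longrightarrow> \<exists>x\<in>A. lookup m x \<noteq> 0) \<Longrightarrow> p \<in> var_ideal A"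
  by (simp add: var_ideal_def)

lemma var_ideal_0 [simp]: "0 \<in> var_ideal A"
  by (simp add: var_ideal_def)

lemma var_ideal_empty [simp]: "p \<in> var_ideal {} \<longleftrightarrow> p = 0"
  by (auto simp: var_ideal_def intro: poly_mapping_eqI)

lemma var_ideal_add: "p \<in> var_ideal A \<Longrightarrow> q \<in> var_ideal A \<Longrightarrow> p + q \<in> var_ideal A"
proof (rule var_idealI)
  fix m assume *: "p \<in> var_ideal A" "q \<in> var_ideal A" "lookup (p + q) m \<noteq> 0"
  then have "lookup p m \<noteq> 0 \<or> lookup q m \<noteq> 0" by (auto simp: lookup_add)
  with * show "\<exists>x\<in>A. lookup m x \<noteq> 0" by (auto dest: var_idealD)
qed

lemma var_ideal_uminus: "p \<in> var_ideal A \<Longrightarrow> - p \<in> var_ideal A"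
  by (simp add: var_ideal_def)

lemma var_ideal_mult: "p \<in> var_ideal A \<Longrightarrow> q * p \<in> var_ideal A"
proof (rule var_idealI)
  fix m assume p: "p \<in> var_ideal A" and m: "lookup (q * p) m \<noteq> 0"
  then obtain l k where "m = l + k" "k \<in> keys p" using keys_mult[of q p] by (auto simp: in_keys_iff[symmetric])
  then show "\<exists>x\<in>A. lookup m x \<noteq> 0" using var_idealD[OF p, of k] by (auto simp: in_keys_iff lookup_add)
qed

lemma var_ideal_sum: "(\<And>x. x \<in> B \<Longrightarrow> f x \<in> var_ideal A) \<Longrightarrow> sum f B \<in> var_ideal A"
  by (induction B rule: infinite_finite_induct) (auto intro: var_ideal_add)

lemma var_ideal_mono: "A \<subseteq> B \<Longrightarrow> p \<in> var_ideal A \<Longrightarrow> p \<in> var_ideal B"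
  unfolding var_ideal_def by blast

lemma var_ideal_restrict_keys: "p \<in> var_ideal A \<Longrightarrow> restrict_keys P p \<in> var_ideal A"
  by (rule var_idealI) (auto split: if_splits dest: var_idealD)

lemma var_ideal_UNIV: "p \<in> var_ideal UNIV \<longleftrightarrow> lookup p 0 = 0"
proof
  assume "lookup p 0 = 0"
  then show "p \<in> var_ideal UNIV"
    by (intro var_idealI) (metis UNIV_I lookup_zero poly_mapping_eqI)
qed (auto dest: var_idealD)

lemma lookup_Var_mult_add: "lookup (Var x * p) (var_monom x + m) = lookup p m"
  for p :: "('n, 'k::comm_ring_1) mpoly"
  unfolding Var_def by (simp add: lookup_single_mult_add)

lemma var_ideal_Var_mult: "x \<in> A \<Longrightarrow> Var x * p \<in> var_ideal A"
proof (rule var_ideal_mult[of _ _ p, unfolded mult.commute[of p]])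
  assume "x \<in> A"
  then show "Var x \<in> var_ideal A"
    by (intro var_idealI) (auto simp: Var_def var_monom_def lookup_single when_def split: if_splits)
qed

lemma var_ideal_Var_cancel:
  assumes "Var x * p \<in> var_ideal A" "x \<notin> A"
  shows "p \<in> var_ideal A"
proof (rule var_idealI)
  fix m assume "lookup p m \<noteq> 0"
  then have "\<exists>y\<in>A. lookup (var_monom x + m) y \<noteq> 0"
    by (intro var_idealD[OF assms(1)]) (simp add: lookup_Var_mult_add)
  then obtain y where "y \<in> A" "lookup (var_monom x + m) y \<noteq> 0" by blast
  moreover from this assms(2) have "lookup (var_monom x) y = 0"
    by (auto simp: var_monom_def lookup_single when_def)
  ultimately show "\<exists>y\<in>A. lookup m y \<noteq> 0" by (auto simp: lookup_add)
qed

text \<open>\<open>s\<close> takes the terms divisible by a variable in \<open>A\<close>, and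
  \<open>q\<close> is the rest divided by \<open>x\<close>. The last property lets \<open>q\<close>
  inherit degree and support from \<open>p\<close>.\<close>

lemma var_ideal_insert_split:
  fixes p :: "('n::finite, 'k::comm_ring_1) mpoly"
  assumes "p \<in> var_ideal (insert x A)"
  obtains s q where "p = s + Var x * q" "s \<in> var_ideal A"
    "\<And>m. lookup q m \<noteq> 0 \<Longrightarrow> lookup p (var_monom x + m) \<noteq> 0"
proof -
  define P where "P m \<longleftrightarrow> (\<exists>y\<in>A. lookup m y \<noteq> 0)" for m :: "'n monom"
  define s where "s = restrict_keys P p"
  define q where "q = Poly_Mapping.map_key (\<lambda>m. var_monom x + m) (restrict_keys (\<lambda>m. \<not> P m) p)"
  have inj: "inj (\<lambda>m :: 'n monom. var_monom x + m)" by (simp add: inj_def)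
  have q: "lookup q m = (if P (var_monom x + m) then 0 else lookup p (var_monom x + m))" for m
    unfolding q_def by (simp add: map_key.rep_eq[OF inj])
  show ?thesis
  proof (rule that[of s q])
    show "s \<in> var_ideal A"
      unfolding s_def by (rule var_idealI) (auto simp: P_def split: if_splits)
    show "lookup p (var_monom x + m) \<noteq> 0" if "lookup q m \<noteq> 0" for m
      using that unfolding q by (auto split: if_splits)
    have "lookup p m = lookup s m + lookup (Var x * q) m" for m
    proof (cases "\<exists>k. m = var_monom x + k")
      case True
      then obtain k where m: "m = var_monom x + k" by blast
      show ?thesis unfolding m lookup_Var_mult_add q by (simp add: s_def)
    next
      case False
      have "lookup m x = 0"
      proof (rule ccontr)
        assume "lookup m x \<noteq> 0"
        then have "var_monom x + (m - var_monom x) = m"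
          by (intro monom_diff_add) (auto simp: var_monom_def lookup_single when_def)
        then show False using False by metis
      qed
      then have "lookup p m \<noteq> 0 \<Longrightarrow> P m"
        using var_idealD[OF assms, of m] by (auto simp: P_def)
      moreover have "lookup (Var x * q) m = 0"
        unfolding Var_def by (rule lookup_single_mult_not[OF False])
      ultimately show ?thesis by (auto simp: s_def)
    qed
    then show "p = s + Var x * q" by (intro poly_mapping_eqI) (simp add: lookup_add)
  qed
qed

definition in_var :: "'n set \<Rightarrow> ('n::finite, 'k::comm_ring_1) pvec \<Rightarrow> bool" where
  "in_var A v \<longleftrightarrow> (\<forall>j. v j \<in> var_ideal A)"

lemma in_var_lin: "in_var A v \<Longrightarrow> in_var A (lin E t v)"
  by (auto simp: in_var_def lin_def intro!: var_ideal_sum var_ideal_mult)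

text \<open>The complex resolves the quotient by \<open>I\<close>: index 0 is the ring itself, and
  the generators of \<open>I\<close> sit at index 1. So index \<open>i\<close> of a resolution of
  \<open>I\<close> is index \<open>Suc i\<close> here. \<open>minimal\<close> says that syzygies
  have no constant terms.\<close>

locale resolution =
  fixes I :: "('n::finite, 'k::field) mpoly set"
    and r :: "nat \<Rightarrow> nat" and a :: "nat \<Rightarrow> nat \<Rightarrow> nat" and E :: "nat \<Rightarrow> nat \<Rightarrow> ('n, 'k) pvec"
  assumes r_0: "r 0 = 1" and a_0: "a 0 = (\<lambda>_. 0)"
    and col_carr: "k < r (Suc i) \<Longrightarrow> E i k \<in> carr (r i)"
    and col_hom: "k < r (Suc i) \<Longrightarrow> hom_vec (a i) (a (Suc i) k) (E i k)"
    and image: "lin (E 0) (r 1) ` carr (r 1) = {v \<in> carr 1. v 0 \<in> I}"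
    and exact: "{v \<in> carr (r (Suc i)). lin (E i) (r (Suc i)) v = (\<lambda>_. 0)} =
      lin (E (Suc i)) (r (Suc (Suc i))) ` carr (r (Suc (Suc i)))"
    and minimal: "lin (E i) (r (Suc i)) v = (\<lambda>_. 0) \<Longrightarrow> k < r (Suc i) \<Longrightarrow> lookup (v k) 0 = 0"
begin

text \<open>The differential \<open>F\<^sub>i \<rightarrow> F\<^sub>i\<^sub>-\<^sub>1\<close> of the complex that ends with \<open>F\<^sub>0 = S\<close>, so \<open>F\<^sub>0/bd F\<^sub>1 = S/I\<close>.\<close>

definition bd :: "nat \<Rightarrow> ('n, 'k) pvec \<Rightarrow> ('n, 'k) pvec" where
  "bd i v = (case i of 0 \<Rightarrow> (\<lambda>_. 0) | Suc i' \<Rightarrow> lin (E i') (r i) v)"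

lemma bd_Suc: "bd (Suc i) v = lin (E i) (r (Suc i)) v"
  by (simp add: bd_def)

lemma bd_0: "bd 0 v = (\<lambda>_. 0)"
  by (simp add: bd_def)

lemma bd_add: "bd i (\<lambda>k. u k + v k) = (\<lambda>j. bd i u j + bd i v j)"
  by (cases i) (simp_all add: bd_Suc bd_0 lin_add)

lemma bd_diff: "bd i (\<lambda>k. u k - v k) = (\<lambda>j. bd i u j - bd i v j)"
  by (cases i) (simp_all add: bd_Suc bd_0 lin_diff)

lemma bd_scale: "bd i (\<lambda>k. p * v k) = (\<lambda>j. p * bd i v j)"
  by (cases i) (simp_all add: bd_Suc bd_0 lin_scale)

lemma in_var_bd: "in_var A v \<Longrightarrow> in_var A (bd i v)"
  by (cases i) (auto simp: bd_Suc bd_0 in_var_lin in_var_def[of _ "\<lambda>_. 0"])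

lemma bd_carr: "bd (Suc i) v \<in> carr (r i)"
  unfolding bd_Suc by (rule lin_carr) (rule col_carr)

lemma bd_image: "\<exists>u\<in>carr (r (Suc i)). bd (Suc i) v = bd (Suc i) u"
  using lin_image_carr[of "E i" "r (Suc i)" v] unfolding bd_Suc by blast

lemma bd_bd: "bd i (bd (Suc i) v) = (\<lambda>_. 0)"
proof (cases i)
  case (Suc i')
  obtain u where "u \<in> carr (r (Suc i))" "bd (Suc i) v = bd (Suc i) u" using bd_image by blast
  then have "bd (Suc i) v \<in> lin (E (Suc i')) (r (Suc (Suc i'))) ` carr (r (Suc (Suc i')))"
    unfolding bd_Suc Suc by simp
  then show ?thesis unfolding exact[symmetric] Suc bd_Suc by blast
qed (simp add: bd_0)

lemma hvec_bd: "hvec (a i) N (bd (Suc i) v) = bd (Suc i) (hvec (a (Suc i)) N v)"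
  unfolding bd_Suc by (rule hvec_lin) (rule col_hom)

text \<open>In terms of homology: the part of degree \<open>N\<close> of \<open>H\<^sub>i(F/(x\<^sub>A)F)\<close> vanishes.\<close>

definition exact_mod :: "'n set \<Rightarrow> nat \<Rightarrow> nat \<Rightarrow> bool" where
  "exact_mod A i N \<longleftrightarrow> (\<forall>v\<in>carr (r i). hom_vec (a i) N v \<longrightarrow> in_var A (bd i v) \<longrightarrow>
     (\<exists>w. in_var A (\<lambda>j. v j - bd (Suc i) w j)))"

text \<open>Multiplication by \<open>x\<close> is injective on the part of degree \<open>N\<close>
  of \<open>H_i(F/(x_A)F)\<close>.\<close>

definition nonzerodivisor_mod :: "'n set \<Rightarrow> 'n \<Rightarrow> nat \<Rightarrow> nat \<Rightarrow> bool" where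
  "nonzerodivisor_mod A x i N \<longleftrightarrow> (\<forall>w\<in>carr (r i). hom_vec (a i) N w \<longrightarrow> in_var A (bd i w) \<longrightarrow>
     (\<exists>u. in_var A (\<lambda>j. Var x * w j - bd (Suc i) u j)) \<longrightarrow>
     (\<exists>u. in_var A (\<lambda>j. w j - bd (Suc i) u j)))"

lemma exact_mod_nonzerodivisor: "exact_mod A i N \<Longrightarrow> nonzerodivisor_mod A x i N"
  unfolding exact_mod_def nonzerodivisor_mod_def by blast

lemma in_var_mono: "A \<subseteq> B \<Longrightarrow> in_var A v \<Longrightarrow> in_var B v"
  unfolding in_var_def using var_ideal_mono by blast

text \<open>The index is positive because the homology at index 0 is the quotient by
  \<open>I\<close>, which need not vanish.\<close>

lemma exact_mod_empty: "exact_mod {} (Suc i) N"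
  unfolding exact_mod_def
proof (intro ballI impI)
  fix v assume v: "v \<in> carr (r (Suc i))" "in_var {} (bd (Suc i) v)"
  then have "bd (Suc i) v = (\<lambda>_. 0)" by (auto simp: in_var_def)
  then have "v \<in> {v \<in> carr (r (Suc i)). lin (E i) (r (Suc i)) v = (\<lambda>_. 0)}"
    using v by (simp add: bd_Suc)
  then obtain w where "v = bd (Suc (Suc i)) w" unfolding exact bd_Suc by blast
  then show "\<exists>w. in_var {} (\<lambda>j. v j - bd (Suc (Suc i)) w j)"
    by (intro exI[of _ w]) (simp add: in_var_def)
qed

lemma exact_mod_0_insert: "exact_mod A 0 N \<Longrightarrow> exact_mod (insert x A) 0 N"
  unfolding exact_mod_def
proof (intro ballI impI)
  fix v :: "('n, 'k) pvec"
  assume *: "\<forall>v\<in>carr (r 0). hom_vec (a 0) N v \<longrightarrow> in_var A (bd 0 v) \<longrightarrow>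
      (\<exists>w. in_var A (\<lambda>j. v j - bd (Suc 0) w j))" and v: "v \<in> carr (r 0)" "hom_vec (a 0) N v"
  have "in_var A (bd 0 v)" by (simp add: in_var_def bd_0)
  with * v obtain w where "in_var A (\<lambda>j. v j - bd (Suc 0) w j)" by blast
  then show "\<exists>w. in_var (insert x A) (\<lambda>j. v j - bd (Suc 0) w j)"
    using in_var_mono[of A "insert x A"] by blast
qed

text \<open>This is the long exact homology sequence of \<open>0 \<rightarrow> F/(x\<^sub>A)F \<rightarrow> F/(x\<^sub>A)F \<rightarrow> F/(x\<^sub>A, x)F \<rightarrow> 0\<close>.\<close>

lemma exact_mod_insert:
  assumes x: "x \<notin> A" and ex: "exact_mod A (Suc i) N"
    and nz: "\<And>N'. N = Suc N' \<Longrightarrow> nonzerodivisor_mod A x i N'"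
  shows "exact_mod (insert x A) (Suc i) N"
  unfolding exact_mod_def
proof (intro ballI impI)
  fix v assume v: "v \<in> carr (r (Suc i))" "hom_vec (a (Suc i)) N v" "in_var (insert x A) (bd (Suc i) v)"
  let ?y = "bd (Suc i) v"
  \<comment> \<open>\<open>q\<close> represents the image of \<open>v\<close> under the connecting
    homomorphism; the condition on its terms gives it degree \<open>N - 1\<close>.\<close>
  have "\<exists>s q. ?y j = s + Var x * q \<and> s \<in> var_ideal A \<and>
      (\<forall>m. lookup q m \<noteq> 0 \<longrightarrow> lookup (?y j) (var_monom x + m) \<noteq> 0)" for j
  proof -
    have "?y j \<in> var_ideal (insert x A)" using v(3) by (simp add: in_var_def)
    then show ?thesis by (rule var_ideal_insert_split) blast
  qed
  then obtain s q where y: "\<And>j. ?y j = s j + Var x * q j" and s: "\<And>j. s j \<in> var_ideal A"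
    and q: "\<And>j m. lookup (q j) m \<noteq> 0 \<Longrightarrow> lookup (?y j) (var_monom x + m) \<noteq> 0" by metis
  have y': "?y = (\<lambda>j. s j + Var x * q j)" using y by blast
  have hy: "hom_vec (a i) N ?y" using hvec_bd[of i N v] hom_vec_hvec[of "a i" N ?y]
    by (simp add: hvec_hom_vec[OF v(2)])
  have hq: "Suc (a i j + mdeg m) = N" if "lookup (q j) m \<noteq> 0" for j m
    using hom_vecD[OF hy q[OF that]] by simp
  show "\<exists>w. in_var (insert x A) (\<lambda>j. v j - bd (Suc (Suc i)) w j)"
  proof (cases N)
    case 0
    \<comment> \<open>In degree 0 there is no room for a factor \<open>x\<close>, so
      \<open>v\<close> is already a cycle modulo \<open>A\<close>.\<close>
    then have "lookup (q j) m = 0" for j m using hq[of j m] by auto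
    then have "q j = 0" for j by (intro poly_mapping_eqI) simp
    then have "in_var A ?y" using s by (simp add: in_var_def y)
    then obtain w where "in_var A (\<lambda>j. v j - bd (Suc (Suc i)) w j)"
      using ex v(1,2) by (auto simp: exact_mod_def)
    then show ?thesis using in_var_mono[of A "insert x A"] by blast
  next
    case (Suc N')
    have qc: "q \<in> carr (r i)"
      unfolding carr_def
    proof (intro CollectI allI impI poly_mapping_eqI)
      fix j m assume "r i \<le> j"
      then have "?y j = 0" using bd_carr[of i v] by (simp add: carr_def)
      then show "lookup (q j) m = lookup 0 m" using q[of j m] by auto
    qed
    have qh: "hom_vec (a i) N' q" using hq by (intro hom_vecI) (auto simp: Suc)
    have "Var x * bd i q j \<in> var_ideal A" for j
    proof -
      have "(\<lambda>j. bd i s j + Var x * bd i q j) = (\<lambda>_. 0)"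
        using bd_bd[of i v] unfolding y' bd_add bd_scale .
      then have "bd i s j + Var x * bd i q j = 0" by (rule fun_cong)
      then have "Var x * bd i q j = - bd i s j" by (simp add: add_eq_0_iff)
      moreover have "bd i s j \<in> var_ideal A" using in_var_bd[of A s i] s by (simp add: in_var_def)
      ultimately show ?thesis by (simp add: var_ideal_uminus)
    qed
    then have bq: "in_var A (bd i q)" using var_ideal_Var_cancel x unfolding in_var_def by blast
    have "in_var A (\<lambda>j. Var x * q j - ?y j)"
      using s by (simp add: in_var_def y var_ideal_uminus)
    then obtain u1 where u1: "in_var A (\<lambda>j. q j - bd (Suc i) u1 j)"
      using nz[OF Suc] qc qh bq unfolding nonzerodivisor_mod_def by blast
    \<comment> \<open>\<open>u1\<close> comes without rank or degree. Its part of degree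
      \<open>N'\<close> in the carrier suffices and makes \<open>v'\<close> homogeneous.\<close>
    obtain u2 where u2: "u2 \<in> carr (r (Suc i))" "bd (Suc i) u1 = bd (Suc i) u2" using bd_image by blast
    define u where "u = hvec (a (Suc i)) N' u2"
    have uc: "u \<in> carr (r (Suc i))" and uh: "hom_vec (a (Suc i)) N' u"
      using u2(1) by (simp_all add: u_def hvec_carr)
    have "(\<lambda>j. q j - bd (Suc i) u j) = hvec (a i) N' (\<lambda>j. q j - bd (Suc i) u2 j)"
      unfolding hvec_diff hvec_hom_vec[OF qh] hvec_bd u_def ..
    moreover have "in_var A (hvec (a i) N' (\<lambda>j. q j - bd (Suc i) u2 j))"
      using u1 unfolding u2(2) in_var_def hvec_def by (blast intro: var_ideal_restrict_keys)
    ultimately have u: "in_var A (\<lambda>j. q j - bd (Suc i) u j)" by simp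
    \<comment> \<open>The correction by \<open>x u\<close> is invisible modulo \<open>x\<close> and
      turns \<open>v\<close> into a cycle modulo \<open>A\<close>, to which \<open>ex\<close>
      applies.\<close>
    define v' where "v' = (\<lambda>j. v j - Var x * u j)"
    have v'c: "v' \<in> carr (r (Suc i))" using v(1) uc by (simp add: v'_def carr_def)
    have "hom_vec (a (Suc i)) (N' + 1) (\<lambda>j. Var x * u j)" by (intro hom_vec_mult homogeneous_Var uh)
    then have v'h: "hom_vec (a (Suc i)) N v'"
      unfolding v'_def using v(2) by (intro hom_vec_diff) (simp_all add: Suc)
    have "bd (Suc i) v' = (\<lambda>j. s j + Var x * (q j - bd (Suc i) u j))"
      unfolding v'_def bd_diff bd_scale y' by (simp add: right_diff_distrib add_diff_eq)
    then have "in_var A (bd (Suc i) v')"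
      using s u by (simp add: in_var_def var_ideal_add var_ideal_mult)
    then obtain w where w: "in_var A (\<lambda>j. v' j - bd (Suc (Suc i)) w j)"
      using ex v'c v'h unfolding exact_mod_def by blast
    have "v j - bd (Suc (Suc i)) w j \<in> var_ideal (insert x A)" for j
    proof -
      have "v' j - bd (Suc (Suc i)) w j \<in> var_ideal (insert x A)"
        using w var_ideal_mono[of A "insert x A"] by (auto simp: in_var_def)
      moreover have "Var x * u j \<in> var_ideal (insert x A)" by (rule var_ideal_Var_mult) simp
      ultimately have "(v' j - bd (Suc (Suc i)) w j) + Var x * u j \<in> var_ideal (insert x A)"
        by (rule var_ideal_add)
      then show ?thesis by (simp add: v'_def algebra_simps)
    qed
    then show ?thesis unfolding in_var_def by blast
  qed
qed

text \<open>Modulo all variables the \<open>k\<close>-th basis vector is a cycle. If it were a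
  boundary, some boundary of the complex itself would have constant term 1 in coordinate
  \<open>k\<close>, against minimality.\<close>

lemma no_generator:
  assumes ex: "exact_mod UNIV (Suc i) (a (Suc i) k)" and k: "k < r (Suc i)"
    and col: "\<And>j. E i k j \<in> var_ideal UNIV"
  shows False
proof -
  let ?v = "\<lambda>l. if l = k then 1 else 0 :: ('n, 'k) mpoly"
  have "?v \<in> carr (r (Suc i))" using k by (simp add: carr_def)
  moreover have "hom_vec (a (Suc i)) (a (Suc i) k) ?v"
    by (rule hom_vecI) (auto simp: lookup_one when_def split: if_splits)
  moreover have "in_var UNIV (bd (Suc i) ?v)"
    unfolding bd_Suc lin_unit[OF k] in_var_def using col by simp
  ultimately obtain w where w: "in_var UNIV (\<lambda>j. ?v j - bd (Suc (Suc i)) w j)"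
    using ex unfolding exact_mod_def by blast
  have "lin (E i) (r (Suc i)) (bd (Suc (Suc i)) w) = (\<lambda>_. 0)"
    using bd_bd[of "Suc i" w] unfolding bd_Suc .
  then have "lookup (bd (Suc (Suc i)) w k) 0 = 0" using k by (rule minimal)
  moreover have "lookup (?v k - bd (Suc (Suc i)) w k) 0 = 0"
    using w unfolding in_var_def var_ideal_UNIV by blast
  ultimately show False by (simp add: lookup_minus)
qed

text \<open>A column is the image of a basis vector and hence a cycle, so \<open>minimal\<close> at
  the index below applies to it.\<close>

lemma col_no_const:
  assumes "k < r (Suc (Suc i))"
  shows "E (Suc i) k j \<in> var_ideal UNIV"
proof (cases "j < r (Suc i)")
  case True
  have "bd (Suc (Suc i)) (\<lambda>l. if l = k then 1 else 0) = E (Suc i) k"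
    unfolding bd_Suc using lin_unit[OF assms, of _ 1] by simp
  then have "lin (E i) (r (Suc i)) (E (Suc i) k) = (\<lambda>_. 0)"
    using bd_bd[of "Suc i" "\<lambda>l. if l = k then 1 else 0"] unfolding bd_Suc by simp
  then show ?thesis unfolding var_ideal_UNIV using True by (rule minimal)
next
  case False
  then show ?thesis using col_carr[OF assms] by (simp add: carr_def)
qed

text \<open>The complex is exact at positive indices, and each variable can move homology up by at
  most one index.\<close>

lemma exact_mod_card:
  assumes "finite A" "card A < i"
  shows "exact_mod A i N"
  using assms
proof (induction A arbitrary: i N rule: finite_induct)
  case empty
  then show ?case using exact_mod_empty by (cases i) auto
next
  case (insert x A)
  then obtain i' where i: "i = Suc i'" "card A < i'" by (cases i) auto
  show ?case unfolding i(1)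
    using insert.hyps i by (intro exact_mod_insert insert.IH exact_mod_nonzerodivisor) auto
qed

lemma finite_length:
  assumes "card (UNIV :: 'n set) < i"
  shows "r i = 0"
proof (rule ccontr)
  assume "r i \<noteq> 0"
  moreover have "card (UNIV :: 'n set) > 0" by (simp add: card_gt_0_iff)
  \<comment> \<open>There is at least one variable, so \<open>i \<ge> 2\<close>, and
    \<open>col_no_const\<close> covers the columns of the differential from index
    \<open>i\<close>.\<close>
  then have "i = Suc (Suc (i - 2))" using assms by linarith
  then obtain i' where i: "i = Suc (Suc i')" by blast
  ultimately have "0 < r (Suc (Suc i'))" by simp
  moreover have "exact_mod UNIV (Suc (Suc i')) (a (Suc (Suc i')) 0)"
    using assms unfolding i by (intro exact_mod_card) auto
  ultimately show False using no_generator[of "Suc i'" 0] col_no_const by blast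
qed

text \<open>
  The hypotheses say that the variables in \<open>A0\<close> form a regular sequence modulo \<open>I\<close> and that the
  quotient of \<open>S/I\<close> by these variables vanishes in degree at least \<open>d\<close>.
\<close>

lemma shift_bound:
  assumes I: "I \<subseteq> var_ideal UNIV"
    and regular: "\<And>A x p. A \<subseteq> A0 \<Longrightarrow> x \<in> A0 \<Longrightarrow> x \<notin> A \<Longrightarrow>
      \<exists>q\<in>I. Var x * p - q \<in> var_ideal A \<Longrightarrow> \<exists>q\<in>I. p - q \<in> var_ideal A"
    and top: "\<And>p N. N \<ge> d \<Longrightarrow> homogeneous N p \<Longrightarrow> \<exists>q\<in>I. p - q \<in> var_ideal A0"
    and k: "k < r (Suc i)"
  shows "a (Suc i) k \<le> d + i"
proof -
  have img: "\<exists>u. bd (Suc 0) u = (\<lambda>j. if j = 0 then q else 0)" if "q \<in> I" for q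
  proof -
    have "(\<lambda>j. if j = 0 then q else 0) \<in> {v \<in> carr 1. v 0 \<in> I}" using that by (simp add: carr_def)
    then show ?thesis unfolding image[symmetric] bd_Suc by auto
  qed
  have img': "bd (Suc 0) u 0 \<in> I" for u
  proof -
    have "lin (E 0) (r 1) u \<in> {v \<in> carr 1. v 0 \<in> I}" unfolding image[symmetric] by (rule lin_image_carr)
    then show ?thesis by (simp add: bd_Suc)
  qed
  have in0: "in_var A (\<lambda>j. w j - bd (Suc 0) u j) \<longleftrightarrow> w 0 - bd (Suc 0) u 0 \<in> var_ideal A"
    if "w \<in> carr 1" for A w u
  proof
    assume *: "w 0 - bd (Suc 0) u 0 \<in> var_ideal A"
    have "w j - bd (Suc 0) u j = 0" if "j \<noteq> 0" for j
      using that \<open>w \<in> carr 1\<close> bd_carr[of 0 u] by (simp add: carr_def r_0)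
    with * show "in_var A (\<lambda>j. w j - bd (Suc 0) u j)"
      unfolding in_var_def by (metis var_ideal_0)
  qed (simp add: in_var_def)
  have from_I: "\<exists>u. in_var A (\<lambda>j. w j - bd (Suc 0) u j)" if w: "w \<in> carr 1" "\<exists>q\<in>I. w 0 - q \<in> var_ideal A" for A w
  proof -
    from w(2) obtain q where q: "q \<in> I" "w 0 - q \<in> var_ideal A" by blast
    obtain u where "bd (Suc 0) u = (\<lambda>j. if j = 0 then q else 0)" using img[OF q(1)] by blast
    then have "w 0 - bd (Suc 0) u 0 \<in> var_ideal A" using q(2) by simp
    then show ?thesis using in0[OF w(1)] by blast
  qed
  have nz0: "nonzerodivisor_mod A x 0 N" if "A \<subseteq> A0" "x \<in> A0" "x \<notin> A" for A x N
    unfolding nonzerodivisor_mod_def r_0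
  proof (intro ballI impI)
    fix w assume w: "w \<in> carr 1" and "\<exists>u. in_var A (\<lambda>j. Var x * w j - bd (Suc 0) u j)"
    then obtain u where "Var x * w 0 - bd (Suc 0) u 0 \<in> var_ideal A" unfolding in_var_def by blast
    then have "\<exists>q\<in>I. Var x * w 0 - q \<in> var_ideal A" using img' by (rule bexI)
    then have "\<exists>q\<in>I. w 0 - q \<in> var_ideal A" by (rule regular[OF that])
    then show "\<exists>u. in_var A (\<lambda>j. w j - bd (Suc 0) u j)" by (rule from_I[OF w])
  qed
  \<comment> \<open>A regular sequence creates no homology at positive indices: \<open>nz0\<close>
    handles the connecting map to index 0, and at higher indices there is nothing to connect
    to.\<close>
  have 1: "\<forall>i N. exact_mod A (Suc i) N" if "finite A" "A \<subseteq> A0" for A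
    using that
  proof (induction rule: finite_induct)
    case empty
    then show ?case using exact_mod_empty by blast
  next
    case (insert x A)
    have "exact_mod (insert x A) (Suc i) N" for i N
    proof (rule exact_mod_insert)
      show "nonzerodivisor_mod A x i N'" for N'
        using insert nz0 exact_mod_nonzerodivisor by (cases i) auto
    qed (use insert in auto)
    then show ?case by blast
  qed
  have 2: "exact_mod A0 0 N" if "N \<ge> d" for N
    unfolding exact_mod_def r_0
  proof (intro ballI impI)
    fix v :: "('n, 'k) pvec"
    assume v: "v \<in> carr 1" "hom_vec (a 0) N v"
    then have "homogeneous N (v 0)" by (simp add: homogeneous_def hom_vec_def a_0)
    then show "\<exists>w. in_var A0 (\<lambda>j. v j - bd (Suc 0) w j)" 
      by (rule from_I[OF v(1) top[OF that]])
  qed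
  \<comment> \<open>Passing from index \<open>i'\<close> to \<open>Suc i'\<close> consults degree
    \<open>N - 1\<close> at index \<open>i'\<close>, so the bound has to grow by exactly one per
    index.\<close>
  have 3: "exact_mod (A0 \<union> A) i N" if "finite A" "N \<ge> d + i" for A i N
    using that
  proof (induction arbitrary: i N rule: finite_induct)
    case empty
    then show ?case using 1[of A0] 2 by (cases i) auto
  next
    case (insert x A)
    show ?case
    proof (cases "x \<in> A0 \<union> A")
      case True
      then show ?thesis using insert.IH[OF insert.prems] by (simp add: insert_absorb)
    next
      case False
      show ?thesis
      proof (cases i)
        case 0
        then show ?thesis using insert.IH[OF insert.prems] exact_mod_0_insert by simp
      next
        case (Suc i')
        have "exact_mod (insert x (A0 \<union> A)) (Suc i') N"
          using False insert.prems Suc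
          by (intro exact_mod_insert exact_mod_nonzerodivisor insert.IH) auto
        then show ?thesis by (simp add: Suc)
      qed
    qed
  qed
  have col: "E i k j \<in> var_ideal UNIV" for j
  proof (cases i)
    case 0
    have "bd (Suc 0) (\<lambda>l. if l = k then 1 else 0) = E 0 k"
      unfolding bd_Suc using lin_unit[of k "r (Suc 0)" "E 0" 1] k 0 by simp
    then have "E 0 k 0 \<in> var_ideal UNIV" using img'[of "\<lambda>l. if l = k then 1 else 0"] I by auto
    moreover have "E 0 k j = 0" if "j \<noteq> 0" using col_carr[of k 0] k that by (simp add: carr_def 0 r_0)
    ultimately show ?thesis by (cases "j = 0") (auto simp: 0)
  next
    case (Suc i')
    then show ?thesis using col_no_const k by simp
  qed
  show ?thesis
  proof (rule ccontr)
    assume "\<not> ?thesis"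
    \<comment> \<open>The negated claim reads \<open>d + Suc i \<le> a (Suc i) k\<close>, which is
      the range of \<open>3\<close> at index \<open>Suc i\<close>.\<close>
    then have "exact_mod (A0 \<union> UNIV) (Suc i) (a (Suc i) k)" by (intro 3) auto
    then show False using no_generator[OF _ k col] by simp
  qed
qed

end

section \<open>Minimal graded free resolutions\<close>

lemma graded_submodule_ideal:
  assumes "graded_ideal I"
  shows "graded_submodule 1 (\<lambda>_. 0) {v \<in> carr 1. v 0 \<in> I}"
proof -
  have sub: "ideal.subspace I" and h: "\<And>f d. f \<in> I \<Longrightarrow> hcomp d f \<in> I"
    using assms by (auto simp: graded_ideal_def)
  show ?thesis unfolding graded_submodule_def
    using ideal.subspace_0[OF sub] ideal.subspace_add[OF sub] ideal.subspace_scale[OF sub] h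
    by (auto simp: carr_def hvec_def)
qed

text \<open>Minimal generators of the current module are chosen, their syzygies form the next
  module, and so on.\<close>

lemma (in mono_order) ex_resolution:
  fixes I :: "('n, 'k::field) mpoly set"
  assumes "graded_ideal I"
  shows "\<exists>r a E. resolution I r a E"
proof -
  define M0 where "M0 = {v \<in> carr 1. v 0 \<in> I}"
  \<comment> \<open>A state holds the rank and shifts of a free module and the submodule to be
    generated next. The clause for \<open>n = 0\<close> fixes the initial state, which dependent
    choice would leave open.\<close>
  define P where "P = (\<lambda>(n::nat) (r, a, M :: ('n, 'k) pvec set).
    graded_submodule r a M \<and> (n = 0 \<longrightarrow> r = 1 \<and> a = (\<lambda>_. 0) \<and> M = M0))"
  define Q where "Q = (\<lambda>(n::nat) (r :: nat, a, M) (t, b, K).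
    \<exists>E :: nat \<Rightarrow> ('n, 'k) pvec. (\<forall>k<t. E k \<in> M \<and> hom_vec a (b k) (E k)) \<and> M = lin E t ` carr t \<and>
      (\<forall>v. lin E t v = (\<lambda>_. 0) \<longrightarrow> (\<forall>k<t. lookup (v k) 0 = 0)) \<and>
      K = {v \<in> carr t. lin E t v = (\<lambda>_. 0)})"
  have "\<exists>f. \<forall>n. P n (f n) \<and> Q n (f n) (f (Suc n))"
  proof (rule dependent_nat_choice)
    have "P 0 (1, \<lambda>_. 0, M0)" using graded_submodule_ideal[OF assms] by (simp add: P_def M0_def)
    then show "\<exists>x. P 0 x" by blast
  next
    fix x n assume P: "P n x"
    obtain r a M where x: "x = (r, a, M)" by (cases x)
    have M: "graded_submodule r a M" using P by (simp add: P_def x)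
    obtain t b E where E: "\<forall>k<t. E k \<in> M \<and> hom_vec a (b k) (E k)" "M = lin E t ` carr t"
      "\<forall>v. lin E t v = (\<lambda>_. 0) \<longrightarrow> (\<forall>k<t. lookup (v k) 0 = 0)"
      using graded_submodule_min_gen[OF M] by blast
    let ?K = "{v \<in> carr t. lin E t v = (\<lambda>_. 0)}"
    have "graded_submodule t b ?K"
      by (rule graded_submodule_ker[where a = a]) (use E(1) in blast)
    then have "P (Suc n) (t, b, ?K)" by (simp add: P_def)
    moreover have "Q n x (t, b, ?K)" unfolding Q_def x using E by blast
    ultimately show "\<exists>y. P (Suc n) y \<and> Q n x y" by blast
  qed
  then obtain f where f: "\<And>n. P n (f n)" "\<And>n. Q n (f n) (f (Suc n))" by blast
  define r where "r n = fst (f n)" for n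
  define a where "a n = fst (snd (f n))" for n
  define M where "M n = snd (snd (f n))" for n
  have fn: "f n = (r n, a n, M n)" for n by (simp add: r_def a_def M_def)
  define R where "R n E \<longleftrightarrow>
      (\<forall>k<r (Suc n). E k \<in> M n \<and> hom_vec (a n) (a (Suc n) k) (E k)) \<and>
      M n = lin E (r (Suc n)) ` carr (r (Suc n)) \<and>
      (\<forall>v. lin E (r (Suc n)) v = (\<lambda>_. 0) \<longrightarrow> (\<forall>k<r (Suc n). lookup (v k) 0 = 0)) \<and>
      M (Suc n) = {v \<in> carr (r (Suc n)). lin E (r (Suc n)) v = (\<lambda>_. 0)}" for n E
  have "\<forall>n. \<exists>E. R n E"
    using f(2) unfolding Q_def R_def fn by simp
  then obtain E where R: "\<And>n. R n (E n)" using choice by blast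
  have E: "k < r (Suc n) \<Longrightarrow> E n k \<in> M n \<and> hom_vec (a n) (a (Suc n) k) (E n k)"
    "M n = lin (E n) (r (Suc n)) ` carr (r (Suc n))"
    "lin (E n) (r (Suc n)) v = (\<lambda>_. 0) \<Longrightarrow> k < r (Suc n) \<Longrightarrow> lookup (v k) 0 = 0"
    "M (Suc n) = {v \<in> carr (r (Suc n)). lin (E n) (r (Suc n)) v = (\<lambda>_. 0)}" for n k v
    using R[of n] unfolding R_def by blast+
  have M: "M n \<subseteq> carr (r n)" for n
    using f(1)[of n] unfolding P_def fn by (simp add: graded_submodule_def)
  have start: "r 0 = 1" "a 0 = (\<lambda>_. 0)" "M 0 = M0"
    using f(1)[of 0] unfolding P_def fn by simp_all
  have "resolution I r a E"
  proof
    show "E i k \<in> carr (r i)" if "k < r (Suc i)" for k i using E(1)[OF that] M by blast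
    show "hom_vec (a i) (a (Suc i) k) (E i k)" if "k < r (Suc i)" for k i using E(1)[OF that] by blast
    show "lin (E 0) (r 1) ` carr (r 1) = {v \<in> carr 1. v 0 \<in> I}"
      using E(2)[of 0] start(3) by (simp add: M0_def)
    show "{v \<in> carr (r (Suc i)). lin (E i) (r (Suc i)) v = (\<lambda>_. 0)} =
      lin (E (Suc i)) (r (Suc (Suc i))) ` carr (r (Suc (Suc i)))" for i
      using E(2)[of "Suc i"] E(4)[of i] by simp
  qed (use start E(3) in auto)
  then show ?thesis by blast
qed

section \<open>Translation into vectors and matrices\<close>

definition pvec_of :: "('n, 'k::comm_ring_1) mpoly Matrix.vec \<Rightarrow> ('n, 'k) pvec" where
  "pvec_of v = (\<lambda>k. if k < dim_vec v then vec_index v k else 0)"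

lemma pvec_of_carr: "v \<in> carrier_vec t \<Longrightarrow> pvec_of v \<in> carr t"
  by (simp add: pvec_of_def carr_def)

lemma pvec_of_vec: "w \<in> carr t \<Longrightarrow> pvec_of (Matrix.vec t w) = w"
  by (auto simp: pvec_of_def carr_def)

lemma vec_pvec_of: "v \<in> carrier_vec t \<Longrightarrow> Matrix.vec t (pvec_of v) = v"
  by (intro eq_vecI) (auto simp: pvec_of_def)

lemma mat_mult_pvec:
  assumes "v \<in> carrier_vec t"
  shows "Matrix.mat r t (\<lambda>(j, k). E k j) *\<^sub>v v = Matrix.vec r (lin E t (pvec_of v))"
proof (rule eq_vecI)
  fix j assume j: "j < dim_vec (Matrix.vec r (lin E t (pvec_of v)))"
  then have "vec_index (Matrix.mat r t (\<lambda>(j, k). E k j) *\<^sub>v v) j = (\<Sum>k = 0..<t. E k j * vec_index v k)"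
    using assms by (simp add: scalar_prod_def)
  also have "\<dots> = (\<Sum>k<t. E k j * pvec_of v k)"
    using assms by (intro sum.cong) (auto simp: pvec_of_def)
  finally show "vec_index (Matrix.mat r t (\<lambda>(j, k). E k j) *\<^sub>v v) j =
      vec_index (Matrix.vec r (lin E t (pvec_of v))) j"
    using j by (simp add: lin_def)
qed simp

lemma scalar_prod_pvec:
  assumes "v \<in> carrier_vec t"
  shows "scalar_prod (Matrix.vec t (\<lambda>k. E k 0)) v = lin E t (pvec_of v) 0"
proof -
  have "scalar_prod (Matrix.vec t (\<lambda>k. E k 0)) v = (\<Sum>k = 0..<t. E k 0 * vec_index v k)"
    using assms by (simp add: scalar_prod_def)
  also have "\<dots> = (\<Sum>k<t. E k 0 * pvec_of v k)"
    using assms by (intro sum.cong) (auto simp: pvec_of_def)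
  finally show ?thesis by (simp add: lin_def)
qed

lemma vec_image_carr:
  "Matrix.vec t ` carr t = (carrier_vec t :: ('n, 'k::comm_ring_1) mpoly Matrix.vec set)"
proof (intro equalityI subsetI)
  fix v :: "('n, 'k) mpoly Matrix.vec"
  assume "v \<in> carrier_vec t"
  then show "v \<in> Matrix.vec t ` carr t"
    using vec_pvec_of[of v t] pvec_of_carr[of v t] by (metis image_eqI)
qed auto

lemma vec_eq_0_iff: "w \<in> carr t \<Longrightarrow> Matrix.vec t w = 0\<^sub>v t \<longleftrightarrow> w = (\<lambda>_. 0)"
proof
  assume w: "w \<in> carr t" "Matrix.vec t w = 0\<^sub>v t"
  have "w = pvec_of (Matrix.vec t w)" using pvec_of_vec[OF w(1)] by simp
  then show "w = (\<lambda>_. 0)" unfolding w(2) by (auto simp: pvec_of_def)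
qed (auto intro: eq_vecI)

context resolution begin

lemma mat_image:
  assumes "\<And>i. R i = Matrix.mat (r i) (r (Suc i)) (\<lambda>(j, k). E i k j)"
  shows "(\<lambda>v. R i *\<^sub>v v) ` carrier_vec (r (Suc i)) =
    Matrix.vec (r i) ` lin (E i) (r (Suc i)) ` carr (r (Suc i))"
proof -
  have "(\<lambda>v. R i *\<^sub>v v) ` carrier_vec (r (Suc i)) =
      (\<lambda>v. R i *\<^sub>v v) ` Matrix.vec (r (Suc i)) ` carr (r (Suc i))" by (simp only: vec_image_carr)
  also have "\<dots> = (\<lambda>w. Matrix.vec (r i) (lin (E i) (r (Suc i)) w)) ` carr (r (Suc i))"
    unfolding image_image assms by (intro image_cong refl) (simp add: mat_mult_pvec pvec_of_vec)
  finally show ?thesis by (simp add: image_image)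
qed

lemma mat_ker:
  assumes "\<And>i. R i = Matrix.mat (r i) (r (Suc i)) (\<lambda>(j, k). E i k j)"
  shows "{v \<in> carrier_vec (r (Suc i)). R i *\<^sub>v v = 0\<^sub>v (r i)} =
    (\<lambda>v. R (Suc i) *\<^sub>v v) ` carrier_vec (r (Suc (Suc i)))"
proof -
  have Rv: "R i *\<^sub>v v = Matrix.vec (r i) (lin (E i) (r (Suc i)) (pvec_of v))"
    if "v \<in> carrier_vec (r (Suc i))" for v
    unfolding assms by (rule mat_mult_pvec[OF that])
  have lc: "lin (E i) (r (Suc i)) w \<in> carr (r i)" for w
    using bd_carr[of i w] unfolding bd_Suc .
  have "{v \<in> carrier_vec (r (Suc i)). R i *\<^sub>v v = 0\<^sub>v (r i)} =
      Matrix.vec (r (Suc i)) ` {w \<in> carr (r (Suc i)). lin (E i) (r (Suc i)) w = (\<lambda>_. 0)}" (is "?L = ?R")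
  proof (intro equalityI subsetI)
    fix v assume v: "v \<in> ?L"
    then have vc: "v \<in> carrier_vec (r (Suc i))" and "R i *\<^sub>v v = 0\<^sub>v (r i)" by blast+
    from this(2) have "Matrix.vec (r i) (lin (E i) (r (Suc i)) (pvec_of v)) = 0\<^sub>v (r i)"
      unfolding Rv[OF vc] .
    then have "lin (E i) (r (Suc i)) (pvec_of v) = (\<lambda>_. 0)"
      using vec_eq_0_iff[OF lc] by blast
    with pvec_of_carr[OF vc] have "pvec_of v \<in> {w \<in> carr (r (Suc i)). lin (E i) (r (Suc i)) w = (\<lambda>_. 0)}"
      by blast
    then show "v \<in> ?R" by (rule image_eqI[rotated]) (rule vec_pvec_of[OF vc, symmetric])
  next
    fix v assume "v \<in> ?R"
    then obtain w where w: "w \<in> carr (r (Suc i))" "lin (E i) (r (Suc i)) w = (\<lambda>_. 0)"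
      "v = Matrix.vec (r (Suc i)) w" by blast
    have vc: "v \<in> carrier_vec (r (Suc i))" unfolding w(3) by simp
    have pv: "pvec_of v = w" unfolding w(3) by (rule pvec_of_vec[OF w(1)])
    have "R i *\<^sub>v v = Matrix.vec (r i) (\<lambda>_. 0)"
      unfolding Rv[OF vc] pv w(2) ..
    also have "\<dots> = 0\<^sub>v (r i)" by (rule eq_vecI) simp_all
    finally show "v \<in> ?L" using vc by blast
  qed
  then show ?thesis unfolding mat_image[OF assms] exact .
qed

lemma minimal_graded_free_resolution:
  "minimal_graded_free_resolution I (\<lambda>i. map (a (Suc i)) [0..<r (Suc i)])
     (Matrix.vec (r 1) (\<lambda>k. E 0 k 0))
     (\<lambda>i. Matrix.mat (r (Suc i)) (r (Suc (Suc i))) (\<lambda>(j, k). E (Suc i) k j))"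
proof -
  let ?a = "\<lambda>i. map (a (Suc i)) [0..<r (Suc i)]"
  let ?f = "Matrix.vec (r 1) (\<lambda>k. E 0 k 0)"
  \<comment> \<open>\<open>R 0\<close> is the augmentation as a matrix with one row, so
    \<open>mat_ker\<close> also covers exactness at the generators of \<open>I\<close>.\<close>
  define R where "R i = Matrix.mat (r i) (r (Suc i)) (\<lambda>(j, k). E i k j)" for i
  note ker = mat_ker[of R, OF R_def]
  have f: "scalar_prod ?f v = lin (E 0) (r 1) (pvec_of v) 0" if "v \<in> carrier_vec (r 1)" for v
    using scalar_prod_pvec[OF that] .
  have len: "\<exists>l. \<forall>i>l. ?a i = []"
    using finite_length by (intro exI[of _ "card (UNIV :: 'n set)"]) auto
  have hom: "homogeneous (a 1 k) (E 0 k 0)" if "k < r 1" for k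
    using col_hom[of k 0] that by (auto simp: homogeneous_def hom_vec_def a_0)
  have homD: "a (Suc i) j + mdeg m = a (Suc (Suc i)) k"
    if "k < r (Suc (Suc i))" "m \<in> keys (E (Suc i) k j)" for i j k m
    using col_hom[OF that(1)] that(2) by (auto simp: hom_vec_def)
  have min: "lookup (E (Suc i) k j) 0 = 0" if "k < r (Suc (Suc i))" for i j k
    using col_no_const[OF that] by (simp add: var_ideal_UNIV)
  have I: "I = {scalar_prod ?f v | v. v \<in> carrier_vec (r 1)}"
  proof (intro equalityI subsetI)
    fix p assume "p \<in> I"
    then have "(\<lambda>j. if j = 0 then p else 0) \<in> {v \<in> carr 1. v 0 \<in> I}" by (simp add: carr_def)
    then obtain w where w: "w \<in> carr (r 1)" "(\<lambda>j. if j = 0 then p else 0) = lin (E 0) (r 1) w"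
      unfolding image[symmetric] by blast
    have "p = lin (E 0) (r 1) w 0" using fun_cong[OF w(2), of 0] by simp
    also have "\<dots> = scalar_prod ?f (Matrix.vec (r 1) w)" 
      using f[of "Matrix.vec (r 1) w"] pvec_of_vec[OF w(1)] by simp
    finally show "p \<in> {scalar_prod ?f v | v. v \<in> carrier_vec (r 1)}" by auto
  next
    fix p assume "p \<in> {scalar_prod ?f v | v. v \<in> carrier_vec (r 1)}"
    then obtain v where "p = lin (E 0) (r 1) (pvec_of v) 0" using f by auto
    moreover have "lin (E 0) (r 1) (pvec_of v) \<in> {v \<in> carr 1. v 0 \<in> I}"
      unfolding image[symmetric] by (rule lin_image_carr)
    ultimately show "p \<in> I" by simp
  qed
  have ker0: "{v \<in> carrier_vec (r 1). scalar_prod ?f v = 0} =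
      (\<lambda>v. R 1 *\<^sub>v v) ` carrier_vec (r 2)"
  proof -
    have "scalar_prod ?f v = 0 \<longleftrightarrow> R 0 *\<^sub>v v = 0\<^sub>v (r 0)" if v: "v \<in> carrier_vec (r 1)" for v
    proof -
      have "R 0 *\<^sub>v v = Matrix.vec 1 (lin (E 0) (r 1) (pvec_of v))"
        unfolding R_def using mat_mult_pvec[of v "r 1" "r 0" "E 0"] v by (simp add: r_0)
      moreover have "Matrix.vec 1 w = 0\<^sub>v 1 \<longleftrightarrow> w 0 = 0" for w :: "('n, 'k) pvec"
        by (auto simp: vec_eq_iff)
      ultimately show ?thesis using f[OF v] by (simp add: r_0)
    qed
    then show ?thesis using ker[of 0] by (auto simp: numeral_2_eq_2)
  qed
  have kerS: "mat_kernel (R (Suc i)) = (\<lambda>v. R (Suc (Suc i)) *\<^sub>v v) ` carrier_vec (r (Suc (i + 2)))" for i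
    using ker[of "Suc i"] by (simp add: mat_kernel_def R_def)
  show ?thesis
    unfolding minimal_graded_free_resolution_def R_def[symmetric]
    using len hom homD min I ker0 kerS by (auto simp: R_def numeral_2_eq_2)
qed

end

section \<open>Bounds for the regularity\<close>

context mono_order begin

text \<open>The least number in \<open>reg\<close> is attained: by \<open>finite_length\<close> only
  finitely many shifts occur, so some bound exists.\<close>

lemma reg_least:
  fixes I :: "('n, 'k::field) mpoly set"
  assumes "graded_ideal I"
  shows "\<exists>a f D. minimal_graded_free_resolution I a f D \<and> (\<forall>i. \<forall>j < length (a i). a i ! j \<le> reg I + i)"
proof -
  obtain r a E where "resolution I r a E" using ex_resolution[OF assms] by blast
  then interpret resolution I r a E .
  define L where "L = card (UNIV :: 'n set)"
  \<comment> \<open>The inserted 0 keeps the maximum meaningful when there are no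
    generators.\<close>
  define d where "d = Max (insert 0 (\<Union>i\<le>L. a (Suc i) ` {..<r (Suc i)}))"
  have "a (Suc i) k \<le> d + i" if "k < r (Suc i)" for i k
  proof -
    have "i \<le> L" using that finite_length[of "Suc i"] unfolding L_def by (metis less_Suc_eq not_le not_less0)
    then have "a (Suc i) k \<le> d" unfolding d_def using that by (intro Max_ge) auto
    then show ?thesis by simp
  qed
  then have "\<exists>d a f D. minimal_graded_free_resolution I a f D \<and> (\<forall>i. \<forall>j < length (a i). a i ! j \<le> d + i)"
    using minimal_graded_free_resolution
    by (intro exI[of _ d] exI[of _ "\<lambda>i. map (a (Suc i)) [0..<r (Suc i)]"] exI conjI) auto
  then show ?thesis unfolding reg_def by (rule LeastI_ex)
qed

text \<open>This is the bound at index 0 in a resolution that attains the regularity.\<close>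

lemma generated_in_degree_le_reg:
  fixes I :: "('n, 'k::field) mpoly set"
  assumes "graded_ideal I" "p \<in> I"
  shows "\<exists>t (f :: nat \<Rightarrow> ('n, 'k) mpoly) v. p = (\<Sum>k<t. f k * v k) \<and>
    (\<forall>k<t. f k \<in> I \<and> (\<exists>e\<le>reg I. homogeneous e (f k)))"
proof -
  obtain a f D where res: "minimal_graded_free_resolution I a f D"
    and le: "\<And>i j. j < length (a i) \<Longrightarrow> a i ! j \<le> reg I + i"
    using reg_least[OF assms(1)] by blast
  let ?t = "length (a 0)"
  note conj = res[unfolded minimal_graded_free_resolution_def, THEN conjunct2]
  have f: "f \<in> carrier_vec ?t" by (rule conj[THEN conjunct1])
  have hom: "\<forall>j<?t. homogeneous (a 0 ! j) (vec_index f j)"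
    by (rule conj[THEN conjunct2, THEN conjunct2, THEN conjunct1])
  have I: "I = {scalar_prod f v | v. v \<in> carrier_vec ?t}"
    by (rule conj[THEN conjunct2, THEN conjunct2, THEN conjunct2, THEN conjunct2, THEN conjunct1])
  obtain v where v: "v \<in> carrier_vec ?t" "p = scalar_prod f v" using assms(2) I by blast
  have "p = (\<Sum>k<?t. vec_index f k * vec_index v k)"
    using v by (simp add: scalar_prod_def atLeast0LessThan)
  moreover have "vec_index f k \<in> I" if "k < ?t" for k
  proof -
    have "scalar_prod f (unit_vec ?t k) = vec_index f k" using f that by simp
    moreover have "scalar_prod f (unit_vec ?t k) \<in> I" 
      unfolding I by (intro CollectI exI[of _ "unit_vec ?t k"] conjI refl unit_vec_carrier)
    ultimately show ?thesis by simp
  qed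
  moreover have "\<exists>e\<le>reg I. homogeneous e (vec_index f k)" if "k < ?t" for k
    using hom that le[OF that] by auto
  ultimately show ?thesis by blast
qed

lemma reg_le:
  fixes I :: "('n, 'k::field) mpoly set"
  assumes "graded_ideal I" "I \<subseteq> var_ideal UNIV"
    and "\<And>A x p. A \<subseteq> A0 \<Longrightarrow> x \<in> A0 \<Longrightarrow> x \<notin> A \<Longrightarrow>
      \<exists>q\<in>I. Var x * p - q \<in> var_ideal A \<Longrightarrow> \<exists>q\<in>I. p - q \<in> var_ideal A"
    and "\<And>p N. N \<ge> d \<Longrightarrow> homogeneous N p \<Longrightarrow> \<exists>q\<in>I. p - q \<in> var_ideal A0"
  shows "reg I \<le> d"
proof -
  obtain r a E where "resolution I r a E" using ex_resolution[OF assms(1)] by blast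
  then interpret resolution I r a E .
  have "a (Suc i) k \<le> d + i" if "k < r (Suc i)" for i k
    using shift_bound[OF assms(2,3,4) that] .
  then show ?thesis unfolding reg_def
    using minimal_graded_free_resolution
    by (intro Least_le exI[of _ "\<lambda>i. map (a (Suc i)) [0..<r (Suc i)]"] exI conjI) auto
qed

end

section \<open>Orders other than the reverse lexicographic order\<close>

lemma monom_split:
  assumes "e \<le> mdeg n"
  shows "\<exists>a c. n = a + c \<and> mdeg a = e"
  using assms
proof (induction e)
  case 0
  show ?case by (intro exI[of _ 0] exI[of _ n]) simp
next
  case (Suc e)
  then obtain a c where n: "n = a + c" "mdeg a = e" by auto
  then have "c \<noteq> 0" using Suc.prems by auto
  then obtain j where j: "lookup c j \<noteq> 0" by (metis lookup_zero poly_mapping_eqI)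
  have "var_monom j + (c - var_monom j) = c"
    using j by (intro monom_diff_add) (auto simp: var_monom_def lookup_single when_def)
  then have "n = (a + var_monom j) + (c - var_monom j)" by (simp add: n(1) add.assoc)
  moreover have "mdeg (a + var_monom j) = Suc e" by (simp add: n(2))
  ultimately show ?case by blast
qed

lemma single_Suc_monom: "single k (Suc n) = var_monom k + single k n"
  by (simp add: var_monom_def flip: single_add)

lemma ex_var_monom:
  assumes "a \<noteq> 0"
  obtains i c where "a = var_monom i + c"
proof -
  obtain j where j: "lookup a j \<noteq> 0" using assms by (metis lookup_zero poly_mapping_eqI)
  have "var_monom j + (a - var_monom j) = a"
    using j by (intro monom_diff_add) (auto simp: var_monom_def lookup_single when_def)
  then show ?thesis using that by metis
qed

lemma lookup_var_monom: "lookup (var_monom i) j = (if i = j then 1 else 0)"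
  by (auto simp: var_monom_def lookup_single when_def)

context mono_order begin

lemma var_ge: "i \<le> j \<Longrightarrow> \<tau> (var_monom i) (var_monom j) \<or> var_monom i = var_monom j"
  using var_gt by (cases "i = j") auto

text \<open>\<open>x_k\<close> is the smallest variable up to index \<open>k\<close>, so replacing
  each factor by it cannot make the monomial larger.\<close>

lemma monom_ge_power:
  assumes "mdeg a = n" "\<And>i. lookup a i \<noteq> 0 \<Longrightarrow> i \<le> k"
  shows "\<tau> a (single k n) \<or> a = single k n"
  using assms
proof (induction n arbitrary: a)
  case (Suc n)
  then have "a \<noteq> 0" by auto
  then obtain i c where a: "a = var_monom i + c" by (rule ex_var_monom)
  have "i \<le> k" using Suc.prems(2)[of i] by (simp add: a lookup_add lookup_var_monom)
  moreover have "\<tau> c (single k n) \<or> c = single k n"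
    using Suc.prems by (intro Suc.IH) (auto simp: a lookup_add)
  ultimately show ?case
    using add_mono2[OF var_ge[of i k], of c "single k n"] by (auto simp: a single_Suc_monom)
qed simp

lemma monom_le_power:
  assumes "mdeg a = n" "\<And>i. lookup a i \<noteq> 0 \<Longrightarrow> k \<le> i"
  shows "\<tau> (single k n) a \<or> single k n = a"
  using assms
proof (induction n arbitrary: a)
  case (Suc n)
  then have "a \<noteq> 0" by auto
  then obtain i c where a: "a = var_monom i + c" by (rule ex_var_monom)
  have "k \<le> i" using Suc.prems(2)[of i] by (simp add: a lookup_add lookup_var_monom)
  moreover have "\<tau> (single k n) c \<or> single k n = c"
    using Suc.prems by (intro Suc.IH) (auto simp: a lookup_add)
  ultimately show ?case
    using add_mono2[OF var_ge[of k i], of "single k n" c] by (auto simp: a single_Suc_monom)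
qed simp

lemma not_rlex_reversed:
  assumes "\<tau> \<noteq> rlex"
  obtains a b where "rlex a b" "\<tau> b a"
proof -
  obtain a b where ab: "\<tau> a b \<noteq> rlex a b" using assms by blast
  have irr: "\<not> rlex a a" for a :: "'n monom" by (simp add: rlex_def)
  show ?thesis
  proof (cases "rlex a b")
    case True
    then have "\<tau> b a" using ab irr total[of a b] by auto
    with True show ?thesis by (rule that)
  next
    case False
    then have t: "\<tau> a b" using ab by simp
    then have ne: "a \<noteq> b" using irrefl by blast
    let ?D = "\<lambda>a b. {i. lookup a i \<noteq> lookup b i}"
    have sym: "?D a b = ?D b a" by auto
    have "?D a b \<noteq> {}" using ne by (auto intro: poly_mapping_eqI)
    then have "Max (?D a b) \<in> ?D a b" by (intro Max_in) auto
    then have "rlex b a" using False ne unfolding rlex_def Let_def sym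
      by (auto simp: not_less order_le_less)
    then show ?thesis using t by (rule that)
  qed
qed

text \<open>Let \<open>z\<close> be the last index at which the exponents differ. After
  cancellation, the monomial that is smaller for \<open>\<tau>\<close> has only variables before
  \<open>x_z\<close>, and the larger one contains \<open>x_z\<close>. They are replaced by the least
  and the greatest monomials of these shapes, where \<open>k\<close> is the predecessor of
  \<open>z\<close> and \<open>u\<close> the first index.\<close>

lemma not_rlex_witness:
  assumes "\<tau> \<noteq> rlex"
  obtains u k z d where "u \<noteq> k" "u < z" "k < z" "\<And>j. j < z \<Longrightarrow> j \<le> k" "0 < d"
    "\<tau> (single u (d - 1) + single z 1) (single k d)"
proof -
  obtain a b where r: "rlex a b" and t: "\<tau> b a" using not_rlex_reversed[OF assms] by blast
  have "\<not> mdeg a > mdeg b" using mdeg_gt[of b a] t asym by blast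
  define z where "z = Max {i. lookup a i \<noteq> lookup b i}"
  from r \<open>\<not> mdeg a > mdeg b\<close> have deg: "mdeg a = mdeg b" and ne: "a \<noteq> b" and z: "lookup a z < lookup b z"
    by (auto simp: rlex_def Let_def z_def)
  have above: "lookup a j = lookup b j" if "z < j" for j
  proof (rule ccontr)
    assume "lookup a j \<noteq> lookup b j"
    then have "j \<le> z" unfolding z_def by (intro Max_ge) auto
    then show False using that by simp
  qed
  \<comment> \<open>With truncated subtraction this is the greatest common divisor of the two
    monomials.\<close>
  define c where "c = a - (a - b)"
  have a: "a = (a - b) + c" and b: "b = (b - a) + c"
    by (rule poly_mapping_eqI; simp add: c_def lookup_add lookup_minus)+
  have t': "\<tau> (b - a) (a - b)" using t a b add_cancel by metis
  have deg': "mdeg (a - b) = mdeg (b - a)"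
    using deg arg_cong[OF a, of mdeg] arg_cong[OF b, of mdeg] by simp
  define d where "d = mdeg (b - a)"
  have bz: "lookup (b - a) z \<noteq> 0" using z by (simp add: lookup_minus)
  have d: "0 < d"
  proof -
    have "b - a \<noteq> 0" using bz by auto
    then show ?thesis by (simp add: d_def)
  qed
  have az: "j < z" if "lookup (a - b) j \<noteq> 0" for j
    using that above[of j] z by (cases j z rule: linorder_cases) (auto simp: lookup_minus)
  define k where "k = Max {j. j < z}"
  have "a - b \<noteq> 0" using d deg' by (auto simp: d_def)
  then obtain j where "lookup (a - b) j \<noteq> 0" by (metis lookup_zero poly_mapping_eqI)
  then have nonempty: "{j. j < z} \<noteq> {}" using az by blast
  then have kz: "k < z" using Max_in[of "{j. j < z}"] by (simp add: k_def)
  have kmax: "j \<le> k" if "j < z" for j using that by (simp add: k_def)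
  define u where "u = (Min UNIV :: 'n)"
  have u: "u \<le> j" for j by (simp add: u_def)
  have 1: "\<tau> (a - b) (single k d) \<or> a - b = single k d"
    using deg' az kmax by (intro monom_ge_power) (auto simp: d_def)
  define b' where "b' = (b - a) - var_monom z"
  have b': "b - a = var_monom z + b'" unfolding b'_def
    by (rule monom_diff_add[symmetric]) (use bz in \<open>auto simp: lookup_var_monom\<close>)
  have "mdeg b' = d - 1" using arg_cong[OF b', of mdeg] by (simp add: d_def)
  then have "\<tau> (single u (d - 1)) b' \<or> single u (d - 1) = b'"
    using u by (intro monom_le_power) auto
  then have 2: "\<tau> (single u (d - 1) + var_monom z) (b - a) \<or> single u (d - 1) + var_monom z = b - a"
    using add_mono[of "single u (d - 1)" b' "var_monom z"] by (auto simp: b' add.commute)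
  have 3: "\<tau> (single u (d - 1) + var_monom z) (single k d)"
    using 1 2 t' trans[of "b - a" "a - b" "single k d"]
      trans[of "single u (d - 1) + var_monom z" "b - a" "single k d"] by auto
  \<comment> \<open>Otherwise the mixed monomial would be \<open>x_k^(d-1) x_z\<close>, which is
    below \<open>x_k^d\<close> in every monomial order.\<close>
  have "u \<noteq> k"
  proof
    assume uk: "u = k"
    have "\<tau> (var_monom k) (var_monom z)" using var_gt[OF kz] .
    then have "\<tau> (var_monom k + single k (d - 1)) (var_monom z + single k (d - 1))" by (rule add_mono)
    then have "\<tau> (single k d) (single u (d - 1) + var_monom z)"
      using d by (cases d) (simp_all add: single_Suc_monom uk add.commute)
    then show False using 3 asym by blast
  qed
  moreover have "u < z" using u[of k] kz by simp
  ultimately show ?thesis using that kz kmax d 3 by (simp add: var_monom_def)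
qed

end

lemma keys_monomial_ideal:
  fixes M :: "'n::finite monom set" and p :: "('n, 'k::comm_ring_1) mpoly"
  assumes "p \<in> ideal_gen ((\<lambda>m. single m 1) ` M)" "lookup p m \<noteq> 0"
  shows "\<exists>m'\<in>M. \<exists>k. m = m' + k"
  using assms
proof (induction arbitrary: m rule: ideal.span_induct_alt)
  case (step c x y)
  then obtain m' where m': "m' \<in> M" "x = single m' 1" by blast
  have "lookup (c * x) m \<noteq> 0 \<or> lookup y m \<noteq> 0" using step.prems by (auto simp: lookup_add)
  then show ?case
  proof
    assume "lookup (c * x) m \<noteq> 0"
    then have "\<exists>k. m = m' + k"
      using lookup_single_mult_not[of m m' 1 c] by (auto simp: m'(2) mult.commute)
    then show ?thesis using m'(1) by blast
  qed (use step.IH in blast)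
qed simp

lemma lookup_binomial_power:
  fixes c :: "'k::comm_ring_1"
  assumes "i \<noteq> j"
  shows "lookup ((Var i + Const c * Var j) ^ n) (single i n) = 1"
proof (induction n)
  case (Suc n)
  let ?P = "(Var i + Const c * Var j) ^ n :: ('a, 'k) mpoly"
  have 1: "lookup (Var i * ?P) (single i (Suc n)) = 1"
    unfolding single_Suc_monom lookup_Var_mult_add by (rule Suc.IH)
  have "\<nexists>m. single i (Suc n) = var_monom j + m"
  proof
    assume "\<exists>m. single i (Suc n) = var_monom j + m"
    then obtain m where "single i (Suc n) = var_monom j + m" by blast
    from arg_cong[OF this, of "\<lambda>m. lookup m j"] show False
      using assms by (simp add: lookup_add lookup_single when_def lookup_var_monom)
  qed
  then have 2: "lookup (Var j * ?P) (single i (Suc n)) = 0"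
    unfolding Var_def by (rule lookup_single_mult_not)
  have "(Var i + Const c * Var j) ^ Suc n = Var i * ?P + Const c * (Var j * ?P)"
    by (simp add: distrib_right mult.assoc)
  then show ?case using 1 2 by (simp only: lookup_add lookup_Const_mult) simp
qed simp

section \<open>Polynomials in some of the variables\<close>

definition vars_in :: "'n set \<Rightarrow> ('n, 'k::zero) mpoly \<Rightarrow> bool" where
  "vars_in V p \<longleftrightarrow> (\<forall>m i. lookup p m \<noteq> 0 \<longrightarrow> i \<notin> V \<longrightarrow> lookup m i = 0)"

lemma vars_in_0 [simp]: "vars_in V 0" by (simp add: vars_in_def)

lemma vars_in_add: "vars_in V p \<Longrightarrow> vars_in V q \<Longrightarrow> vars_in V (p + q)"
  for p q :: "('n, 'k::comm_ring_1) mpoly"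
  unfolding vars_in_def lookup_add by (metis add_0)

lemma vars_in_mult:
  fixes p q :: "('n, 'k::comm_ring_1) mpoly"
  assumes "vars_in V p" "vars_in V q"
  shows "vars_in V (p * q)"
  unfolding vars_in_def
proof (intro allI impI)
  fix m i assume m: "lookup (p * q) m \<noteq> 0" and i: "i \<notin> V"
  then obtain l n where "m = l + n" "l \<in> keys p" "n \<in> keys q"
    using keys_mult[of p q] by (auto simp: in_keys_iff[symmetric])
  then show "lookup m i = 0" using assms i by (auto simp: vars_in_def in_keys_iff lookup_add)
qed

lemma vars_in_single: "(\<And>i. i \<notin> V \<Longrightarrow> lookup m i = 0) \<Longrightarrow> vars_in V (single m c)"
  by (auto simp: vars_in_def lookup_single when_def)

lemma vars_in_Const: "vars_in V (Const c)"
  unfolding Const_def by (rule vars_in_single) simp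

lemma vars_in_1 [simp]: "vars_in V (1 :: ('n, 'k::comm_ring_1) mpoly)"
  by (subst Const_1[symmetric]) (rule vars_in_Const)

lemma vars_in_Var: "i \<in> V \<Longrightarrow> vars_in V (Var i)"
  unfolding Var_def by (rule vars_in_single) (auto simp: lookup_var_monom)

lemma vars_in_sum: "(\<And>x. x \<in> A \<Longrightarrow> vars_in V (f x)) \<Longrightarrow> vars_in V (sum f A)"
  for f :: "'a \<Rightarrow> ('n, 'k::comm_ring_1) mpoly"
  by (induction A rule: infinite_finite_induct) (auto intro: vars_in_add)

lemma vars_in_prod: "(\<And>x. x \<in> A \<Longrightarrow> vars_in V (f x)) \<Longrightarrow> vars_in V (prod f A)"
  for f :: "'a \<Rightarrow> ('n, 'k::comm_ring_1) mpoly"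
  by (induction A rule: infinite_finite_induct) (auto intro: vars_in_mult)

lemma vars_in_power: "vars_in V p \<Longrightarrow> vars_in V (p ^ n)"
  for p :: "('n, 'k::comm_ring_1) mpoly"
  by (induction n) (auto intro: vars_in_mult)

lemma vars_in_gl_act:
  fixes p :: "('n::finite, 'k::comm_ring_1) mpoly"
  assumes "vars_in V p" "\<And>i. i \<in> V \<Longrightarrow> vars_in V (gl_act g (Var i))"
  shows "vars_in V (gl_act g p)"
proof -
  have "gl_act g p = (\<Sum>m\<in>keys p. gl_act g (single m (lookup p m)))"
    by (subst poly_mapping_sum_monomials[of "keys p" p]) (auto simp: gl_act_sum)
  moreover have "vars_in V (gl_act g (single m c))" if "m \<in> keys p" for m c
  proof -
    have *: "gl_act g (single m c) = Const c * (\<Prod>i\<in>UNIV. gl_act g (Var i) ^ lookup m i)"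
      unfolding gl_act_Var by (simp add: gl_act_def monom_subst_def)
    have "vars_in V (gl_act g (Var i) ^ lookup m i)" for i
    proof (cases "i \<in> V")
      case True
      then show ?thesis using assms(2) by (intro vars_in_power)
    next
      case False
      then have "lookup m i = 0" using assms(1) that by (auto simp: vars_in_def in_keys_iff)
      then show ?thesis by simp
    qed
    then show ?thesis unfolding * by (intro vars_in_mult vars_in_Const vars_in_prod)
  qed
  ultimately show ?thesis by (auto intro: vars_in_sum)
qed

section \<open>The witness ideal and its regularity\<close>

locale witness = mono_order \<tau>
  for \<tau> :: "'n::{finite, linorder} monom \<Rightarrow> 'n monom \<Rightarrow> bool" +
  fixes u k z :: 'n and d :: nat
  assumes u_ne_k: "u \<noteq> k" and u_z: "u < z" and k_z: "k < z" and k_max: "j < z \<Longrightarrow> j \<le> k"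
    and d_pos: "0 < d" and reversed: "\<tau> (single u (d - 1) + single z 1) (single k d)"
begin

definition adm :: "'n monom set" where
  "adm = {a. mdeg a = d \<and> (\<forall>i. \<not> i < z \<longrightarrow> lookup a i = 0)}"

definition gen :: "'n monom \<Rightarrow> ('n, 'k::comm_ring_1) mpoly" where
  "gen a = (if a = single k d then single a 1 - single (single k (d - 1) + single z 1) 1
            else single a 1)"

definition ideal :: "('n, 'k::comm_ring_1) mpoly set" where
  "ideal = ideal_gen (gen ` adm)"

lemma finite_adm: "finite adm"
  by (rule finite_subset[OF _ finite_monoms_mdeg[of d]]) (auto simp: adm_def)

lemma power_in_adm: "single k d \<in> adm"
  using k_z by (auto simp: adm_def lookup_single when_def)

lemma homogeneous_gen: "a \<in> adm \<Longrightarrow> homogeneous d (gen a)"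
  using d_pos by (auto simp: gen_def adm_def intro!: homogeneous_diff homogeneous_single)

lemma homogeneous_ideal: "homogeneous_ideal ideal"
  unfolding homogeneous_ideal_def ideal_def using homogeneous_gen by blast

lemma gen_in: "a \<in> adm \<Longrightarrow> p * gen a \<in> ideal"
  unfolding ideal_def by (intro ideal.span_scale ideal.span_base) auto

lemma ideal_add: "p \<in> ideal \<Longrightarrow> q \<in> ideal \<Longrightarrow> p + q \<in> ideal"
  unfolding ideal_def by (rule ideal.span_add)

lemma ideal_mult: "p \<in> ideal \<Longrightarrow> q * p \<in> ideal"
  unfolding ideal_def by (rule ideal.span_scale)

lemma ideal_sum: "(\<And>x. x \<in> A \<Longrightarrow> f x \<in> ideal) \<Longrightarrow> sum f A \<in> ideal"
  unfolding ideal_def by (rule ideal.span_sum)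

lemma ideal_0: "0 \<in> ideal"
  unfolding ideal_def by (rule ideal.span_zero)

lemma adm_in: "a \<in> adm \<Longrightarrow> a \<noteq> single k d \<Longrightarrow> single (m + a) c \<in> ideal"
  using gen_in[of a "single m c"] by (simp add: gen_def mult_single)

section \<open>Normal forms modulo the witness ideal\<close>

definition vdeg :: "'n monom \<Rightarrow> nat" where
  "vdeg m = (\<Sum>i | i < z. lookup m i)"

definition pure :: "'n monom \<Rightarrow> bool" where
  "pure m \<longleftrightarrow> (\<forall>i. i < z \<longrightarrow> i \<noteq> k \<longrightarrow> lookup m i = 0)"

text \<open>
  The normal form is linear over the polynomials in \<open>x\<^sub>z, \<dots>, x\<^sub>n\<close>. In the first case, a power \<open>x\<^sub>k\<^sup>t\<close>
  with \<open>t \<ge> d\<close> becomes \<open>x\<^sub>k\<^sup>d\<^sup>-\<^sup>1 x\<^sub>z\<^sup>t\<^sup>-\<^sup>d\<^sup>+\<^sup>1\<close>, and truncated subtraction leaves smaller powers alone.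
\<close>

definition nf_monom :: "'n monom \<Rightarrow> ('n, 'k::comm_ring_1) mpoly" where
  "nf_monom m =
     (if pure m then single (m - single k (lookup m k - (d - 1)) + single z (lookup m k - (d - 1))) 1
      else if vdeg m < d then single m 1 else 0)"

definition nf :: "('n, 'k::comm_ring_1) mpoly \<Rightarrow> ('n, 'k) mpoly" where
  "nf p = (\<Sum>m\<in>keys p. Const (lookup p m) * nf_monom m)"

lemma nf_superset:
  assumes "finite K" "keys p \<subseteq> K"
  shows "nf p = (\<Sum>m\<in>K. Const (lookup p m) * nf_monom m)"
  unfolding nf_def by (rule sum.mono_neutral_left) (use assms in \<open>auto simp: in_keys_iff\<close>)

lemma nf_add: "nf (p + q) = nf p + nf q"
proof -
  let ?K = "keys p \<union> keys q"
  have *: "finite ?K" "keys p \<subseteq> ?K" "keys q \<subseteq> ?K" "keys (p + q) \<subseteq> ?K"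
    using keys_add[of p q] by auto
  show ?thesis
    using * by (simp add: nf_superset[of ?K] lookup_add Const_add distrib_right sum.distrib)
qed

lemma nf_0 [simp]: "nf 0 = 0"
  by (simp add: nf_def)

lemma nf_diff: "nf (p - q) = nf p - nf q"
  using nf_add[of "p - q" q] by simp

lemma nf_single: "nf (single m c) = Const c * nf_monom m"
  using nf_superset[of "{m}" "single m c"] by simp

lemma nf_sum: "nf (sum f A) = (\<Sum>x\<in>A. nf (f x))"
  by (induction A rule: infinite_finite_induct) (auto simp: nf_add)

lemma sum_monomials: "p = (\<Sum>m\<in>keys p. single m (lookup p m))"
  by (rule poly_mapping_sum_monomials) auto

lemma vdeg_add: "vdeg (a + b) = vdeg a + vdeg b"
  by (simp add: vdeg_def lookup_add sum.distrib)

lemma pure_add: "pure (a + b) \<longleftrightarrow> pure a \<and> pure b"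
  by (auto simp: pure_def lookup_add)

lemma vdeg_pure: "pure m \<Longrightarrow> vdeg m = lookup m k"
proof -
  assume "pure m"
  then have "vdeg m = (\<Sum>i | i < z. if i = k then lookup m k else 0)"
    unfolding vdeg_def by (intro sum.cong) (auto simp: pure_def)
  then show ?thesis using k_z by simp
qed

lemma vdeg_single: "vdeg (single i n) = (if i < z then n else 0)"
proof -
  have "vdeg (single i n) = (\<Sum>j | j < z. if j = i then n else 0)"
    unfolding vdeg_def by (intro sum.cong) (auto simp: lookup_single when_def)
  then show ?thesis by simp
qed

lemma pure_single: "i = k \<or> \<not> i < z \<Longrightarrow> pure (single i n)"
  by (auto simp: pure_def lookup_single when_def)

lemma vdeg_pos_if_not_pure: "\<not> pure m \<Longrightarrow> 0 < vdeg m"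
  unfolding pure_def vdeg_def by (auto intro!: sum_pos2)

lemma vdeg_adm: "a \<in> adm \<Longrightarrow> vdeg a = d"
proof -
  assume a: "a \<in> adm"
  have "vdeg a = mdeg a" unfolding vdeg_def mdeg_def
    by (rule sum.mono_neutral_left) (use a in \<open>auto simp: adm_def\<close>)
  then show ?thesis using a by (simp add: adm_def)
qed

lemma not_pure_adm:
  assumes a: "a \<in> adm" "a \<noteq> single k d"
  shows "\<not> pure a"
proof
  assume p: "pure a"
  then have "lookup a k = d" using vdeg_pure[OF p] vdeg_adm[OF a(1)] by simp
  then have "a = single k d"
    using p a(1) by (intro poly_mapping_eqI) (auto simp: lookup_single when_def pure_def adm_def)
  then show False using a by simp
qed

text \<open>Multiples of the monomial generators are not pure and have \<open>vdeg\<close> at least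
  \<open>d\<close>. For the binomial, a pure \<open>m\<close> gives two terms with the same normal
  form; otherwise \<open>m\<close> adds at least 1 to the \<open>vdeg\<close> of each term, so both
  vanish.\<close>

lemma nf_gen:
  assumes a: "a \<in> adm"
  shows "nf (single m c * gen a) = (0 :: ('n, 'k::comm_ring_1) mpoly)"
proof (cases "a = single k d")
  case False
  then have "nf_monom (m + a) = (0 :: ('n, 'k) mpoly)"
    using not_pure_adm[OF a False] vdeg_adm[OF a] by (simp add: nf_monom_def pure_add vdeg_add)
  then show ?thesis using False by (simp add: gen_def mult_single nf_single)
next
  case True
  let ?b = "single k (d - 1) + single z 1 :: 'n monom"
  have pb: "pure a" "pure ?b" using True by (auto simp: pure_add intro!: pure_single)
  have "nf_monom (m + a) = (nf_monom (m + ?b) :: ('n, 'k) mpoly)"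
  proof (cases "pure m")
    case m: True
    let ?n = "\<lambda>m. m - single k (lookup m k - (d - 1)) + single z (lookup m k - (d - 1)) :: 'n monom"
    have "?n (m + a) = ?n (m + ?b)"
      using d_pos k_z unfolding True
      by (intro poly_mapping_eqI) (auto simp: lookup_add lookup_minus lookup_single when_def)
    then show ?thesis using m pb unfolding nf_monom_def by (simp add: pure_add)
  next
    case m: False
    have "vdeg (m + a) \<ge> d" "vdeg (m + ?b) \<ge> d"
      using vdeg_adm[OF a] vdeg_pos_if_not_pure[OF m] k_z d_pos by (auto simp: vdeg_add vdeg_single)
    then show ?thesis using m by (simp add: nf_monom_def pure_add)
  qed
  then show ?thesis using True
    by (simp add: gen_def right_diff_distrib mult_single nf_single nf_diff)
qed

lemma nf_ideal:
  assumes "p \<in> ideal"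
  shows "nf p = 0"
  using assms unfolding ideal_def
proof (induction rule: ideal.span_induct_alt)
  case (step c x y)
  then obtain a where a: "a \<in> adm" "x = gen a" by blast
  have "c * x = (\<Sum>m\<in>keys c. single m (lookup c m) * gen a)"
    unfolding a(2) by (subst sum_monomials) (simp add: sum_distrib_right)
  then have "nf (c * x) = 0" by (simp add: nf_sum nf_gen[OF a(1)])
  then show ?case using step.IH by (simp add: nf_add)
qed simp

text \<open>Each multiple of the binomial trades one \<open>x_k\<close> for one \<open>x_z\<close>,
  as long as \<open>d\<close> factors \<open>x_k\<close> are present.\<close>

lemma reduce_power:
  "single (w + single k (d - 1 + s)) 1 - single (w + single k (d - 1) + single z s) 1 \<in>
    (ideal :: ('n, 'k::comm_ring_1) mpoly set)"
proof (induction s arbitrary: w)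
  case 0
  show ?case by (simp add: ideal_0)
next
  case (Suc s)
  have 1: "single (w + single k s) 1 * gen (single k d) =
      single (w + single k (d - 1 + Suc s)) 1 - (single (w + single z 1 + single k (d - 1 + s)) 1 :: ('n, 'k) mpoly)"
  proof -
    have "w + single k s + single k d = w + single k (d - 1 + Suc s)"
      "w + single k s + (single k (d - 1) + single z 1) = w + single z 1 + single k (d - 1 + s)"
      using d_pos by (auto intro!: poly_mapping_eqI simp: lookup_add lookup_single when_def)
    then show ?thesis by (simp add: gen_def right_diff_distrib mult_single)
  qed
  have 2: "w + single z 1 + single k (d - 1) + single z s = w + single k (d - 1) + single z (Suc s)"
    by (auto intro!: poly_mapping_eqI simp: lookup_add lookup_single when_def)
  have "single (w + single k s) 1 * gen (single k d) +
      (single (w + single z 1 + single k (d - 1 + s)) 1 -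
       single (w + single z 1 + single k (d - 1) + single z s) 1) \<in> (ideal :: ('n, 'k) mpoly set)"
    by (intro ideal_add gen_in power_in_adm Suc.IH)
  then show ?case unfolding 1 2 by simp
qed

lemma diff_nf_monom: "single m 1 - nf_monom m \<in> (ideal :: ('n, 'k::comm_ring_1) mpoly set)"
proof (cases "pure m")
  case True
  define s where "s = lookup m k - (d - 1)"
  show ?thesis
  proof (cases "s = 0")
    case True
    then show ?thesis using \<open>pure m\<close> unfolding nf_monom_def s_def[symmetric] by (simp add: ideal_0)
  next
    case False
    define w where "w = m - single k (d - 1 + s)"
    have m: "m = w + single k (d - 1 + s)"
      using False by (intro poly_mapping_eqI)
        (auto simp: w_def s_def lookup_add lookup_minus lookup_single when_def)
    have m': "m - single k s = w + single k (d - 1)"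
      unfolding m by (intro poly_mapping_eqI) (auto simp: lookup_add lookup_minus lookup_single when_def)
    show ?thesis
      using reduce_power[of w s] \<open>pure m\<close> unfolding nf_monom_def s_def[symmetric] m' m[symmetric] by simp
  qed
next
  case False
  show ?thesis
  proof (cases "vdeg m < d")
    case True
    then show ?thesis using False by (simp add: nf_monom_def ideal_0)
  next
    case v: False
    obtain i where i: "i < z" "i \<noteq> k" "lookup m i \<noteq> 0" using False by (auto simp: pure_def)
    \<comment> \<open>The part of \<open>m\<close> in the variables before \<open>x_z\<close>; an
      admissible divisor has to be found inside it.\<close>
    define m' where "m' = (\<Sum>j | j < z. single j (lookup m j))"
    have lm': "lookup m' j = (if j < z then lookup m j else 0)" for j
    proof -
      have "lookup m' j = (\<Sum>l | l < z. if l = j then lookup m j else 0)"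
        unfolding m'_def lookup_sum by (intro sum.cong) (auto simp: lookup_single when_def)
      then show ?thesis by simp
    qed
    have mm': "m = m' + (m - m')" by (rule monom_diff_add[symmetric]) (simp add: lm')
    have "mdeg m' = vdeg m"
      unfolding mdeg_def vdeg_def by (rule sum.mono_neutral_cong_right) (auto simp: lm')
    define n where "n = m' - var_monom i"
    have m'n: "m' = var_monom i + n"
      unfolding n_def by (rule monom_diff_add[symmetric]) (use i in \<open>auto simp: lookup_var_monom lm'\<close>)
    have "d - 1 \<le> mdeg n" using \<open>mdeg m' = vdeg m\<close> v d_pos by (simp add: m'n)
    then obtain a c where n: "n = a + c" "mdeg a = d - 1" using monom_split by blast
    \<comment> \<open>The divisor is built around \<open>x_i\<close> with
      \<open>i \<noteq> k\<close>, so that it differs from \<open>x_k^d\<close>, whose generator is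
      not a monomial.\<close>
    let ?a = "var_monom i + a"
    have "lookup ?a j = 0" if "\<not> j < z" for j
      using lm'[of j] that by (simp add: m'n n lookup_add)
    then have "?a \<in> adm" using n(2) d_pos by (simp add: adm_def)
    moreover have "?a \<noteq> single k d"
    proof
      assume "?a = single k d"
      from arg_cong[OF this, of "\<lambda>m. lookup m i"] show False
        using i by (simp add: lookup_add lookup_var_monom lookup_single when_def)
    qed
    ultimately have "single ((c + (m - m')) + ?a) 1 \<in> (ideal :: ('n, 'k) mpoly set)" by (rule adm_in)
    moreover have "(c + (m - m')) + ?a = m"
      using mm' m'n n(1) by (simp add: ac_simps)
    ultimately show ?thesis using False v by (simp add: nf_monom_def)
  qed
qed

text \<open>Together with \<open>nf_ideal\<close> this makes \<open>nf\<close> a linear projection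
  with kernel \<open>ideal\<close>.\<close>

lemma diff_nf: "p - nf p \<in> ideal"
proof -
  have "p - nf p = (\<Sum>m\<in>keys p. Const (lookup p m) * (single m 1 - nf_monom m))"
    unfolding nf_def by (subst (1) sum_monomials)
      (simp add: right_diff_distrib sum_subtractf Const_mult_single)
  then show ?thesis by (simp add: ideal_sum ideal_mult diff_nf_monom)
qed

lemma nf_monom_add_outer:
  assumes "\<not> x < z"
  shows "nf_monom (var_monom x + m) = Var x * nf_monom m"
proof -
  have p: "pure (var_monom x)" "vdeg (var_monom x) = 0"
    using assms by (auto simp: var_monom_def vdeg_single intro: pure_single)
  have xk: "x \<noteq> k" using assms k_z by auto
  then have l: "lookup (var_monom x + m) k = lookup m k" by (simp add: lookup_add lookup_var_monom)
  have "var_monom x + m - single k s + single z s = var_monom x + (m - single k s + single z s)" for s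
    using xk by (intro poly_mapping_eqI)
      (auto simp: lookup_add lookup_minus lookup_single when_def lookup_var_monom)
  then show ?thesis unfolding nf_monom_def l
    by (simp add: pure_add vdeg_add p Var_def mult_single)
qed

text \<open>This linearity is what makes \<open>x_z\<close> and the later variables a regular
  sequence modulo the ideal.\<close>

lemma nf_Var_mult:
  assumes "\<not> x < z"
  shows "nf (Var x * p) = Var x * nf p"
proof -
  have "nf (Var x * p) = (\<Sum>m\<in>keys p. nf (Var x * single m (lookup p m)))"
    by (subst (1) sum_monomials) (simp add: sum_distrib_left nf_sum)
  also have "\<dots> = (\<Sum>m\<in>keys p. Const (lookup p m) * nf_monom (var_monom x + m))"
    by (simp add: Var_def mult_single nf_single)
  also have "\<dots> = Var x * nf p"
    unfolding nf_def sum_distrib_left nf_monom_add_outer[OF assms]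
    by (intro sum.cong refl) (simp add: mult.left_commute)
  finally show ?thesis .
qed

lemma single_var_ideal: "x \<in> A \<Longrightarrow> lookup m x \<noteq> 0 \<Longrightarrow> single m c \<in> var_ideal A"
  by (rule var_idealI) (auto simp: lookup_single when_def split: if_splits)

text \<open>Normalizing a monomial removes only factors \<open>x_k\<close>, or the whole term. So no
  variable of \<open>A\<close> is lost from a surviving term.\<close>

lemma nf_var_ideal:
  assumes p: "p \<in> var_ideal A" and A: "A \<subseteq> {x. \<not> x < z}"
  shows "nf p \<in> var_ideal A"
  unfolding nf_def
proof (intro var_ideal_sum var_ideal_mult)
  fix m assume "m \<in> keys p"
  then obtain x where x: "x \<in> A" "lookup m x \<noteq> 0"
    using var_idealD[OF p, of m] by (auto simp: in_keys_iff)
  then have "x \<noteq> k" using A k_z by auto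
  then have "lookup (m - single k s + single z t) x \<noteq> 0" for s t
    using x(2) by (simp add: lookup_add lookup_minus lookup_single when_def)
  then show "nf_monom m \<in> var_ideal A"
    using x by (auto simp: nf_monom_def intro: single_var_ideal[OF x(1)])
qed

text \<open>In degree at least \<open>d\<close>, a monomial with \<open>vdeg\<close> below
  \<open>d\<close> contains \<open>x_z\<close> or a later variable. A pure one with larger
  \<open>vdeg\<close> acquires a factor \<open>x_z\<close>, and all others vanish.\<close>

lemma nf_top:
  fixes p :: "('n, 'k::comm_ring_1) mpoly"
  assumes "homogeneous N p" "d \<le> N"
  shows "nf p \<in> var_ideal {x. \<not> x < z}"
  unfolding nf_def
proof (intro var_ideal_sum var_ideal_mult)
  fix m assume "m \<in> keys p"
  then have m: "mdeg m = N" using assms(1) by (simp add: homogeneous_def)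
  have outer: "single m 1 \<in> (var_ideal {x. \<not> x < z} :: ('n, 'k) mpoly set)" if v: "vdeg m < d"
  proof -
    have "\<exists>x. \<not> x < z \<and> lookup m x \<noteq> 0"
    proof (rule ccontr)
      assume "\<not> ?thesis"
      then have "vdeg m = mdeg m" unfolding vdeg_def mdeg_def
        by (intro sum.mono_neutral_left) auto
      then show False using v m assms(2) by simp
    qed
    then show ?thesis by (auto intro: single_var_ideal)
  qed
  show "nf_monom m \<in> (var_ideal {x. \<not> x < z} :: ('n, 'k) mpoly set)"
  proof (cases "pure m")
    case True
    show ?thesis
    proof (cases "lookup m k < d")
      case True
      then have "lookup m k - (d - 1) = 0" "vdeg m < d" using vdeg_pure[OF \<open>pure m\<close>] by auto
      then show ?thesis using outer \<open>pure m\<close> by (simp add: nf_monom_def)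
    next
      case False
      have "lookup (m - single k s + single z (lookup m k - (d - 1))) z \<noteq> 0" for s
        using False d_pos by (simp add: lookup_add)
      then have "single (m - single k s + single z (lookup m k - (d - 1))) 1 \<in>
          (var_ideal {x. \<not> x < z} :: ('n, 'k) mpoly set)" for s
        by (intro single_var_ideal[of z]) auto
      then show ?thesis using \<open>pure m\<close> by (simp add: nf_monom_def)
    qed
  next
    case False
    then show ?thesis using outer by (simp add: nf_monom_def)
  qed
qed

lemma reg_ideal_le: "reg (ideal :: ('n, 'k::field) mpoly set) \<le> d"
proof (rule reg_le)
  show "graded_ideal (ideal :: ('n, 'k) mpoly set)" by (rule homogeneous_ideal_graded[OF homogeneous_ideal])
  have "lookup (gen a :: ('n, 'k) mpoly) 0 = 0" if "a \<in> adm" for a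
    using homogeneous_lookup_0[OF homogeneous_gen[OF that], of 0] d_pos by simp
  then have "gen a \<in> (var_ideal UNIV :: ('n, 'k) mpoly set)" if "a \<in> adm" for a
    using that by (simp add: var_ideal_UNIV)
  moreover have "ideal.subspace (var_ideal UNIV :: ('n, 'k) mpoly set)"
    by (rule ideal.subspaceI) (auto intro: var_ideal_add var_ideal_mult)
  ultimately show "ideal \<subseteq> (var_ideal UNIV :: ('n, 'k) mpoly set)"
    unfolding ideal_def by (intro ideal.span_minimal) auto
next
  fix A x and p :: "('n, 'k) mpoly"
  assume A: "A \<subseteq> {x. \<not> x < z}" "x \<in> {x. \<not> x < z}" "x \<notin> A"
    and "\<exists>q\<in>ideal. Var x * p - q \<in> var_ideal A"
  then obtain q where q: "q \<in> ideal" "Var x * p - q \<in> var_ideal A" by blast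
  have "nf (Var x * p - q) \<in> var_ideal A" using q(2) A(1) by (rule nf_var_ideal)
  then have "Var x * nf p \<in> var_ideal A" using A(2) by (simp add: nf_diff nf_ideal[OF q(1)] nf_Var_mult)
  then have "nf p \<in> var_ideal A" using A(3) by (rule var_ideal_Var_cancel)
  then show "\<exists>q\<in>ideal. p - q \<in> var_ideal A" by (intro bexI[OF _ diff_nf[of p]]) simp
next
  fix p :: "('n, 'k) mpoly" and N assume "d \<le> N" "homogeneous N p"
  then have "nf p \<in> var_ideal {x. \<not> x < z}" by (intro nf_top)
  then show "\<exists>q\<in>ideal. p - q \<in> var_ideal {x. \<not> x < z}" by (intro bexI[OF _ diff_nf[of p]]) simp
qed

end

section \<open>The generic initial ideal of the witness\<close>

text \<open>The notation with \<open>^\<close> would restrict the sort of \<open>'n\<close>.\<close>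

type_synonym ('k, 'n) sqmat = "(('k, 'n) Finite_Cartesian_Product.vec, 'n) Finite_Cartesian_Product.vec"

context witness begin

lemma sum_insert_coeff:
  fixes c :: "'a \<Rightarrow> 'k::comm_ring_1" and h :: "'a \<Rightarrow> ('n, 'k) mpoly"
  assumes "finite A" "a \<in> A"
  shows "(\<Sum>x\<in>A. Const (if x = a then c x + e else c x) * h x) = (\<Sum>x\<in>A. Const (c x) * h x) + Const e * h a"
proof -
  have "(\<Sum>x\<in>A. Const (if x = a then c x + e else c x) * h x) =
      (\<Sum>x\<in>A. Const (c x) * h x + (if x = a then Const e * h a else 0))"
    by (intro sum.cong) (auto simp: Const_add distrib_right)
  then show ?thesis using assms by (simp add: sum.distrib)
qed

text \<open>All generators have degree \<open>d\<close>, so only the constant terms of their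
  coefficients matter in that degree.\<close>

lemma hcomp_ideal:
  assumes "p \<in> ideal"
  shows "\<exists>c. hcomp d p = (\<Sum>a\<in>adm. Const (c a) * gen a)"
  using assms unfolding ideal_def
proof (induction rule: ideal.span_induct_alt)
  case base
  show ?case by (rule exI[of _ "\<lambda>_. 0"]) simp
next
  case (step p x y)
  then obtain a where a: "a \<in> adm" "x = gen a" by blast
  obtain c where c: "hcomp d y = (\<Sum>a\<in>adm. Const (c a) * gen a)" using step.IH by blast
  have "hcomp 0 p = Const (lookup p 0)" by (rule poly_mapping_eqI) (auto simp: lookup_Const)
  then have "hcomp d (p * x + y) = Const (lookup p 0) * gen a + (\<Sum>a\<in>adm. Const (c a) * gen a)"
    unfolding restrict_keys_add a(2) hcomp_mult_homogeneous[OF homogeneous_gen[OF a(1)]] c by simp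
  also have "\<dots> = (\<Sum>x\<in>adm. Const (if x = a then c x + lookup p 0 else c x) * gen x)"
    unfolding sum_insert_coeff[OF finite_adm a(1)] by (rule add.commute)
  finally show ?case
    by (rule exI[where x = "\<lambda>x. if x = a then c x + lookup p 0 else c x"])
qed

text \<open>The coordinate change \<open>x_k -> x_k + c x_u\<close>, at which the open condition for
  \<open>generic_power_not_in_inits\<close> is verified.\<close>

definition transvection :: "'k::comm_ring_1 \<Rightarrow> ('k, 'n) sqmat" where
  "transvection c = (\<chi> i j. if i = j then 1 else if i = u \<and> j = k then c else 0)"

lemma transvection_Var:
  "gl_act (transvection c) (Var j) = (if j = k then Var k + Const c * Var u else Var j)"
proof -
  have "gl_act (transvection c) (Var j) =
      (\<Sum>i\<in>UNIV. (if i = j then Var j else 0) + (if i = u then (if j = k then Const c * Var u else 0) else 0))"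
    unfolding gl_act_Var using u_ne_k by (intro sum.cong refl) (auto simp: transvection_def)
  then show ?thesis by (simp add: sum.distrib)
qed

lemma transvection_inverse: "gl_act (transvection (- 1)) (gl_act (transvection 1) p) = p"
proof (induction p rule: mpoly_induct)
  case (Var i)
  show ?case using u_ne_k
    by (simp add: transvection_Var gl_act_add gl_act_mult gl_act_Const Const_uminus)
qed (simp_all only: gl_act_add gl_act_mult gl_act_Const)

definition above :: "'n monom set" where
  "above = {m. mdeg m = d \<and> \<tau> m (single k d)}"

lemma above_adm: "a \<in> adm \<Longrightarrow> a \<noteq> single k d \<Longrightarrow> a \<in> above"
proof -
  assume a: "a \<in> adm" "a \<noteq> single k d"
  have iz: "i < z" if "lookup a i \<noteq> 0" for i
  proof (rule ccontr)
    assume "\<not> i < z"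
    then show False using a(1) that by (simp add: adm_def)
  qed
  have "\<tau> a (single k d) \<or> a = single k d"
  proof (rule monom_ge_power)
    show "mdeg a = d" using a(1) by (simp add: adm_def)
    show "i \<le> k" if "lookup a i \<noteq> 0" for i using k_max[OF iz[OF that]] .
  qed
  then show "a \<in> above" using a by (simp add: above_def adm_def)
qed

lemma above_mixed: "single u (d - 1) + single z 1 \<in> above"
  unfolding above_def using reversed d_pos by simp

text \<open>
  A combination of the transformed generators without terms above \<open>x\<^sub>k\<^sup>d\<close> is a multiple of
  \<open>x\<^sub>k\<^sup>d - (x\<^sub>u + x\<^sub>k)\<^sup>d\<^sup>-\<^sup>1 x\<^sub>z\<close>, where the term \<open>x\<^sub>u\<^sup>d\<^sup>-\<^sup>1 x\<^sub>z\<close> is above \<open>x\<^sub>k\<^sup>d\<close>.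
\<close>

lemma indep_transvection:
  "indep adm above (\<lambda>a. lookup (gl_act (transvection 1) (gen a :: ('n, 'k::field) mpoly)))"
  unfolding indep_def
proof (intro allI impI)
  fix c :: "'n monom \<Rightarrow> 'k"
  let ?g = "transvection 1 :: ('k, 'n) sqmat"
  assume "\<forall>m\<in>above. (\<Sum>a\<in>adm. c a * lookup (gl_act ?g (gen a)) m) = 0"
  then have c: "lookup (\<Sum>a\<in>adm. Const (c a) * gl_act ?g (gen a)) m = 0" if "m \<in> above" for m
    using that by (simp add: lookup_sum)
  let ?l = "c (single k d)"
  \<comment> \<open>The combination of the admissible monomials themselves. The true combination
    differs from it by the \<open>x_z\<close>-term of the binomial only.\<close>
  define F :: "('n, 'k) mpoly" where "F = (\<Sum>a\<in>adm. single a (c a))"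
  have lF: "lookup F m = (if m \<in> adm then c m else 0)" for m
  proof -
    have "lookup F m = (\<Sum>a\<in>adm. if a = m then c m else 0)"
      unfolding F_def lookup_sum by (intro sum.cong) (auto simp: lookup_single when_def)
    then show ?thesis using finite_adm by simp
  qed
  define H where "H = gl_act ?g F"
  define B :: "('n, 'k) mpoly" where "B = (Var u + Const 1 * Var k) ^ (d - 1)"
  have sum: "(\<Sum>a\<in>adm. Const (c a) * gl_act ?g (gen a)) = H - Const ?l * (Var z * B)"
  proof -
    let ?b = "single k (d - 1) + single z 1 :: 'n monom"
    have "(\<Sum>a\<in>adm. Const (c a) * gen a) =
        (\<Sum>a\<in>adm. single a (c a) - (if a = single k d then Const ?l * single ?b 1 else 0))"
      by (intro sum.cong) (auto simp: gen_def right_diff_distrib Const_mult_single)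
    also have "\<dots> = F - Const ?l * single ?b 1"
      using finite_adm power_in_adm by (simp add: sum_subtractf F_def)
    also have "single ?b 1 = Var z * (Var k :: ('n, 'k) mpoly) ^ (d - 1)"
      unfolding Var_power by (simp add: mult_single Var_def var_monom_def add.commute)
    finally have "gl_act ?g (\<Sum>a\<in>adm. Const (c a) * gen a) = H - Const ?l * (Var z * B)"
      using k_z unfolding H_def B_def
      by (simp add: gl_act_diff gl_act_mult gl_act_power transvection_Var add.commute)
    then show ?thesis by (simp add: gl_act_sum gl_act_mult)
  qed
  have "vars_in {i. i < z} F"
    by (auto simp: vars_in_def lF adm_def split: if_splits)
  then have "vars_in {i. i < z} H"
    unfolding H_def
    by (rule vars_in_gl_act)
      (use u_z k_z in \<open>auto simp: transvection_Var intro!: vars_in_add vars_in_mult vars_in_Const vars_in_Var\<close>)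
  moreover have "homogeneous d H"
    unfolding H_def F_def by (intro homogeneous_gl_act homogeneous_sum homogeneous_single) (simp add: adm_def)
  ultimately have H_adm: "m \<in> adm" if "lookup H m \<noteq> 0" for m
    using that by (auto simp: vars_in_def homogeneous_def adm_def in_keys_iff)
  \<comment> \<open>Admissible monomials other than \<open>x_k^d\<close> lie above
    \<open>x_k^d\<close>, and the subtracted multiple of \<open>x_z\<close> has no admissible
    terms.\<close>
  have H0: "lookup H m = 0" if m: "m \<noteq> single k d" for m
  proof (rule ccontr)
    assume "lookup H m \<noteq> 0"
    then have "m \<in> adm" by (rule H_adm)
    then have "lookup m z = 0" by (simp add: adm_def)
    then have "\<nexists>n. m = var_monom z + n" by (auto simp: lookup_add lookup_var_monom)
    then have "lookup (Var z * B) m = 0" unfolding Var_def by (rule lookup_single_mult_not)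
    then show False
      using c[OF above_adm[OF \<open>m \<in> adm\<close> m]] \<open>lookup H m \<noteq> 0\<close> unfolding sum by (simp add: lookup_minus)
  qed
  have "lookup (Var z * B) (single u (d - 1) + single z 1) = 1"
  proof -
    have "lookup (Var z * B) (var_monom z + single u (d - 1)) = 1"
      unfolding lookup_Var_mult_add B_def by (rule lookup_binomial_power[OF u_ne_k])
    then show ?thesis by (simp add: var_monom_def add.commute)
  qed
  moreover have "lookup H (single u (d - 1) + single z 1) = 0"
  proof (rule H0)
    show "single u (d - 1) + single z 1 \<noteq> single k d"
    proof
      assume "single u (d - 1) + single z 1 = single k d"
      from arg_cong[OF this, of "\<lambda>m. lookup m z"] show False
        using k_z by (auto simp: lookup_add lookup_single when_def split: if_splits)
    qed
  qed
  ultimately have l0: "?l = 0"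
    using c[OF above_mixed] unfolding sum by (simp add: lookup_minus)
  have H: "H = Const (lookup H (single k d)) * Var k ^ d"
    by (rule poly_mapping_eqI) (auto simp: Var_power lookup_single when_def H0)
  \<comment> \<open>Undoing the change shows that \<open>F\<close> is a multiple of
    \<open>(x_k - x_u)^d\<close>. Its coefficient at \<open>x_k^d\<close> is both the multiplier and
    \<open>?l\<close>, which is 0.\<close>
  have "F = gl_act (transvection (- 1)) H" unfolding H_def transvection_inverse ..
  also have "\<dots> = Const (lookup H (single k d)) * (Var k + Const (- 1) * Var u) ^ d"
    by (subst H) (simp add: gl_act_mult gl_act_power transvection_Var)
  finally have F: "F = Const (lookup H (single k d)) * (Var k + Const (- 1) * Var u) ^ d" .
  have "lookup F (single k d) = lookup H (single k d)"
    unfolding F lookup_Const_mult lookup_binomial_power[OF u_ne_k[symmetric]] by simp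
  then have "lookup H (single k d) = 0" using l0 power_in_adm by (simp add: lF)
  then have "F = 0" using F by simp
  then show "\<forall>a\<in>adm. c a = 0" using lF by (metis lookup_zero)
qed

text \<open>By \<open>indep_open\<close> the independence found at one transvection is generic. An
  element with initial monomial \<open>x_k^d\<close> would be, in degree \<open>d\<close>, a
  combination of generators without terms in \<open>above\<close>, hence zero.\<close>

lemma generic_power_not_in_inits:
  "\<exists>q. generic q \<and> (\<forall>g. invertible g \<longrightarrow> q g \<noteq> 0 \<longrightarrow>
     single k d \<notin> inits (gl_act g ` (ideal :: ('n, 'k::field_char_0) mpoly set)))"
proof -
  let ?I = "ideal :: ('n, 'k) mpoly set"
  have gr: "graded_ideal ?I" by (rule homogeneous_ideal_graded[OF homogeneous_ideal])
  have "\<exists>q. polyfun q \<and> q (transvection 1 :: ('k, 'n) sqmat) \<noteq> 0 \<and>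
      (\<forall>g. q g \<noteq> 0 \<longrightarrow> indep adm above (\<lambda>a. lookup (gl_act g (gen a :: ('n, 'k) mpoly))))"
    by (rule indep_open[OF finite_adm polyfun_gl_act indep_transvection])
  then obtain q where q: "polyfun q" "q (transvection 1 :: ('k, 'n) sqmat) \<noteq> 0"
    and ind: "\<And>g. q g \<noteq> 0 \<Longrightarrow> indep adm above (\<lambda>a. lookup (gl_act g (gen a :: ('n, 'k) mpoly)))" by blast
  have "single k d \<notin> inits (gl_act g ` ?I)" if g: "invertible g" "q g \<noteq> 0" for g
  proof
    assume "single k d \<in> inits (gl_act g ` ?I)"
    then have "single k d \<in> inits_deg d (gl_act g ` ?I)"
      using inits_eq_inits_deg[OF graded_ideal_gl_act[OF gr g(1)]] by (metis mdeg_single)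
    then obtain h where h: "h \<in> ?I" "gl_act g h \<noteq> 0" "homogeneous d (gl_act g h)"
      "init_monom \<tau> (gl_act g h) = single k d" by (auto simp: inits_deg_def)
    obtain c where c: "hcomp d h = (\<Sum>a\<in>adm. Const (c a) * gen a)" using hcomp_ideal[OF h(1)] by blast
    have "gl_act g h = gl_act g (hcomp d h)"
      using h(3) by (simp add: hcomp_homogeneous flip: hcomp_gl_act)
    also have "\<dots> = (\<Sum>a\<in>adm. Const (c a) * gl_act g (gen a))"
      unfolding c by (simp add: gl_act_sum gl_act_mult)
    finally have eq: "gl_act g h = (\<Sum>a\<in>adm. Const (c a) * gl_act g (gen a))" .
    have "(\<Sum>a\<in>adm. c a * lookup (gl_act g (gen a)) m) = 0" if m: "m \<in> above" for m
    proof -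
      have t: "\<tau> m (single k d)" using m by (simp add: above_def)
      then have "m \<noteq> single k d" "\<not> \<tau> (single k d) m" using irrefl asym by auto
      then have "lookup (gl_act g h) m = 0"
        using init_monom(2)[OF h(2), of m] by (auto simp: h(4) in_keys_iff)
      then show ?thesis unfolding eq by (simp add: lookup_sum)
    qed
    then have "c a = 0" if "a \<in> adm" for a
      using indepD[OF ind[OF g(2)], where c = c] that by blast
    then show False using h(2) unfolding eq by simp
  qed
  with q show ?thesis unfolding generic_def by blast
qed

section \<open>Linear forms with initial monomial \<open>x_k\<close>\<close>

abbreviation lincomb :: "('n \<Rightarrow> ('n, 'k::comm_ring_1) mpoly) \<Rightarrow> ('n \<Rightarrow> 'k) \<Rightarrow> ('n, 'k) mpoly" where
  "lincomb f c \<equiv> \<Sum>j | j < z. Const (c j) * f j"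

text \<open>The initial monomials of the combinations are among \<open>x\<^sub>1, \<dots>, x\<^sub>k\<close>, and there are \<open>k\<close> of them.\<close>

lemma ex_linear_form:
  fixes f :: "'n \<Rightarrow> ('n, 'k::field_char_0) mpoly"
  assumes hom: "\<And>j. homogeneous 1 (f j)"
    and ind: "indep {j. j < z} (var_monom ` {j. j < z}) (\<lambda>j. lookup (f j))"
  shows "\<exists>c. (lincomb f c) \<noteq> 0 \<and>
    init_monom \<tau> (lincomb f c) = var_monom k"
proof -
  let ?V = "{j. j < z}" and ?T = "{m :: 'n monom. mdeg m = 1}"
  let ?v = "\<lambda>j. lookup (f j)"
  have sub: "var_monom ` ?V \<subseteq> ?T" by auto
  have "indep ?V ?T ?v" using ind sub unfolding indep_def by (meson subsetD)
  then have card: "card (leads \<tau> ?V ?T ?v) = card ?V"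
    by (intro card_leads) (auto simp: finite_monoms_mdeg)
  have "leads \<tau> ?V ?T ?v \<subseteq> var_monom ` ?V"
  proof
    fix m assume "m \<in> leads \<tau> ?V ?T ?v"
    then obtain c where m: "mdeg m = 1" and c: "(\<Sum>j\<in>?V. c j * ?v j m) \<noteq> 0"
      "\<And>m'. mdeg m' = 1 \<Longrightarrow> \<tau> m' m \<Longrightarrow> (\<Sum>j\<in>?V. c j * ?v j m') = 0"
      unfolding leads_def by blast
    have "m \<noteq> 0" using m by auto
    then obtain i n where i: "m = var_monom i + n" by (rule ex_var_monom)
    then have mi: "m = var_monom i" using m by simp
    show "m \<in> var_monom ` ?V"
    proof (rule ccontr)
      assume "m \<notin> var_monom ` ?V"
      then have "\<not> i < z" using mi by blast
      then have "(\<Sum>j\<in>?V. c j * ?v j m') = 0" if "m' \<in> var_monom ` ?V" for m'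
        using that var_gt[of _ i] by (intro c(2)) (auto simp: mi)
      then have "c j = 0" if "j \<in> ?V" for j using indepD[OF ind, where c = c] that by blast
      then show False using c(1) by simp
    qed
  qed
  moreover have "card (var_monom ` ?V) = card ?V"
    by (intro card_image inj_onI) (metis lookup_var_monom zero_neq_one)
  ultimately have "leads \<tau> ?V ?T ?v = var_monom ` ?V"
    using card by (intro card_subset_eq) auto
  then have "var_monom k \<in> leads \<tau> ?V ?T ?v" using k_z by blast
  then obtain c where c: "(\<Sum>j\<in>?V. c j * ?v j (var_monom k)) \<noteq> 0"
    "\<And>m'. mdeg m' = 1 \<Longrightarrow> \<tau> m' (var_monom k) \<Longrightarrow> (\<Sum>j\<in>?V. c j * ?v j m') = 0"
    unfolding leads_def by blast
  define L where "L = (lincomb f c)"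
  have lk: "lookup L m = (\<Sum>j\<in>?V. c j * ?v j m)" for m by (simp add: L_def lookup_sum)
  have "homogeneous 1 L" unfolding L_def by (intro homogeneous_sum homogeneous_Const_mult hom)
  have "init_monom \<tau> L = var_monom k"
  proof (rule init_monom_eqI)
    show "var_monom k \<in> keys L" using c(1) by (simp add: in_keys_iff lk)
    fix m' assume m': "m' \<in> keys L" "m' \<noteq> var_monom k"
    then have "mdeg m' = 1" using \<open>homogeneous 1 L\<close> by (simp add: homogeneous_def)
    then have "\<not> \<tau> m' (var_monom k)" using c(2)[of m'] m'(1) by (auto simp: in_keys_iff lk)
    then show "\<tau> (var_monom k) m'" using total[of "var_monom k" m'] m'(2) by auto
  qed
  moreover have "L \<noteq> 0" using c(1) lk by auto
  ultimately show ?thesis unfolding L_def by blast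
qed

text \<open>A second family of linear forms, suggested by the factor \<open>x_k - x_z\<close> of the
  binomial.\<close>

definition shifted_var :: "'n \<Rightarrow> ('n, 'k::comm_ring_1) mpoly" where
  "shifted_var j = (if j = k then Var k - Var z else Var j)"

lemma homogeneous_shifted_var: "homogeneous 1 (shifted_var j)"
  unfolding shifted_var_def
  by (cases "j = k") (simp_all only: if_True if_False simp_thms homogeneous_Var homogeneous_diff)

text \<open>The critical products are \<open>x_k^d (x_k - x_z)\<close>, which is \<open>x_k\<close>
  times the binomial, and \<open>x_k^d x_j\<close>, which is \<open>x_k\<close> times the monomial
  generator \<open>x_j x_k^(d-1)\<close>.\<close>

lemma single_shifted_var:
  assumes a: "a \<in> adm" and j: "j < z"
  shows "single a 1 * shifted_var j \<in> (ideal :: ('n, 'k::comm_ring_1) mpoly set)"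
proof (cases "a = single k d")
  case False
  then have "shifted_var j * gen a \<in> (ideal :: ('n, 'k) mpoly set)" using a by (intro gen_in)
  then show ?thesis using False by (simp add: gen_def mult.commute)
next
  case True
  have dS: "single k d = var_monom k + single k (d - 1)"
    using d_pos by (cases d) (simp_all add: single_Suc_monom)
  show ?thesis
  proof (cases "j = k")
    case jk: True
    have e: "single k d + var_monom z = var_monom k + (single k (d - 1) + single z 1)"
      unfolding dS by (simp add: var_monom_def add.assoc)
    have 1: "single a 1 * (shifted_var j :: ('n, 'k) mpoly) =
        single (single k d + var_monom k) 1 - single (single k d + var_monom z) 1"
      by (simp add: True jk shifted_var_def Var_def right_diff_distrib mult_single)
    have 2: "Var k * (gen (single k d) :: ('n, 'k) mpoly) =
        single (var_monom k + single k d) 1 - single (var_monom k + (single k (d - 1) + single z 1)) 1"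
      by (simp add: gen_def Var_def right_diff_distrib mult_single)
    have "single a 1 * (shifted_var j :: ('n, 'k) mpoly) = Var k * gen (single k d)"
      unfolding 1 2 e by (simp only: add.commute[of "single k d"])
    then show ?thesis using gen_in[OF power_in_adm, of "Var k"] by simp
  next
    case False
    let ?b = "var_monom j + single k (d - 1)"
    have b: "?b \<in> adm" using j k_z d_pos
      by (auto simp: adm_def lookup_add lookup_var_monom lookup_single when_def)
    have "lookup ?b j \<noteq> lookup (single k d) j"
      using False by (simp add: lookup_add lookup_var_monom lookup_single when_def)
    then have "?b \<noteq> single k d" by auto
    with b have "single (var_monom k + ?b) 1 \<in> (ideal :: ('n, 'k) mpoly set)" by (rule adm_in)
    moreover have "single a 1 * (shifted_var j :: ('n, 'k) mpoly) = single (var_monom k + ?b) 1"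
    proof -
      have "single k d + var_monom j = var_monom k + ?b" unfolding dS by (simp add: ac_simps)
      then show ?thesis using False by (simp add: True shifted_var_def Var_def mult_single)
    qed
    ultimately show ?thesis by simp
  qed
qed

lemma power_mult_in_ideal:
  fixes c e :: "'n \<Rightarrow> 'k::comm_ring_1"
  shows "(lincomb Var c) ^ d * (lincomb shifted_var e) \<in> ideal"
proof -
  define P where "P = (lincomb Var c) ^ d"
  have "homogeneous (d * 1) P"
    unfolding P_def by (intro homogeneous_power homogeneous_sum homogeneous_Const_mult homogeneous_Var)
  moreover have "vars_in {j. j < z} P"
    unfolding P_def by (intro vars_in_power vars_in_sum vars_in_mult vars_in_Const vars_in_Var) auto
  ultimately have keys: "keys P \<subseteq> adm"
    by (auto simp: adm_def homogeneous_def vars_in_def in_keys_iff)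
  have "P * (lincomb shifted_var e) =
      (\<Sum>m\<in>keys P. single m (lookup P m)) * (lincomb shifted_var e)"
    by (simp only: sum_monomials[symmetric])
  also have "\<dots> = (\<Sum>m\<in>keys P. \<Sum>j | j < z. (Const (lookup P m) * Const (e j)) * (single m 1 * shifted_var j))"
    unfolding sum_product
  proof (intro sum.cong refl)
    fix m j
    have "single m (lookup P m) = Const (lookup P m) * single m 1" by (simp add: Const_mult_single)
    then show "single m (lookup P m) * (Const (e j) * shifted_var j) =
        (Const (lookup P m) * Const (e j)) * (single m 1 * shifted_var j)"
      by (simp only: ac_simps)
  qed
  also have "\<dots> \<in> ideal"
    using keys by (intro ideal_sum ideal_mult single_shifted_var) auto
  finally show ?thesis unfolding P_def .
qed

text \<open>The open condition is verified at the identity matrix, where the relevant coefficients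
  form an identity matrix.\<close>

lemma generic_linear_form:
  fixes f :: "'n \<Rightarrow> ('n, 'k::field_char_0) mpoly"
  assumes hom: "\<And>j. homogeneous 1 (f j)"
    and lookup: "\<And>i j. i < z \<Longrightarrow> j < z \<Longrightarrow> lookup (f j) (var_monom i) = (if i = j then 1 else 0)"
  shows "\<exists>q. generic q \<and> (\<forall>g. q g \<noteq> 0 \<longrightarrow> (\<exists>c. gl_act g (lincomb f c) \<noteq> 0 \<and>
    init_monom \<tau> (gl_act g (lincomb f c)) = var_monom k))"
proof -
  let ?V = "{j. j < z}" and ?id = "Finite_Cartesian_Product.mat 1"
  have "indep ?V (var_monom ` ?V) (\<lambda>j. Poly_Mapping.lookup (gl_act ?id (f j)))"
    unfolding indep_def gl_act_one
  proof (intro allI impI ballI)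
    fix c i assume c: "\<forall>m\<in>var_monom ` ?V. (\<Sum>j\<in>?V. c j * Poly_Mapping.lookup (f j) m) = 0" and i: "i \<in> ?V"
    have "(\<Sum>j\<in>?V. c j * Poly_Mapping.lookup (f j) (var_monom i)) = (\<Sum>j\<in>?V. if j = i then c i else 0)"
      using i lookup by (intro sum.cong) auto
    then show "c i = 0" using c i by simp
  qed
  then have "\<exists>q. polyfun q \<and> q ?id \<noteq> 0 \<and>
      (\<forall>g. q g \<noteq> 0 \<longrightarrow> indep ?V (var_monom ` ?V) (\<lambda>j. Poly_Mapping.lookup (gl_act g (f j))))"
    by (intro indep_open polyfun_gl_act) auto
  then obtain q where q: "polyfun q" "q ?id \<noteq> 0"
    and ind: "\<And>g. q g \<noteq> 0 \<Longrightarrow> indep ?V (var_monom ` ?V) (\<lambda>j. Poly_Mapping.lookup (gl_act g (f j)))" by blast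
  have "\<exists>c. gl_act g (lincomb f c) \<noteq> 0 \<and>
      init_monom \<tau> (gl_act g (lincomb f c)) = var_monom k" if "q g \<noteq> 0" for g
    using ex_linear_form[OF homogeneous_gl_act[OF hom] ind[OF that]]
    by (simp add: gl_act_sum gl_act_mult)
  with q show ?thesis unfolding generic_def by blast
qed

lemma init_monom_power:
  fixes L :: "('n, 'k::field) mpoly"
  assumes "L \<noteq> 0" "init_monom \<tau> L = var_monom k"
  shows "L ^ n \<noteq> 0 \<and> init_monom \<tau> (L ^ n) = single k n"
proof (induction n)
  case 0
  have "init_monom \<tau> (1 :: ('n, 'k) mpoly) = 0" by (rule init_monom_eqI) auto
  then show ?case by simp
next
  case (Suc n)
  then show ?case using init_monom_mult[OF assms(1), of "L ^ n"] assms(2) by (simp add: single_Suc_monom)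
qed

text \<open>Both families of linear forms contain, after the change \<open>g\<close>, a combination
  with initial monomial \<open>x_k\<close>. The combinations depend on \<open>g\<close>, but by
  \<open>power_mult_in_ideal\<close> their product lies in the ideal for every choice.\<close>

lemma generic_power_in_inits:
  "\<exists>q. generic q \<and> (\<forall>g. q g \<noteq> 0 \<longrightarrow>
     single k (Suc d) \<in> inits (gl_act g ` (ideal :: ('n, 'k::field_char_0) mpoly set)))"
proof -
  have z: "lookup (Var z :: ('n, 'k) mpoly) (var_monom i) = 0" if "i < z" for i
  proof -
    have "lookup (var_monom z) z \<noteq> lookup (var_monom i) z" using that by (simp add: lookup_var_monom)
    then have "var_monom z \<noteq> var_monom i" by metis
    then show ?thesis by (simp add: Var_def lookup_single)
  qed
  have v: "lookup (Var j :: ('n, 'k) mpoly) (var_monom i) = (if i = j then 1 else 0)" for i j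
  proof -
    have "var_monom j = var_monom i \<longleftrightarrow> i = j" by (metis lookup_var_monom zero_neq_one)
    then show ?thesis by (simp add: Var_def lookup_single)
  qed
  have s: "lookup (shifted_var j :: ('n, 'k) mpoly) (var_monom i) = (if i = j then 1 else 0)" if "i < z" for i j
    using z[OF that] v by (auto simp: shifted_var_def lookup_minus)
  obtain q1 where q1: "generic q1" "\<And>g. q1 g \<noteq> 0 \<Longrightarrow> \<exists>c. gl_act g (lincomb Var c) \<noteq> 0 \<and>
    init_monom \<tau> (gl_act g (lincomb Var c :: ('n, 'k) mpoly)) = var_monom k"
    using generic_linear_form[of Var] homogeneous_Var v by blast
  obtain q2 where q2: "generic q2" "\<And>g. q2 g \<noteq> 0 \<Longrightarrow> \<exists>c. gl_act g (lincomb shifted_var c) \<noteq> 0 \<and>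
    init_monom \<tau> (gl_act g (lincomb shifted_var c :: ('n, 'k) mpoly)) = var_monom k"
    using generic_linear_form[of shifted_var] homogeneous_shifted_var s by blast
  have "single k (Suc d) \<in> inits (gl_act g ` (ideal :: ('n, 'k) mpoly set))" if g: "q1 g * q2 g \<noteq> 0" for g
  proof -
    have "q1 g \<noteq> 0" "q2 g \<noteq> 0" using g by auto
    then obtain c e where
      c: "gl_act g (lincomb Var c) \<noteq> 0"
        "init_monom \<tau> (gl_act g (lincomb Var c :: ('n, 'k) mpoly)) = var_monom k"
      and e: "gl_act g (lincomb shifted_var e) \<noteq> 0"
        "init_monom \<tau> (gl_act g (lincomb shifted_var e :: ('n, 'k) mpoly)) = var_monom k"
      using q1(2) q2(2) by blast
    define p where "p = (lincomb Var c) ^ d * (lincomb shifted_var e)"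
    have gp: "gl_act g p = gl_act g (lincomb Var c) ^ d *
        gl_act g (lincomb shifted_var e)"
      by (simp add: p_def gl_act_mult gl_act_power)
    have pw: "gl_act g (lincomb Var c) ^ d \<noteq> 0"
      "init_monom \<tau> (gl_act g (lincomb Var c) ^ d) = single k d"
      using init_monom_power[OF c] by auto
    have "gl_act g p \<noteq> 0" "init_monom \<tau> (gl_act g p) = single k (Suc d)"
      using init_monom_mult[OF pw(1) e(1)] pw(2) e(2)
      by (simp_all add: gp single_Suc_monom add.commute)
    moreover have "p \<in> ideal" unfolding p_def by (rule power_mult_in_ideal)
    ultimately show ?thesis unfolding inits_def by (auto intro!: exI[of _ "gl_act g p"])
  qed
  with generic_mult[OF q1(1) q2(1)] show ?thesis by blast
qed

text \<open>With equal regularities, \<open>gin\<close> would be generated in degrees up to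
  \<open>d\<close>. Then a term of some generator divides \<open>x_k^(d+1)\<close> and has degree at
  most \<open>d\<close>, so it is a power of \<open>x_k\<close> that divides \<open>x_k^d\<close>,
  and \<open>x_k^d\<close> would be an initial monomial.\<close>

theorem reg_gin_neq_reg:
  "reg (gin \<tau> (ideal :: ('n, 'k::field_char_0) mpoly set)) \<noteq> reg (ideal :: ('n, 'k) mpoly set)"
proof
  let ?I = "ideal :: ('n, 'k) mpoly set"
  assume eq: "reg (gin \<tau> ?I) = reg ?I"
  have gr: "graded_ideal ?I" by (rule homogeneous_ideal_graded[OF homogeneous_ideal])
  obtain q1 where q1: "generic q1"
    "\<And>g. invertible g \<Longrightarrow> q1 g \<noteq> 0 \<Longrightarrow> init_ideal \<tau> (gl_act g ` ?I) = gin \<tau> ?I"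
    using init_ideal_gin[OF gr] by blast
  obtain q2 where q2: "generic q2"
    "\<And>g. invertible g \<Longrightarrow> q2 g \<noteq> 0 \<Longrightarrow> single k d \<notin> inits (gl_act g ` ?I)"
    using generic_power_not_in_inits by blast
  obtain q3 where q3: "generic q3" "\<And>g. q3 g \<noteq> 0 \<Longrightarrow> single k (Suc d) \<in> inits (gl_act g ` ?I)"
    using generic_power_in_inits by blast
  obtain g where g: "invertible g" "q1 g * (q2 g * q3 g) \<noteq> 0"
    using generic_invertible[OF generic_mult[OF q1(1) generic_mult[OF q2(1) q3(1)]]] by blast
  then have ne: "q1 g \<noteq> 0" "q2 g \<noteq> 0" "q3 g \<noteq> 0" by auto
  let ?M = "inits (gl_act g ` ?I)" and ?J = "gin \<tau> ?I"
  have gI: "graded_ideal (gl_act g ` ?I)" by (rule graded_ideal_gl_act[OF gr g(1)])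
  have J: "?J = ideal_gen ((\<lambda>m. single m 1) ` ?M)"
    using q1(2)[OF g(1) ne(1)] by (simp add: init_ideal_eq)
  have "homogeneous_ideal ?J"
    unfolding homogeneous_ideal_def
  proof (intro exI conjI)
    show "?J = ideal_gen ((\<lambda>m. single m 1) ` ?M)" by (rule J)
    show "\<forall>f\<in>(\<lambda>m. single m 1) ` ?M. \<exists>d. homogeneous d f" by (auto intro: homogeneous_single)
  qed
  then have grJ: "graded_ideal ?J" by (rule homogeneous_ideal_graded)
  have "single (single k (Suc d)) 1 \<in> ?J"
    unfolding J using q3(2)[OF ne(3)] by (intro ideal.span_base imageI)
  from generated_in_degree_le_reg[OF grJ this] obtain t and f v :: "nat \<Rightarrow> ('n, 'k) mpoly" where
    sum: "single (single k (Suc d)) 1 = (\<Sum>i<t. f i * v i)"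
    and f: "\<And>i. i < t \<Longrightarrow> f i \<in> ?J" "\<And>i. i < t \<Longrightarrow> \<exists>e\<le>reg ?J. homogeneous e (f i)" by blast
  have "(\<Sum>i<t. lookup (f i * v i) (single k (Suc d))) = 1"
    using arg_cong[OF sum, of "\<lambda>p. lookup p (single k (Suc d))"] by (simp add: lookup_sum)
  then obtain i where i: "i < t" "lookup (f i * v i) (single k (Suc d)) \<noteq> 0"
    by (metis (no_types, lifting) lessThan_iff sum.neutral zero_neq_one)
  then obtain l n where ln: "single k (Suc d) = l + n" "l \<in> keys (f i)"
    using keys_mult[of "f i" "v i"] by (auto simp: in_keys_iff[symmetric])
  obtain e where e: "e \<le> reg ?J" "homogeneous e (f i)" using f(2)[OF i(1)] by blast
  have "mdeg l \<le> d" using e ln(2) eq reg_ideal_le[where 'k = 'k] by (auto simp: homogeneous_def)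
  have "lookup l j = 0" if "j \<noteq> k" for j
    using arg_cong[OF ln(1), of "\<lambda>m. lookup m j"] that by (simp add: lookup_add lookup_single when_def)
  then have l: "l = single k (lookup l k)"
    by (intro poly_mapping_eqI) (auto simp: lookup_single when_def)
  have "lookup l k \<le> d" using \<open>mdeg l \<le> d\<close> lookup_le_mdeg[of l k] by simp
  obtain m m' where m: "m \<in> ?M" "l = m + m'"
    using keys_monomial_ideal[of "f i" ?M l] f(1)[OF i(1)] ln(2) unfolding J by (auto simp: in_keys_iff)
  have "single k d = single k (d - lookup l k) + l"
    using \<open>lookup l k \<le> d\<close> by (subst l) (simp flip: single_add)
  then have "single k d = (single k (d - lookup l k) + m') + m" using m(2) by (simp add: ac_simps)
  then have "single k d \<in> ?M" using inits_add[OF gI m(1)] by simp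
  then show False using q2(2)[OF g(1) ne(2)] by blast
qed

end

theorem corollary4p6:
  fixes \<tau> :: "'n::{finite, linorder} monom \<Rightarrow> 'n monom \<Rightarrow> bool"
  assumes "monomial_order \<tau>"
    and "\<And>I :: ('n, 'k::{alg_closed_field, field_char_0}) mpoly set.
           homogeneous_ideal I \<Longrightarrow> reg (gin \<tau> I) = reg I"
  shows "\<tau> = rlex"
proof (rule ccontr)
  assume ne: "\<tau> \<noteq> rlex"
  interpret mono_order \<tau> using assms(1) by unfold_locales
  obtain u k z d where "u \<noteq> k" "u < z" "k < z" "\<And>j. j < z \<Longrightarrow> j \<le> k" "0 < d"
    "\<tau> (single u (d - 1) + single z 1) (single k d)"
    using not_rlex_witness[OF ne] by blast
  then interpret witness \<tau> u k z d by unfold_locales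
  show False using reg_gin_neq_reg[where 'k = 'k] assms(2)[OF homogeneous_ideal] by blast
qed

end
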